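(* For every $k\ge2$ there exist constants $c_k,C_k,D_k>0$ such that the following holds for all $n$ large enough (depending only on $k$). Let $Z=(z_1,\dots,z_k)\in\mathbb{C}^k$ have pairwise distinct entries and let $\{1,\dots,k\}=I\sqcup J$ be a partition into two non-empty sets such that $d(Z_I,Z_J)\ge D_k/\sqrt n$. Then $$\big|\rho(Z)-\rho(Z_I)\,\rho(Z_J)\big|\le C_k\,n^k\,e^{-c_k\,n\,d(Z_I,Z_J)^2},$$ where $\rho$ denotes the $k$-, $|I|$- and $|J|$-point functions, respectively, of the zero set of $f_n$.
   Context: For $n\ge1$, $f_n(z)=\sum_{j=0}^n a_j\sqrt{\binom nj}\,z^j$, where $a_0,\dots,a_n$ are i.i.d. standard complex Gaussians (density $\frac1\pi e^{-|z|^2}$ on $\mathbb{C}$), and $\mathcal{Z}_n$ is its zero set. The $k$-point function of $\mathcal{Z}_n$ is the symmetric function $\rho=\rho_k$ on $k$-tuples of pairwise distinct complex numbers, with values in $\mathbb{R}_{\ge0}$, defined by $$\mathbb{E}\Big[\prod_{j=1}^k\#(\mathcal{Z}_n\cap B_j)\Big]=\int_{B_1\times\cdots\times B_k}\rho(z_1,\dots,z_k)\,dm(z_1)\cdots dm(z_k)$$ for all families of disjoint Borel sets $B_1,\dots,B_k\subset\mathbb{C}$, where $m$ is Lebesgue measure on $\mathbb{C}$ (for each fixed $k$ it exists for all $n$ large enough; the continuous version, given by the Kac–Rice formula $\rho(z_1,\dots,z_k)=\mathbb{E}[\prod_j|f_n'(z_j)|^2\mid f_n(z_1)=\dots=f_n(z_k)=0]/(\pi^k\det[\mathrm{Cov}(f_n(z_1),\dots,f_n(z_k))])$,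 is used). For $I=\{i_1,\dots,i_\ell\}$, $Z_I=(z_{i_1},\dots,z_{i_\ell})$, and $Z_J$ is defined analogously. The distance is $d(Z_I,Z_J)=\min_{i\in I,\,j\in J}d_{\mathbb{S}^2}(z_i,z_j)$ with $d_{\mathbb{S}^2}(z,w)=\frac{2|z-w|}{\sqrt{1+|z|^2}\sqrt{1+|w|^2}}$. *)

theory Defs
  imports "HOL-Probability.Probability"
begin

definition std_complex_gaussian :: "complex measure" where
  "std_complex_gaussian = density lborel (\<lambda>z. ennreal (exp (- (cmod z)\<^sup>2) / pi))"

text \<open>The joint law of the i.i.d. coefficients \<open>a 0, \<dots>, a n\<close>.\<close>

definition coeff_law :: "nat \<Rightarrow> (nat \<Rightarrow> complex) measure" where
  "coeff_law n = PiM {..n} (\<lambda>_. std_complex_gaussian)"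

definition gauss_poly :: "nat \<Rightarrow> (nat \<Rightarrow> complex) \<Rightarrow> complex \<Rightarrow> complex" where
  "gauss_poly n a z = (\<Sum>j\<le>n. a j * of_real (sqrt (real (n choose j))) * z ^ j)"

definition zero_set :: "nat \<Rightarrow> (nat \<Rightarrow> complex) \<Rightarrow> complex set" where
  "zero_set n a = {z. gauss_poly n a z = 0}"

text \<open>
  Tuples of points are lists, so one function \<open>\<rho>\<close> can carry the point functions of all orders;
  \<open>is_point_function n k \<rho>\<close> constrains it only on lists of \<open>k\<close> pairwise distinct points.

  The integral identity determines \<open>\<rho>\<close> only almost everywhere; the continuity condition selects
  the continuous version. It is stated on \<open>nat \<Rightarrow> complex\<close> with the product topology, where
  \<open>\<lambda>z. \<rho> (map z [0..<k])\<close> depends on the first \<open>k\<close> coordinates only, so it is continuity on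
  the open set of \<open>k\<close>-tuples with distinct entries.

  The number of zeros is taken without multiplicity. The exceptional case of infinitely many zeros,
  where \<open>card\<close> returns 0, is the null event that all coefficients vanish.
\<close>

definition is_point_function :: "nat \<Rightarrow> nat \<Rightarrow> (complex list \<Rightarrow> real) \<Rightarrow> bool" where
  "is_point_function n k \<rho> \<longleftrightarrow>
     (\<forall>Z. length Z = k \<and> distinct Z \<longrightarrow> 0 \<le> \<rho> Z) \<and>
     (\<forall>Z W. length Z = k \<and> distinct Z \<and> mset W = mset Z \<longrightarrow> \<rho> W = \<rho> Z) \<and>
     continuous_on {z. inj_on z {..<k}} (\<lambda>z. \<rho> (map z [0..<k])) \<and>
     (\<forall>B. (\<forall>j<k. B j \<in> sets borel) \<and> disjoint_family_on B {..<k} \<longrightarrow>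
        (\<integral>\<^sup>+ a. (\<Prod>j<k. of_nat (card (zero_set n a \<inter> B j))) \<partial>coeff_law n) =
        (\<integral>\<^sup>+ z \<in> PiE {..<k} B. ennreal (\<rho> (map z [0..<k])) \<partial>PiM {..<k} (\<lambda>_. lborel)))"

definition sphere_dist :: "complex \<Rightarrow> complex \<Rightarrow> real" where
  "sphere_dist z w = 2 * cmod (z - w) / (sqrt (1 + (cmod z)\<^sup>2) * sqrt (1 + (cmod w)\<^sup>2))"

definition tuple_dist :: "complex list \<Rightarrow> complex list \<Rightarrow> real" where
  "tuple_dist Z W = Min ((\<lambda>(z, w). sphere_dist z w) ` (set Z \<times> set W))"

end

theory Submission
  imports Defs "HOL-Complex_Analysis.Conformal_Mappings"
begin

text \<open>
  Applying the area formula to one root at a time (divide the polynomial by \<open>X - z\<close>) yields the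
  Kac--Rice density in the form \<open>J / T\<close>, where \<open>J\<close> and \<open>T\<close> are integrals of \<open>exp (- q)\<close> with and
  without the factor \<open>\<Prod> |u j|\<^sup>2\<close>, and \<open>q\<close> is the quadratic form assigning to the jets
  \<open>(v j, u j)\<close> at the points \<open>z j\<close> the least squared norm of a polynomial of degree at most \<open>n\<close>
  having these jets. For two distant groups of points this form is \<open>1 \<plusminus> O(\<epsilon>)\<close> times the sum of the
  forms of the groups, with \<open>\<epsilon> = O(exp (- c n d\<^sup>2))\<close>. Indeed, the spans of the reproducing kernels of
  the two groups are almost orthogonal: by a Schwarz lemma and Newton polynomials localised at
  scale \<open>1 / sqrt n\<close>, the jets of a polynomial at a group can be interpolated by one whose norm is
  controlled by the values near that group, with constants independent of the mutual distances
  inside the group. Homogeneity then gives \<open>\<rho> Z = \<rho> X * \<rho> Y * (1 + O(\<epsilon>))\<close>, and the same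
  interpolation gives \<open>\<rho> \<le> K n ^ k\<close>.
\<close>

subsection \<open>Counting zeros and the area formula\<close>

text \<open>Points inside a group may be arbitrarily close. Then the covariance determinants
  degenerate, inverse Gram matrices have no uniform bound, and entrywise estimates of the covariance
  are useless. This is why subspaces and quadratic forms are compared: only the angle between the
  two spans enters, and \<open>J\<close> and \<open>T\<close> may both degenerate while their ratio
  is compared up to a factor. The decay originates in the normalised kernel of two points at
  spherical distance \<open>d\<close>, which is \<open>(1 - d^2 / 4) powr (n / 2)\<close>, hence at
  most \<open>exp (- n d^2 / 8)\<close>. Controlling polynomials on circles of radius
  \<open>1 / sqrt n\<close> about the points costs half of this exponent, and halving the distance
  as a safety margin costs another factor 4, which gives \<open>c = 1 / 64\<close>. The area formula
  determines the density only up to null sets, while \<rho> is the continuous version. Continuity of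
  \<open>J / T\<close> is never established: the estimates are multiplicative and survive
  integration over products of small discs, after which the continuity of \<rho> suffices.\<close>

definition pm :: "complex poly measure" where
  "pm = vimage_algebra UNIV coeff (PiM UNIV (\<lambda>_. borel))"

lemma space_pm [simp]: "space pm = UNIV"
  by (simp add: pm_def)

lemma measurable_coeff [measurable]: "(\<lambda>p. coeff p j) \<in> borel_measurable pm"
proof -
  have "coeff \<in> measurable pm (PiM UNIV (\<lambda>_. borel))"
    unfolding pm_def by (rule measurable_vimage_algebra1) (simp add: space_PiM)
  then show ?thesis
    by (rule measurable_compose) (rule measurable_component_singleton, simp)
qed

text \<open>\<open>pm\<close> is generated by all coefficients at once, without a degree bound.
  Sums, products, derivatives and shifts of random polynomials therefore live in one measurable
  space.\<close>

lemma measurable_pmI: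
  assumes "\<And>j. (\<lambda>x. coeff (f x) j) \<in> borel_measurable M"
  shows "f \<in> measurable M pm"
  unfolding pm_def
proof (rule measurable_vimage_algebra2)
  show "(\<lambda>x. coeff (f x)) \<in> measurable M (PiM UNIV (\<lambda>_. borel))"
    by (rule measurable_PiM_single') (use assms in \<open>auto\<close>)
qed simp

lemma measurable_pm_add [measurable (raw)]:
  assumes [measurable]: "f \<in> measurable M pm" "g \<in> measurable M pm"
  shows "(\<lambda>x. f x + g x) \<in> measurable M pm"
  by (rule measurable_pmI) simp

lemma measurable_pm_diff [measurable (raw)]:
  assumes [measurable]: "f \<in> measurable M pm" "g \<in> measurable M pm"
  shows "(\<lambda>x. f x - g x) \<in> measurable M pm"
  by (rule measurable_pmI) simp

lemma measurable_pm_mult [measurable (raw)]: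
  assumes [measurable]: "f \<in> measurable M pm" "g \<in> measurable M pm"
  shows "(\<lambda>x. f x * g x) \<in> measurable M pm"
  by (rule measurable_pmI) (simp add: coeff_mult)

lemma measurable_pm_smult [measurable (raw)]:
  assumes [measurable]: "f \<in> borel_measurable M" "g \<in> measurable M pm"
  shows "(\<lambda>x. smult (f x) (g x)) \<in> measurable M pm"
  by (rule measurable_pmI) simp

lemma measurable_pm_pCons [measurable (raw)]:
  assumes [measurable]: "f \<in> borel_measurable M" "g \<in> measurable M pm"
  shows "(\<lambda>x. pCons (f x) (g x)) \<in> measurable M pm"
proof (rule measurable_pmI)
  fix j show "(\<lambda>x. coeff (pCons (f x) (g x)) j) \<in> borel_measurable M"
    by (cases j) simp_all
qed

lemma measurable_pm_pderiv [measurable (raw)]: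
  assumes [measurable]: "f \<in> measurable M pm"
  shows "(\<lambda>x. pderiv (f x)) \<in> measurable M pm"
  by (rule measurable_pmI) (simp add: coeff_pderiv)

lemma measurable_pm_shift [measurable (raw)]:
  assumes [measurable]: "f \<in> measurable M pm"
  shows "(\<lambda>x. poly_shift n (f x)) \<in> measurable M pm"
  by (rule measurable_pmI) (simp add: coeff_poly_shift)

lemma measurable_pm_sum [measurable (raw)]:
  assumes "\<And>i. i \<in> A \<Longrightarrow> f i \<in> measurable M pm"
  shows "(\<lambda>x. \<Sum>i\<in>A. f i x) \<in> measurable M pm"
  by (rule measurable_pmI) (use assms in \<open>auto simp: coeff_sum intro!: borel_measurable_sum\<close>)

lemma measurable_pm_prod [measurable (raw)]:
  assumes "\<And>i. i \<in> A \<Longrightarrow> f i \<in> measurable M pm"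
  shows "(\<lambda>x. \<Prod>i\<in>A. f i x) \<in> measurable M pm"
  using assms by (induction A rule: infinite_finite_induct) simp_all

text \<open>The degree varies with the argument, so no fixed finite sum represents the value. It is
  the pointwise limit of the sums over \<open>{..N}\<close>, which are constant from the degree
  on.\<close>

lemma measurable_pm_poly [measurable (raw)]:
  assumes [measurable]: "f \<in> measurable M pm" "g \<in> borel_measurable M"
  shows "(\<lambda>x. poly (f x) (g x)) \<in> borel_measurable M"
proof (rule borel_measurable_LIMSEQ_metric)
  fix x
  have "\<forall>\<^sub>F N in sequentially. (\<Sum>j\<le>N. coeff (f x) j * g x ^ j) = poly (f x) (g x)"
    unfolding eventually_sequentially
  proof (intro exI allI impI)
    fix N assume "N \<ge> degree (f x)"
    then show "(\<Sum>j\<le>N. coeff (f x) j * g x ^ j) = poly (f x) (g x)"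
      unfolding poly_altdef by (intro sum.mono_neutral_right) (auto simp: coeff_eq_0)
  qed
  then show "(\<lambda>N. \<Sum>j\<le>N. coeff (f x) j * g x ^ j) \<longlonglongrightarrow> poly (f x) (g x)"
    by (rule tendsto_eventually)
qed measurable

text \<open>By compactness a zero in \<open>K\<close> exists as soon as the polynomial takes
  arbitrarily small values on \<open>K\<close>, and by continuity these can be tested on a countable
  dense subset.\<close>

lemma pred_poly_zero_in_compact:
  assumes [measurable]: "f \<in> measurable M pm" and K: "compact K"
  shows "Measurable.pred M (\<lambda>x. \<exists>z\<in>K. poly (f x) z = 0)"
proof (cases "K = {}")
  case False
  obtain D where D: "countable D" "D \<subseteq> K" "K \<subseteq> closure D"
    using separable[of K] by blast
  have eq: "(\<exists>z\<in>K. poly p z = 0) \<longleftrightarrow> (\<forall>m. \<exists>q\<in>D. cmod (poly p q) < 1 / real (Suc m))" for p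
  proof
    assume "\<exists>z\<in>K. poly p z = 0"
    then obtain z where z: "z \<in> K" "poly p z = 0" by blast
    show "\<forall>m. \<exists>q\<in>D. cmod (poly p q) < 1 / real (Suc m)"
    proof
      fix m
      have "isCont (poly p) z" by simp
      then obtain d where d: "d > 0" "\<And>q. dist q z < d \<Longrightarrow> dist (poly p q) (poly p z) < 1 / real (Suc m)"
        unfolding continuous_at_eps_delta by (metis of_nat_0_less_iff zero_less_Suc zero_less_divide_1_iff)
      obtain q where "q \<in> D" "dist q z < d"
        using D(3) z(1) d(1) closure_approachable by blast
      then show "\<exists>q\<in>D. cmod (poly p q) < 1 / real (Suc m)"
        using d(2)[of q] z(2) by (auto simp: dist_norm)
    qed
  next
    assume R: "\<forall>m. \<exists>q\<in>D. cmod (poly p q) < 1 / real (Suc m)"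
    have "continuous_on K (\<lambda>z. cmod (poly p z))"
      by (intro continuous_intros)
    then obtain z0 where z0: "z0 \<in> K" "\<forall>z\<in>K. cmod (poly p z0) \<le> cmod (poly p z)"
      using continuous_attains_inf[OF K False] by blast
    have "cmod (poly p z0) = 0"
    proof (rule ccontr)
      assume "cmod (poly p z0) \<noteq> 0"
      then have "cmod (poly p z0) > 0" by simp
      then obtain m where "1 / real (Suc m) < cmod (poly p z0)"
        using nat_approx_posE by blast
      then show False using R z0(2) D(2) by (meson order.strict_trans not_le subsetD)
    qed
    then show "\<exists>z\<in>K. poly p z = 0" using z0(1) by auto
  qed
  have "Measurable.pred M (\<lambda>x. \<forall>m. \<exists>q\<in>D. cmod (poly (f x) q) < 1 / real (Suc m))"
    using D(1) by (intro pred_intros_countable pred_intros_countable_bounded) auto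
  then show ?thesis unfolding eq .
qed simp

definition rational_cballs :: "complex set set" where
  "rational_cballs = {cball c e | c e. Re c \<in> \<rat> \<and> Im c \<in> \<rat> \<and> e \<in> \<rat>}"

lemma countable_rational_cballs: "countable rational_cballs"
proof -
  have "rational_cballs \<subseteq> (\<lambda>(a,b,e). cball (Complex a b) e) ` (\<rat> \<times> \<rat> \<times> \<rat>)"
  proof
    fix K assume "K \<in> rational_cballs"
    then obtain c e where "Re c \<in> \<rat>" "Im c \<in> \<rat>" "e \<in> \<rat>" "K = cball c e"
      by (auto simp: rational_cballs_def)
    then show "K \<in> (\<lambda>(a,b,e). cball (Complex a b) e) ` (\<rat> \<times> \<rat> \<times> \<rat>)"
      by (intro image_eqI[of _ _ "(Re c, Im c, e)"]) auto
  qed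
  then show ?thesis by (rule countable_subset) (auto simp: countable_rat)
qed

lemma compact_rational_cballs: "K \<in> rational_cballs \<Longrightarrow> compact K"
  by (auto simp: rational_cballs_def)

lemma rational_cball_in_ball:
  assumes "d > 0"
  obtains K where "K \<in> rational_cballs" "s \<in> K" "K \<subseteq> ball s d"
proof -
  obtain e where e: "e \<in> \<rat>" "0 < e" "e < d / 4" using Rats_dense_in_real[of 0 "d/4"] assms by auto
  obtain a where a: "a \<in> \<rat>" "Re s < a" "a < Re s + e/2" using Rats_dense_in_real[of "Re s" "Re s + e/2"] e by auto
  obtain b where b: "b \<in> \<rat>" "Im s < b" "b < Im s + e/2" using Rats_dense_in_real[of "Im s" "Im s + e/2"] e by auto
  have dd: "dist (Complex a b) s \<le> e"
    using cmod_le[of "Complex a b - s"] a b by (simp add: dist_norm)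
  have "cball (Complex a b) e \<subseteq> ball s d"
  proof
    fix x assume "x \<in> cball (Complex a b) e"
    then have "dist s x \<le> e + e" using dd by (metis add_mono dist_commute dist_triangle_le mem_cball)
    then show "x \<in> ball s d" using e by auto
  qed
  moreover have "s \<in> cball (Complex a b) e" using dd by simp
  moreover have "cball (Complex a b) e \<in> rational_cballs"
    unfolding rational_cballs_def using a(1) b(1) e(1)
    by (intro CollectI exI[of _ "Complex a b"] exI[of _ e]) simp
  ultimately show ?thesis by (intro that)
qed

text \<open>Finitely many distinct zeros can be enclosed in pairwise disjoint discs of the countable
  family inside \<open>B\<close>; conversely, disjoint discs pick distinct zeros. The count thus
  reduces to countably many events already known to be measurable.\<close>

lemma card_zeros_ge_iff:
  fixes p :: "complex poly"
  assumes p: "p \<noteq> 0" and B: "open B"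
  defines "Q \<equiv> {K \<in> rational_cballs. K \<subseteq> B}"
  shows "r \<le> card ({z. poly p z = 0} \<inter> B) \<longleftrightarrow>
    (\<exists>T\<in>{T. finite T \<and> T \<subseteq> Q \<and> disjoint T \<and> card T = r}. \<forall>K\<in>T. \<exists>z\<in>K. poly p z = 0)"
proof
  have fin: "finite ({z. poly p z = 0} \<inter> B)" using poly_roots_finite[OF p] by auto
  {
    assume "r \<le> card ({z. poly p z = 0} \<inter> B)"
    then obtain S where S: "S \<subseteq> {z. poly p z = 0} \<inter> B" "card S = r" "finite S"
      by (meson obtain_subset_with_card_n)
    have "\<exists>d>0. \<forall>s\<in>S. ball s d \<subseteq> B \<and> (\<forall>t\<in>S. t \<noteq> s \<longrightarrow> 2 * d \<le> dist s t)"
    proof -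
      have "\<exists>d>0. \<forall>s\<in>S. ball s d \<subseteq> B"
        using S(3) S(1)
      proof (induction S rule: finite_induct)
        case empty then show ?case by (auto intro: exI[of _ 1])
      next
        case (insert s S)
        then obtain d where d: "d > 0" "\<forall>s\<in>S. ball s d \<subseteq> B" by auto
        obtain e where "e > 0" "ball s e \<subseteq> B" using insert.prems B openE by blast
        with d show ?case by (intro exI[of _ "min d e"]) (auto simp: subset_iff)
      qed
      then obtain d where d: "d > 0" "\<forall>s\<in>S. ball s d \<subseteq> B" by blast
      have "\<exists>e>0. \<forall>s\<in>S. \<forall>t\<in>S. t \<noteq> s \<longrightarrow> e \<le> dist s t"
      proof -
        define D where "D = insert 1 {dist s t | s t. s \<in> S \<and> t \<in> S \<and> s \<noteq> t}"
        have "D \<subseteq> insert 1 ((\<lambda>(s,t). dist s t) ` (S \<times> S))" by (auto simp: D_def)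
        then have "finite D" using S(3) finite_subset by (metis finite_SigmaI finite_imageI finite_insert)
        moreover have "\<forall>x\<in>D. x > 0" by (auto simp: D_def)
        ultimately have "Min D > 0" by (subst Min_gr_iff) (auto simp: D_def)
        moreover have "\<forall>s\<in>S. \<forall>t\<in>S. t \<noteq> s \<longrightarrow> Min D \<le> dist s t"
          using \<open>finite D\<close> by (auto simp: D_def intro!: Min_le)
        ultimately show ?thesis by blast
      qed
      then obtain e where e: "e > 0" "\<forall>s\<in>S. \<forall>t\<in>S. t \<noteq> s \<longrightarrow> e \<le> dist s t" by blast
      show ?thesis
      proof (intro exI[of _ "min d (e/2)"] conjI ballI impI)
        show "min d (e/2) > 0" using d e by simp
        show "ball s (min d (e/2)) \<subseteq> B" if "s \<in> S" for s
          using d(2) that by (meson min.cobounded1 order_trans subset_ball)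
        show "2 * min d (e/2) \<le> dist s t" if "s \<in> S" "t \<in> S" "t \<noteq> s" for s t
        proof -
          have "e \<le> dist s t" using e(2) that by blast
          then show ?thesis by linarith
        qed
      qed
    qed
    then obtain d where d: "d > 0" "\<And>s. s \<in> S \<Longrightarrow> ball s d \<subseteq> B"
      "\<And>s t. s \<in> S \<Longrightarrow> t \<in> S \<Longrightarrow> t \<noteq> s \<Longrightarrow> 2 * d \<le> dist s t" by blast
    have "\<exists>K\<in>Q. s \<in> K \<and> K \<subseteq> ball s d" if "s \<in> S" for s
    proof -
      obtain K where "K \<in> rational_cballs" "s \<in> K" "K \<subseteq> ball s d"
        using rational_cball_in_ball[OF d(1)] .
      then show ?thesis using d(2)[OF that] unfolding Q_def by auto
    qed
    then obtain K where K: "\<And>s. s \<in> S \<Longrightarrow> K s \<in> Q \<and> s \<in> K s \<and> K s \<subseteq> ball s d" by metis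
    have dj: "K s \<inter> K t = {}" if "s \<in> S" "t \<in> S" "s \<noteq> t" for s t
    proof -
      have "ball s d \<inter> ball t d = {}"
        by (rule disjoint_ballI) (use d(3)[of t s] that in \<open>auto simp: dist_commute\<close>)
      then show ?thesis using K that by blast
    qed
    have inj: "inj_on K S" using dj K by (intro inj_onI) blast
    have dT: "disjoint (K ` S)" using dj by (auto simp: disjoint_def)
    show "\<exists>T\<in>{T. finite T \<and> T \<subseteq> Q \<and> disjoint T \<and> card T = r}. \<forall>K\<in>T. \<exists>z\<in>K. poly p z = 0"
      using S K inj dT by (intro bexI[of _ "K ` S"]) (auto simp: card_image)
  next
    assume "\<exists>T\<in>{T. finite T \<and> T \<subseteq> Q \<and> disjoint T \<and> card T = r}. \<forall>K\<in>T. \<exists>z\<in>K. poly p z = 0"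
    then obtain T where T: "finite T" "T \<subseteq> Q" "disjoint T" "card T = r" "\<forall>K\<in>T. \<exists>z\<in>K. poly p z = 0" by auto
    then obtain s where s: "\<And>K. K \<in> T \<Longrightarrow> s K \<in> K \<and> poly p (s K) = 0" by metis
    have "inj_on s T"
      using s T(3) by (intro inj_onI) (metis disjointD disjoint_iff)
    moreover have "s ` T \<subseteq> {z. poly p z = 0} \<inter> B" using s T(2) by (fastforce simp: Q_def)
    ultimately show "r \<le> card ({z. poly p z = 0} \<inter> B)"
      using card_inj_on_le[of s T] fin T(4) by blast
  }
qed

lemma measurable_card_zeros:
  assumes [measurable]: "f \<in> measurable M pm" and B: "open B"
  shows "(\<lambda>x. card ({z. poly (f x) z = 0} \<inter> B)) \<in> measurable M (count_space UNIV)"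
proof -
  define Q where "Q = {K \<in> rational_cballs. K \<subseteq> B}"
  have cQ: "countable Q" by (rule countable_subset[OF _ countable_rational_cballs]) (auto simp: Q_def)
  have cpt: "compact K" if "K \<in> Q" for K using that compact_rational_cballs by (auto simp: Q_def)
  \<comment> \<open>The zero polynomial vanishes on all of \<open>B\<close>, which is open and hence
    empty or infinite; \<open>card\<close> is 0 in both cases.\<close>
  have z: "card ({z. poly 0 z = 0} \<inter> B) = 0"
    using B finite_imp_not_open[of B] by (auto simp: card_eq_0_iff)
  have "Measurable.pred M (\<lambda>x. r \<le> card ({z. poly (f x) z = 0} \<inter> B))" for r
  proof -
    have eq: "r \<le> card ({z. poly p z = 0} \<inter> B) \<longleftrightarrow> (if (\<forall>j. coeff p j = 0) then r = 0 else
      (\<exists>T\<in>{T. finite T \<and> T \<subseteq> Q \<and> disjoint T \<and> card T = r}. \<forall>K\<in>T. \<exists>z\<in>K. poly p z = 0))" for p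
    proof (cases "p = 0")
      case True then show ?thesis using z by simp
    next
      case False
      then have "\<not> (\<forall>j. coeff p j = 0)" by (simp add: poly_eq_iff)
      then show ?thesis using card_zeros_ge_iff[OF False B, of r] unfolding Q_def by (simp only: if_False)
    qed
    show ?thesis
    proof -
      have c: "countable {T. finite T \<and> T \<subseteq> Q \<and> disjoint T \<and> card T = r}"
        by (rule countable_subset[OF _ countable_Collect_finite_subset[OF cQ]]) auto
      have "Measurable.pred M (\<lambda>x. \<exists>T\<in>{T. finite T \<and> T \<subseteq> Q \<and> disjoint T \<and> card T = r}. \<forall>K\<in>T. \<exists>z\<in>K. poly (f x) z = 0)"
        unfolding pred_def
      proof (rule sets.sets_Collect_countable_Ex'[OF _ c])
        fix T assume "T \<in> {T. finite T \<and> T \<subseteq> Q \<and> disjoint T \<and> card T = r}"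
        then have "Measurable.pred M (\<lambda>x. \<forall>K\<in>T. \<exists>z\<in>K. poly (f x) z = 0)"
          using cpt by (intro pred_intros_finite pred_poly_zero_in_compact assms) auto
        then show "{x \<in> space M. \<forall>K\<in>T. \<exists>z\<in>K. poly (f x) z = 0} \<in> sets M" by (simp add: pred_def)
      qed
      moreover have "Measurable.pred M (\<lambda>x. \<forall>j. coeff (f x) j = 0)" by measurable
      ultimately show ?thesis unfolding eq by measurable
    qed
  qed
  then have m: "{x \<in> space M. r \<le> card ({z. poly (f x) z = 0} \<inter> B)} \<in> sets M" for r
    by (simp add: pred_def)
  have "(\<lambda>x. card ({z. poly (f x) z = 0} \<inter> B)) -` {a} \<inter> space M =
      {x \<in> space M. a \<le> card ({z. poly (f x) z = 0} \<inter> B)} - {x \<in> space M. Suc a \<le> card ({z. poly (f x) z = 0} \<inter> B)}" for a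
    by auto
  then have "(\<lambda>x. card ({z. poly (f x) z = 0} \<inter> B)) -` {a} \<inter> space M \<in> sets M" for a
    using m by (simp only: sets.Diff)
  then show ?thesis
    by (simp only: measurable_count_space_eq2_countable) auto
qed

section \<open>The area formula for polynomials\<close>

definition real2_to_complex :: "real^2 \<Rightarrow> complex" where
  "real2_to_complex x = Complex (x $ 1) (x $ 2)"

definition complex_to_real2 :: "complex \<Rightarrow> real^2" where
  "complex_to_real2 z = vector [Re z, Im z]"

lemma real2_complex_inverse [simp]:
  "real2_to_complex (complex_to_real2 z) = z" "complex_to_real2 (real2_to_complex x) = x"
  by (auto simp: real2_to_complex_def complex_to_real2_def vec_eq_iff forall_2)

lemma bounded_linear_real2_to_complex: "bounded_linear real2_to_complex"
  by (intro linear_conv_bounded_linear[THEN iffD1] linearI)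
    (auto simp: real2_to_complex_def complex_eq_iff)

lemma bounded_linear_complex_to_real2: "bounded_linear complex_to_real2"
  by (intro linear_conv_bounded_linear[THEN iffD1] linearI)
    (auto simp: complex_to_real2_def vec_eq_iff forall_2)

lemma measurable_real2_to_complex [measurable]: "real2_to_complex \<in> borel_measurable borel"
  by (intro borel_measurable_continuous_onI linear_continuous_on bounded_linear_real2_to_complex)

lemma distr_real2_to_complex: "distr lborel borel real2_to_complex = lborel"
proof (rule lborel_eqI[symmetric])
  fix l u :: complex assume le: "\<And>b. b \<in> Basis \<Longrightarrow> l \<bullet> b \<le> u \<bullet> b"
  have Basis2: "(Basis :: (real^2) set) = {axis 1 1, axis 2 1}"
    by (auto simp: Basis_vec_def UNIV_2)
  have ne: "axis 1 1 \<noteq> (axis 2 1 :: real^2)" by (simp add: axis_eq_axis)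
  have "real2_to_complex -` box l u = box (complex_to_real2 l) (complex_to_real2 u)"
    by (auto simp: box_def real2_to_complex_def complex_to_real2_def Basis2 Basis_complex_def inner_axis)
  moreover have "\<forall>b\<in>Basis. complex_to_real2 l \<bullet> b \<le> complex_to_real2 u \<bullet> b"
    using le[of 1] le[of \<i>] by (auto simp: complex_to_real2_def Basis2 inner_axis Basis_complex_def)
  ultimately show "emeasure (distr lborel borel real2_to_complex) (box l u) = (\<Prod>b\<in>Basis. (u - l) \<bullet> b)"
    using le by (simp add: emeasure_distr emeasure_lborel_box_eq)
      (simp add: Basis2 ne complex_to_real2_def inner_axis Basis_complex_def)
qed simp

lemma nn_integral_real2_to_complex:
  "f \<in> borel_measurable borel \<Longrightarrow> (\<integral>\<^sup>+x. f (real2_to_complex x) \<partial>lborel) = (\<integral>\<^sup>+z. f z \<partial>lborel)"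
  by (subst distr_real2_to_complex[symmetric], subst nn_integral_distr) auto

text \<open>The change of variables formula with \<open>det (matrix _)\<close> lives on
  \<open>real^2\<close>, whence the transport by \<open>real2_to_complex\<close>. The real Jacobian
  of a holomorphic map is the squared modulus of its derivative, and by injectivity the image is
  covered once.\<close>

lemma emeasure_poly_image_compact:
  fixes p :: "complex poly"
  assumes K: "compact K" and inj: "inj_on (poly p) K"
  shows "emeasure lborel (poly p ` K) = (\<integral>\<^sup>+z. ennreal ((cmod (poly (pderiv p) z))\<^sup>2) * indicator K z \<partial>lborel)"
proof -
  define S where "S = complex_to_real2 ` K"
  have S_vim: "S = real2_to_complex -` K"
    by (auto simp: S_def image_iff) (metis real2_complex_inverse(2))
  define f where "f x = complex_to_real2 (poly p (real2_to_complex x))" for x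
  define f' where "f' x h = complex_to_real2 (poly (pderiv p) (real2_to_complex x) * real2_to_complex h)" for x h
  have cS: "compact S" unfolding S_def
    by (intro compact_continuous_image linear_continuous_on bounded_linear_complex_to_real2 K)
  have fS: "f ` S = complex_to_real2 ` poly p ` K"
    unfolding S_def f_def image_image by simp
  have fS_vim: "f ` S = real2_to_complex -` (poly p ` K)"
    unfolding fS by (auto simp: image_iff) (metis real2_complex_inverse(2))
  have cfS: "compact (f ` S)" unfolding fS
    by (intro compact_continuous_image linear_continuous_on bounded_linear_complex_to_real2 K continuous_intros)
  have der: "(f has_derivative f' x) (at x within S)" for x
  proof -
    have "(poly p has_derivative (\<lambda>h. poly (pderiv p) (real2_to_complex x) * h)) (at (real2_to_complex x))"
      using poly_DERIV[of p "real2_to_complex x"] by (simp add: has_field_derivative_def)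
    then have "((\<lambda>x. poly p (real2_to_complex x)) has_derivative
        (\<lambda>h. poly (pderiv p) (real2_to_complex x) * real2_to_complex h)) (at x within S)"
      by (rule has_derivative_compose[OF bounded_linear_imp_has_derivative[OF bounded_linear_real2_to_complex]])
    then show ?thesis unfolding f_def f'_def
      by (rule bounded_linear.has_derivative[OF bounded_linear_complex_to_real2])
  qed
  \<comment> \<open>Multiplication by \<open>w\<close> is the real matrix with rows
    \<open>(Re w, - Im w)\<close> and \<open>(Im w, Re w)\<close>, of determinant
    \<open>|w|^2\<close>.\<close>
  have det: "det (matrix (f' x)) = (cmod (poly (pderiv p) (real2_to_complex x)))\<^sup>2" for x
    by (simp add: det_2 matrix_def f'_def real2_to_complex_def complex_to_real2_def axis_def cmod_power2)
      (simp add: power2_eq_square)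
  have injf: "inj_on f S"
    using inj by (auto simp: inj_on_def S_def f_def) (metis real2_complex_inverse(1))
  define h where "h x = (cmod (poly (pderiv p) (real2_to_complex x)))\<^sup>2 * indicator S x" for x
  have [measurable]: "S \<in> sets borel" using cS by (simp add: borel_compact)
  have [measurable]: "h \<in> borel_measurable borel" unfolding h_def
  proof -
    have "(\<lambda>x. poly (pderiv p) (real2_to_complex x)) \<in> borel_measurable borel"
      by (intro borel_measurable_continuous_onI continuous_intros linear_continuous_on bounded_linear_real2_to_complex)
    then show "(\<lambda>x. (cmod (poly (pderiv p) (real2_to_complex x)))\<^sup>2 * indicator S x) \<in> borel_measurable borel"
      by measurable
  qed
  have "continuous_on S (\<lambda>x. (cmod (poly (pderiv p) (real2_to_complex x)))\<^sup>2)"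
    by (intro continuous_intros linear_continuous_on bounded_linear_real2_to_complex)
  then have "compact ((\<lambda>x. (cmod (poly (pderiv p) (real2_to_complex x)))\<^sup>2) ` S)"
    using cS compact_continuous_image by blast
  then have "bdd_above ((\<lambda>x. (cmod (poly (pderiv p) (real2_to_complex x)))\<^sup>2) ` S)"
    by (intro bounded_imp_bdd_above compact_imp_bounded)
  then obtain B where "\<forall>y\<in>(\<lambda>x. (cmod (poly (pderiv p) (real2_to_complex x)))\<^sup>2) ` S. y \<le> B"
    unfolding bdd_above_def by blast
  then have B: "\<And>x. x \<in> S \<Longrightarrow> (cmod (poly (pderiv p) (real2_to_complex x)))\<^sup>2 \<le> B" by blast
  have int_h: "integrable lborel h"
  proof (rule integrableI_bounded_set[where A=S and B=B])
    show "emeasure lborel S < \<infinity>" using cS emeasure_compact_finite by simp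
    show "AE x in lborel. x \<in> S \<longrightarrow> norm (h x) \<le> B" using B by (auto simp: h_def)
  qed (auto simp: h_def)
  have "(h has_integral (integral\<^sup>L lborel h)) UNIV"
    by (rule has_integral_integral_lborel[OF int_h])
  moreover have "h = (\<lambda>x. if x \<in> S then \<bar>det (matrix (f' x))\<bar> else 0)"
    by (auto simp: h_def det fun_eq_iff)
  ultimately have "((\<lambda>x. \<bar>det (matrix (f' x))\<bar>) has_integral (integral\<^sup>L lborel h)) S"
    by (simp add: has_integral_restrict_UNIV)
  then have m: "measure lebesgue (f ` S) = integral\<^sup>L lborel h"
    using has_measure_differentiable_image[of S f f' "integral\<^sup>L lborel h", OF _ der injf] by simp
  have "emeasure lborel (poly p ` K) = emeasure lborel (f ` S)"
    unfolding fS_vim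
    by (subst (1) distr_real2_to_complex[symmetric], subst emeasure_distr)
      (auto intro!: borel_compact compact_continuous_image K continuous_intros)
  also have "\<dots> = ennreal (measure lebesgue (f ` S))"
    using cfS emeasure_compact_finite[OF cfS] borel_compact[OF cfS]
    by (simp add: emeasure_eq_ennreal_measure)
  also have "\<dots> = (\<integral>\<^sup>+x. ennreal (h x) \<partial>lborel)"
    unfolding m by (rule nn_integral_eq_integral[symmetric, OF int_h]) (simp add: h_def)
  also have "\<dots> = (\<integral>\<^sup>+x. ennreal ((cmod (poly (pderiv p) (real2_to_complex x)))\<^sup>2) * indicator K (real2_to_complex x) \<partial>lborel)"
    by (intro nn_integral_cong) (auto simp: h_def S_vim indicator_def)
  also have "\<dots> = (\<integral>\<^sup>+z. ennreal ((cmod (poly (pderiv p) z))\<^sup>2) * indicator K z \<partial>lborel)"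
  proof -
    have [measurable]: "K \<in> sets borel" using K by (simp add: borel_compact)
    have [measurable]: "poly (pderiv p) \<in> borel_measurable borel"
      by (intro borel_measurable_continuous_onI continuous_intros)
    show ?thesis by (rule nn_integral_real2_to_complex) measurable
  qed
  finally show ?thesis .
qed

text \<open>Both sides are integrals of \<open>G\<close> against finite measures. These agree on a
  closed set \<open>E\<close> by the formula for the measure of an image, applied to the compact
  part of \<open>K\<close> that is mapped into \<open>E\<close>; closed sets are stable under
  intersection and generate the Borel sets.\<close>

lemma area_formula_compact:
  fixes p :: "complex poly"
  assumes K: "compact K" and inj: "inj_on (poly p) K" and [measurable]: "G \<in> borel_measurable borel"
  shows "(\<integral>\<^sup>+c. G c * indicator (poly p ` K) c \<partial>lborel) =
    (\<integral>\<^sup>+z. G (poly p z) * ennreal ((cmod (poly (pderiv p) z))\<^sup>2) * indicator K z \<partial>lborel)"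
proof -
  have [measurable]: "K \<in> sets borel" "poly p ` K \<in> sets borel"
    using K by (auto intro!: borel_compact compact_continuous_image continuous_intros)
  define \<mu> where "\<mu> = distr (density lborel (\<lambda>z. ennreal ((cmod (poly (pderiv p) z))\<^sup>2) * indicator K z)) borel (poly p)"
  define \<nu> where "\<nu> = density lborel (indicator (poly p ` K) :: complex \<Rightarrow> ennreal)"
  have \<mu>: "emeasure \<mu> E = (\<integral>\<^sup>+z. ennreal ((cmod (poly (pderiv p) z))\<^sup>2) * indicator (K \<inter> poly p -` E) z \<partial>lborel)"
    if [measurable]: "E \<in> sets borel" for E
  proof -
    have "poly p -` E \<inter> space borel \<in> sets borel" by measurable
    then have [measurable]: "poly p -` E \<in> sets borel" by simp
    show ?thesis unfolding \<mu>_def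
      by (subst emeasure_distr) (auto simp: emeasure_density indicator_inter_arith mult.assoc)
  qed
  have \<nu>: "emeasure \<nu> E = emeasure lborel (poly p ` K \<inter> E)" if [measurable]: "E \<in> sets borel" for E
    unfolding \<nu>_def by (simp add: emeasure_density indicator_inter_arith[symmetric])
  have eq: "emeasure \<mu> E = emeasure \<nu> E" if E: "closed E" for E
  proof -
    have EK: "compact (K \<inter> poly p -` E)"
      using K E continuous_closed_vimage[of E "poly p"] by (intro compact_Int_closed) auto
    have "poly p ` K \<inter> E = poly p ` (K \<inter> poly p -` E)" by auto
    then show ?thesis using E emeasure_poly_image_compact[OF EK inj_on_subset[OF inj]] \<mu>[of E] \<nu>[of E] by simp
  qed
  have "\<mu> = \<nu>"
  proof (rule measure_eqI_generator_eq[where E="Collect closed" and \<Omega>=UNIV and A="\<lambda>_. UNIV"])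
    show "Int_stable (Collect closed :: complex set set)" by (auto simp: Int_stable_def)
    show "sets \<mu> = sigma_sets UNIV (Collect closed)" "sets \<nu> = sigma_sets UNIV (Collect closed)"
      by (simp_all add: \<mu>_def \<nu>_def borel_eq_closed)
    show "emeasure \<mu> UNIV \<noteq> \<infinity>" for i :: nat
    proof -
      have "compact (poly p ` K)" by (intro compact_continuous_image K continuous_intros)
      then show ?thesis using eq[of UNIV] \<nu>[of UNIV] emeasure_compact_finite by fastforce
    qed
  qed (use eq in auto)
  then have "(\<integral>\<^sup>+c. G c \<partial>\<mu>) = (\<integral>\<^sup>+c. G c \<partial>\<nu>)" by simp
  then show ?thesis unfolding \<mu>_def \<nu>_def
    by (simp add: nn_integral_distr nn_integral_density mult_ac)
qed

text \<open>Away from the finitely many critical points a polynomial is locally injective, so this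
  part of \<open>B\<close> splits into countably many disjoint pieces of injectivity; a value is
  counted once for each piece whose image contains it. The critical values form a finite, hence
  null, set.\<close>

lemma area_formula:
  fixes p :: "complex poly"
  assumes B: "open B" and [measurable]: "G \<in> borel_measurable borel"
  shows "(\<integral>\<^sup>+c. G c * of_nat (card ({z. poly p z = c} \<inter> B)) \<partial>lborel) =
    (\<integral>\<^sup>+z. G (poly p z) * ennreal ((cmod (poly (pderiv p) z))\<^sup>2) * indicator B z \<partial>lborel)"
proof (cases "degree p = 0")
  \<comment> \<open>A constant polynomial takes its value on all of \<open>B\<close>, an empty or
    infinite set with \<open>card\<close> 0, and its derivative vanishes, so both sides are
    0.\<close>
  case True
  then have pd: "pderiv p = 0" by (simp add: pderiv_eq_0_iff)
  obtain a where a: "p = [:a:]" using True degree_eq_zeroE by blast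
  have "card ({z. poly p z = c} \<inter> B) = 0" for c
    using B finite_imp_not_open[of B] by (cases "a = c") (auto simp: a card_eq_0_iff)
  then show ?thesis by (simp add: pd)
next
  case False
  define S where "S = B \<inter> {z. poly (pderiv p) z \<noteq> 0}"
  have pd: "pderiv p \<noteq> 0" using False by (simp add: pderiv_eq_0_iff)
  then have crit: "finite {z. poly (pderiv p) z = 0}" by (rule poly_roots_finite)
  have oS: "open S"
    unfolding S_def using B finite_imp_closed[OF crit]
    by (intro open_Int open_Collect_neg)
  define Q where "Q = {K \<in> rational_cballs. inj_on (poly p) K}"
  have Qc: "countable Q" by (rule countable_subset[OF _ countable_rational_cballs]) (auto simp: Q_def)
  \<comment> \<open>The empty disc makes \<open>Q\<close> non-empty, as \<open>from_nat_into\<close>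
    requires.\<close>
  have "cball 0 (-1) = ({} :: complex set)" by simp
  then have "{} \<in> Q" unfolding Q_def rational_cballs_def
    by (auto intro!: exI[of _ 0] exI[of _ "-1"])
  then have Qne: "Q \<noteq> {}" by blast
  define U where "U = from_nat_into Q"
  have U: "U i \<in> Q" for i unfolding U_def by (rule from_nat_into[OF Qne])
  have cov: "S \<subseteq> (\<Union>i. U i)"
  proof
    fix z assume z: "z \<in> S"
    have "\<exists>e>0. inj_on (poly p) (ball z e)"
    proof -
      have "(poly p has_field_derivative poly (pderiv p) z) (at z)" by (rule poly_DERIV)
      from DERIV_imp_deriv[OF this] have "deriv (poly p) z \<noteq> 0" using z by (simp add: S_def)
      moreover have "poly p holomorphic_on UNIV" by (intro holomorphic_intros)
      ultimately show ?thesis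
        using has_complex_derivative_locally_injective[of "poly p" UNIV z] by blast
    qed
    then obtain e where "e > 0" "inj_on (poly p) (ball z e)" by blast
    moreover obtain K where "K \<in> rational_cballs" "z \<in> K" "K \<subseteq> ball z e"
      using rational_cball_in_ball[OF \<open>e > 0\<close>] .
    ultimately have "K \<in> Q" "z \<in> K" by (auto simp: Q_def intro: inj_on_subset)
    then show "z \<in> (\<Union>i. U i)" unfolding U_def
      using range_from_nat_into[OF Qne Qc] by (metis UN_iff UNIV_I image_iff)
  qed
  have Ucl: "compact (U i)" for i using U[of i] compact_rational_cballs by (auto simp: Q_def)
  define A where "A i = disjointed U i \<inter> S" for i
  have A_disj: "disjoint_family A" unfolding A_def
    using disjoint_family_disjointed[of U] by (auto simp: disjoint_family_on_def)
  have A_un: "(\<Union>i. A i) = S" using cov UN_disjointed_eq[of U] by (auto simp: A_def)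
  have A_inj: "inj_on (poly p) (A i)" for i
    using U[of i] disjointed_subset[of U i] by (auto simp: A_def Q_def intro: inj_on_subset)
  \<comment> \<open>A piece is the open set \<open>S\<close> minus finitely many compact discs,
    intersected with one more disc. It is thus an increasing union of compact sets, and monotone
    convergence extends the compact case to it.\<close>
  have piece: "poly p ` A i \<in> sets borel \<and> (\<integral>\<^sup>+c. G c * indicator (poly p ` A i) c \<partial>lborel) =
    (\<integral>\<^sup>+z. G (poly p z) * ennreal ((cmod (poly (pderiv p) z))\<^sup>2) * indicator (A i) z \<partial>lborel)" for i
  proof -
    have oW: "open (S - (\<Union>j<i. U j))"
      using oS Ucl by (intro open_Diff closed_UN) (auto intro: compact_imp_closed)
    obtain C where C: "\<And>n::nat. compact (C n)" "\<And>n. C n \<subseteq> S - (\<Union>j<i. U j)"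
      "\<And>n. C n \<subseteq> interior (C (Suc n))" "\<Union>(range C) = S - (\<Union>j<i. U j)"
      using open_Union_compact_subsets[OF oW] by metis
    define K where "K n = C n \<inter> U i" for n
    have cK: "compact (K n)" for n unfolding K_def using C(1) Ucl by blast
    have incK: "incseq K" unfolding K_def using C(3) interior_subset by (intro incseq_SucI) blast
    have unK: "(\<Union>n. K n) = A i"
      using C(4) by (auto simp: K_def A_def disjointed_def atLeast0LessThan)
    have injK: "inj_on (poly p) (K n)" for n using A_inj[of i] unK by (auto intro: inj_on_subset)
    have im: "poly p ` A i = (\<Union>n. poly p ` K n)" using unK by blast
    have [measurable]: "K n \<in> sets borel" "poly p ` K n \<in> sets borel" for n
      using cK by (auto intro!: borel_compact compact_continuous_image continuous_intros)
    have "(\<integral>\<^sup>+c. G c * indicator (poly p ` A i) c \<partial>lborel) = (\<integral>\<^sup>+c. (SUP n. G c * indicator (poly p ` K n) c) \<partial>lborel)"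
      unfolding im
    proof (intro nn_integral_cong)
      fix c
      have "indicator (\<Union>n. poly p ` K n) c = (SUP n. indicator (poly p ` K n) c :: ennreal)"
        by (auto simp: indicator_def intro!: antisym SUP_least SUP_upper2)
      then show "G c * indicator (\<Union>n. poly p ` K n) c = (SUP n. G c * indicator (poly p ` K n) c)"
        by (simp add: SUP_mult_left_ennreal)
    qed
    also have "\<dots> = (SUP n. \<integral>\<^sup>+c. G c * indicator (poly p ` K n) c \<partial>lborel)"
      using incK by (intro nn_integral_monotone_convergence_SUP)
        (auto simp: incseq_def le_fun_def intro!: mult_left_mono split: split_indicator)
    also have "\<dots> = (SUP n. \<integral>\<^sup>+z. G (poly p z) * ennreal ((cmod (poly (pderiv p) z))\<^sup>2) * indicator (K n) z \<partial>lborel)"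
      by (simp add: area_formula_compact[OF cK injK])
    also have "\<dots> = (\<integral>\<^sup>+z. (SUP n. G (poly p z) * ennreal ((cmod (poly (pderiv p) z))\<^sup>2) * indicator (K n) z) \<partial>lborel)"
      using incK by (intro nn_integral_monotone_convergence_SUP[symmetric])
        (auto simp: incseq_def le_fun_def intro!: mult_left_mono split: split_indicator)
    also have "\<dots> = (\<integral>\<^sup>+z. G (poly p z) * ennreal ((cmod (poly (pderiv p) z))\<^sup>2) * indicator (A i) z \<partial>lborel)"
      unfolding unK[symmetric]
    proof (intro nn_integral_cong)
      fix c
      have "indicator (\<Union>n. K n) c = (SUP n. indicator (K n) c :: ennreal)"
        by (auto simp: indicator_def intro!: antisym SUP_least SUP_upper2)
      then show "(SUP n. G (poly p c) * ennreal ((cmod (poly (pderiv p) c))\<^sup>2) * indicator (K n) c) =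
          G (poly p c) * ennreal ((cmod (poly (pderiv p) c))\<^sup>2) * indicator (\<Union>n. K n) c"
        by (simp add: SUP_mult_left_ennreal)
    qed
    finally show ?thesis unfolding im by auto
  qed
  then have [measurable]: "poly p ` A i \<in> sets borel" for i by blast
  have [measurable]: "A i \<in> sets borel" for i unfolding A_def
    unfolding disjointed_def using oS borel_compact[OF Ucl] by auto
  have "finite (poly p ` {z. poly (pderiv p) z = 0})" using crit by blast
  then have "AE c in lborel. c \<notin> poly p ` {z. poly (pderiv p) z = 0}"
    by (intro AE_not_in finite_imp_null_set_lborel)
  then have "(\<integral>\<^sup>+c. G c * of_nat (card ({z. poly p z = c} \<inter> B)) \<partial>lborel) =
    (\<integral>\<^sup>+c. (\<Sum>i. G c * indicator (poly p ` A i) c) \<partial>lborel)"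
  proof (intro nn_integral_cong_AE, elim AE_mp, intro AE_I2 impI)
    fix c assume c: "c \<notin> poly p ` {z. poly (pderiv p) z = 0}"
    have "p \<noteq> [:c:]" using False by auto
    then have "finite {z. poly (p - [:c:]) z = 0}" by (intro poly_roots_finite) auto
    then have fin: "finite {z. poly p z = c}" by simp
    have eqS: "{z. poly p z = c} \<inter> B = (\<Union>i. {z. poly p z = c} \<inter> A i)"
      using c A_un by (auto simp: S_def)
    have "of_nat (card ({z. poly p z = c} \<inter> B)) = emeasure (count_space UNIV) ({z. poly p z = c} \<inter> B)"
      using fin by simp
    also have "\<dots> = (\<Sum>i. emeasure (count_space UNIV) ({z. poly p z = c} \<inter> A i))"
      unfolding eqS using A_disj by (intro suminf_emeasure[symmetric]) (auto simp: disjoint_family_on_def)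
    also have "\<dots> = (\<Sum>i. indicator (poly p ` A i) c)"
    proof (intro arg_cong[where f=suminf] ext)
      fix i
      show "emeasure (count_space UNIV) ({z. poly p z = c} \<inter> A i) = indicator (poly p ` A i) c"
      proof (cases "c \<in> poly p ` A i")
        case True
        then obtain z where "z \<in> A i" "poly p z = c" by blast
        then have "{z. poly p z = c} \<inter> A i = {z}" using A_inj[of i] by (auto simp: inj_on_def)
        then show ?thesis using True by simp
      next
        case False
        then have "{z. poly p z = c} \<inter> A i = {}" by auto
        then show ?thesis using False by simp
      qed
    qed
    finally show "G c * of_nat (card ({z. poly p z = c} \<inter> B)) = (\<Sum>i. G c * indicator (poly p ` A i) c)"
      by simp
  qed
  also have "\<dots> = (\<Sum>i. \<integral>\<^sup>+c. G c * indicator (poly p ` A i) c \<partial>lborel)"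
    by (rule nn_integral_suminf) measurable
  also have "\<dots> = (\<Sum>i. \<integral>\<^sup>+z. G (poly p z) * ennreal ((cmod (poly (pderiv p) z))\<^sup>2) * indicator (A i) z \<partial>lborel)"
    using piece by simp
  also have "\<dots> = (\<integral>\<^sup>+z. (\<Sum>i. G (poly p z) * ennreal ((cmod (poly (pderiv p) z))\<^sup>2) * indicator (A i) z) \<partial>lborel)"
    by (rule nn_integral_suminf[symmetric]) measurable
  also have "\<dots> = (\<integral>\<^sup>+z. G (poly p z) * ennreal ((cmod (poly (pderiv p) z))\<^sup>2) * indicator B z \<partial>lborel)"
  proof (intro nn_integral_cong)
    fix z
    have "(\<Sum>i. indicator (A i) z) = (indicator S z :: ennreal)"
      unfolding A_un[symmetric] by (rule suminf_indicator[OF A_disj])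
    then have "(\<Sum>i. G (poly p z) * ennreal ((cmod (poly (pderiv p) z))\<^sup>2) * indicator (A i) z) =
      G (poly p z) * ennreal ((cmod (poly (pderiv p) z))\<^sup>2) * indicator S z" by simp
    then show "(\<Sum>i. G (poly p z) * ennreal ((cmod (poly (pderiv p) z))\<^sup>2) * indicator (A i) z) =
      G (poly p z) * ennreal ((cmod (poly (pderiv p) z))\<^sup>2) * indicator B z"
      by (auto simp: S_def indicator_def)
  qed
  finally show ?thesis .
qed

subsection \<open>Lebesgue measure on spaces of polynomials\<close>

lemma nn_integral_lborel_translation:
  fixes a :: "'a::euclidean_space"
  assumes [measurable]: "F \<in> borel_measurable borel"
  shows "(\<integral>\<^sup>+x. F (a + x) \<partial>lborel) = (\<integral>\<^sup>+x. F x \<partial>lborel)"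
  by (subst (2) lborel_distr_plus[symmetric, of a], subst nn_integral_distr) auto

lemma nn_integral_complex_mult:
  fixes s :: complex
  assumes s: "s \<noteq> 0" and [measurable]: "F \<in> borel_measurable borel"
  shows "(\<integral>\<^sup>+x. F x \<partial>lborel) = ennreal ((cmod s)\<^sup>2) * (\<integral>\<^sup>+x. F (s * x) \<partial>lborel)"
proof -
  have c: "card {z. s * z = c} = 1" for c
  proof -
    have "{z. s * z = c} = {c / s}" using s by (auto simp: field_simps)
    then show ?thesis by simp
  qed
  have "(\<integral>\<^sup>+x. F x \<partial>lborel) = (\<integral>\<^sup>+x. F (s * x) * ennreal ((cmod s)\<^sup>2) \<partial>lborel)"
    using area_formula[of UNIV F "[:0, s:]"] c by (simp add: mult.commute pderiv_pCons)
  also have "\<dots> = (\<integral>\<^sup>+x. F (s * x) \<partial>lborel) * ennreal ((cmod s)\<^sup>2)"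
    by (rule nn_integral_multc) measurable
  finally show ?thesis by (simp add: mult.commute)
qed

lemma nn_integral_complex_affine:
  fixes s a :: complex
  assumes s: "s \<noteq> 0" and [measurable]: "F \<in> borel_measurable borel"
  shows "(\<integral>\<^sup>+x. F x \<partial>lborel) = ennreal ((cmod s)\<^sup>2) * (\<integral>\<^sup>+x. F (a + s * x) \<partial>lborel)"
  by (subst nn_integral_lborel_translation[symmetric, of F a], simp)
    (rule nn_integral_complex_mult[OF s], measurable)

text \<open>Lebesgue measure on the coefficients of the polynomials of degree below
  \<open>m\<close>; for \<open>m = 0\<close> it is the point mass at the zero polynomial. Building
  it with \<open>pCons\<close> lets integrals be peeled off from the constant coefficient.\<close>

fun polyL :: "nat \<Rightarrow> complex poly measure" where
  "polyL 0 = return pm 0"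
| "polyL (Suc m) = distr (lborel \<Otimes>\<^sub>M polyL m) pm (\<lambda>(c, h). pCons c h)"

lemma sets_polyL [simp, measurable_cong]: "sets (polyL m) = sets pm"
  by (cases m) auto

lemma space_polyL [simp]: "space (polyL m) = UNIV"
  by (cases m) auto

text \<open>Preimages under the left inverse \<open>g\<close> carry a countable cover by sets of
  finite measure over to the target, where images under \<open>f\<close> might fail to be
  measurable.\<close>

lemma sigma_finite_distr_left_inverse:
  assumes "sigma_finite_measure M" and f [measurable]: "f \<in> measurable M N" and g [measurable]: "g \<in> measurable N M"
    and gf: "\<And>x. x \<in> space M \<Longrightarrow> g (f x) = x"
  shows "sigma_finite_measure (distr M N f)"
proof -
  interpret sigma_finite_measure M by fact
  obtain A where A: "countable A" "A \<subseteq> sets M" "\<Union>A = space M" "\<And>a. a \<in> A \<Longrightarrow> emeasure M a \<noteq> \<infinity>"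
    using sigma_finite_countable by blast
  show ?thesis
  proof
    show "\<exists>B. countable B \<and> B \<subseteq> sets (distr M N f) \<and> \<Union>B = space (distr M N f) \<and> (\<forall>a\<in>B. emeasure (distr M N f) a \<noteq> \<infinity>)"
    proof (intro exI[of _ "(\<lambda>a. g -` a \<inter> space N) ` A"] conjI ballI)
      show "countable ((\<lambda>a. g -` a \<inter> space N) ` A)" using A(1) by simp
      show "(\<lambda>a. g -` a \<inter> space N) ` A \<subseteq> sets (distr M N f)" using A(2) by auto
      show "\<Union>((\<lambda>a. g -` a \<inter> space N) ` A) = space (distr M N f)"
        using measurable_space[OF g, folded A(3)] by auto
      fix b assume "b \<in> (\<lambda>a. g -` a \<inter> space N) ` A"
      then obtain a where a: "a \<in> A" and b: "b = g -` a \<inter> space N" by blast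
      then have [measurable]: "a \<in> sets M" using A(2) by blast
      have "f -` b \<inter> space M = a"
        unfolding b using gf measurable_space[OF f] sets.sets_into_space[OF \<open>a \<in> sets M\<close>] by auto
      then show "emeasure (distr M N f) b \<noteq> \<infinity>"
        using A(4)[OF a] by (subst emeasure_distr) (auto simp: b)
    qed
  qed
qed

lemma sigma_finite_polyL: "sigma_finite_measure (polyL m)"
proof (induction m)
  case 0
  interpret prob_space "return pm (0 :: complex poly)" by (rule prob_space_return) simp
  show ?case by simp unfold_locales
next
  case (Suc m)
  interpret L: sigma_finite_measure "polyL m" by fact
  interpret pair_sigma_finite lborel "polyL m" ..
  have "sigma_finite_measure (lborel \<Otimes>\<^sub>M polyL m :: (complex \<times> complex poly) measure)" ..
  then show ?case
    unfolding polyL.simps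
    by (rule sigma_finite_distr_left_inverse[where g = "\<lambda>p. (coeff p 0, poly_shift 1 p)"])
      (auto simp: poly_eq_iff coeff_poly_shift)
qed

interpretation polyL: sigma_finite_measure "polyL m" for m
  by (rule sigma_finite_polyL)

lemma nn_integral_polyL_0: "F \<in> borel_measurable pm \<Longrightarrow> (\<integral>\<^sup>+f. F f \<partial>polyL 0) = F 0"
  by (simp add: nn_integral_return)

lemma nn_integral_polyL_Suc:
  assumes [measurable]: "F \<in> borel_measurable pm"
  shows "(\<integral>\<^sup>+f. F f \<partial>polyL (Suc m)) = (\<integral>\<^sup>+c. \<integral>\<^sup>+h. F (pCons c h) \<partial>polyL m \<partial>lborel)"
  by (simp add: nn_integral_distr polyL.nn_integral_fst[symmetric])

lemma AE_polyL_degree: "AE f in polyL m. f = 0 \<or> degree f < m"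
proof -
  have meas: "Measurable.pred pm (\<lambda>f. \<forall>j. m \<le> j \<longrightarrow> coeff f j = (0::complex))" for m by measurable
  have "AE f in polyL m. \<forall>j. m \<le> j \<longrightarrow> coeff f j = 0"
  proof (induction m)
    case 0
    show ?case unfolding polyL.simps by (subst AE_return) (use meas[of 0] in simp_all)
  next
    case (Suc m)
    have "AE x in lborel \<Otimes>\<^sub>M polyL m. \<forall>j. Suc m \<le> j \<longrightarrow> coeff (pCons (fst x) (snd x)) j = 0"
    proof (rule pair_sigma_finite.AE_pair_measure)
      show "pair_sigma_finite lborel (polyL m)" ..
      show "{x \<in> space (lborel \<Otimes>\<^sub>M polyL m). \<forall>j. Suc m \<le> j \<longrightarrow> coeff (pCons (fst x) (snd x)) j = 0} \<in> sets (lborel \<Otimes>\<^sub>M polyL m)"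
        by measurable
      show "AE x in lborel. AE y in polyL m. \<forall>j. Suc m \<le> j \<longrightarrow> coeff (pCons (fst (x, y)) (snd (x, y))) j = 0"
        using Suc by (auto elim!: AE_mp simp: coeff_pCons split: nat.split)
    qed
    then show ?case
      unfolding polyL.simps
      by (subst AE_distr_iff) (use meas[of "Suc m"] in \<open>simp_all add: pred_def split_beta\<close>)
  qed
  then show ?thesis
    by (rule AE_mp) (auto intro!: AE_I2 simp: leading_coeff_0_iff[symmetric] not_less simp del: leading_coeff_0_iff)
qed

lemma nn_integral_polyL_translate:
  assumes [measurable]: "F \<in> borel_measurable pm" and "g = 0 \<or> degree g < m"
  shows "(\<integral>\<^sup>+f. F (g + f) \<partial>polyL m) = (\<integral>\<^sup>+f. F f \<partial>polyL m)"
  using assms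
proof (induction m arbitrary: g F)
  case 0
  then show ?case by simp
next
  case (Suc m)
  note [measurable] = Suc.prems(1)
  obtain b h where g: "g = pCons b h" by (cases g)
  have h: "h = 0 \<or> degree h < m" using Suc.prems(2) by (auto simp: g split: if_splits)
  have "(\<integral>\<^sup>+f. F (g + f) \<partial>polyL (Suc m)) = (\<integral>\<^sup>+c. \<integral>\<^sup>+f. F (pCons (b + c) (h + f)) \<partial>polyL m \<partial>lborel)"
    by (simp add: nn_integral_polyL_Suc g del: polyL.simps)
  also have "\<dots> = (\<integral>\<^sup>+c. \<integral>\<^sup>+f. F (pCons (b + c) f) \<partial>polyL m \<partial>lborel)"
    by (intro nn_integral_cong Suc.IH[where F="\<lambda>f. F (pCons _ f)"] h) measurable
  also have "\<dots> = (\<integral>\<^sup>+c. \<integral>\<^sup>+f. F (pCons c f) \<partial>polyL m \<partial>lborel)"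
    by (rule nn_integral_lborel_translation[where F="\<lambda>c. \<integral>\<^sup>+f. F (pCons c f) \<partial>polyL m"]) measurable
  finally show ?case by (simp add: nn_integral_polyL_Suc del: polyL.simps)
qed

text \<open>Division with remainder by \<open>X - z\<close> is a unitriangular change of the
  coefficients, so it has Jacobian 1.\<close>

lemma nn_integral_polyL_divide:
  assumes [measurable]: "F \<in> borel_measurable pm"
  shows "(\<integral>\<^sup>+f. F f \<partial>polyL (Suc m)) = (\<integral>\<^sup>+c. \<integral>\<^sup>+h. F ([:c:] + [:-z, 1:] * h) \<partial>polyL m \<partial>lborel)"
  using assms
proof (induction m arbitrary: F)
  case 0
  note [measurable] = 0
  show ?case by (simp add: nn_integral_polyL_Suc nn_integral_polyL_0 del: polyL.simps)
next
  case (Suc m)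
  note [measurable] = Suc.prems
  have "(\<integral>\<^sup>+f. F f \<partial>polyL (Suc (Suc m))) = (\<integral>\<^sup>+b. \<integral>\<^sup>+f. F (pCons b f) \<partial>polyL (Suc m) \<partial>lborel)"
    by (simp add: nn_integral_polyL_Suc del: polyL.simps)
  also have "\<dots> = (\<integral>\<^sup>+b. \<integral>\<^sup>+c. \<integral>\<^sup>+h. F (pCons b ([:c:] + [:-z, 1:] * h)) \<partial>polyL m \<partial>lborel \<partial>lborel)"
    by (intro nn_integral_cong Suc.IH) measurable
  also have "\<dots> = (\<integral>\<^sup>+c. \<integral>\<^sup>+b. \<integral>\<^sup>+h. F (pCons b ([:c:] + [:-z, 1:] * h)) \<partial>polyL m \<partial>lborel \<partial>lborel)"
    by (rule lborel_pair.Fubini') measurable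
  also have "\<dots> = (\<integral>\<^sup>+c. \<integral>\<^sup>+b. \<integral>\<^sup>+h. F ([:b:] + [:-z, 1:] * pCons c h) \<partial>polyL m \<partial>lborel \<partial>lborel)"
  proof (rule nn_integral_cong)
    fix c
    have "pCons b ([:c:] + [:-z, 1:] * h) = [:z * c + b:] + [:-z, 1:] * pCons c h" for b h
      by (simp add: poly_eq_iff coeff_pCons algebra_simps split: nat.split)
    then have "(\<integral>\<^sup>+b. \<integral>\<^sup>+h. F (pCons b ([:c:] + [:-z, 1:] * h)) \<partial>polyL m \<partial>lborel)
      = (\<integral>\<^sup>+b. \<integral>\<^sup>+h. F ([:z * c + b:] + [:-z, 1:] * pCons c h) \<partial>polyL m \<partial>lborel)" by simp
    also have "\<dots> = (\<integral>\<^sup>+b. \<integral>\<^sup>+h. F ([:b:] + [:-z, 1:] * pCons c h) \<partial>polyL m \<partial>lborel)"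
      by (rule nn_integral_lborel_translation[where F="\<lambda>b. \<integral>\<^sup>+h. F ([:b:] + [:-z, 1:] * pCons c h) \<partial>polyL m"]) measurable
    finally show "(\<integral>\<^sup>+b. \<integral>\<^sup>+h. F (pCons b ([:c:] + [:-z, 1:] * h)) \<partial>polyL m \<partial>lborel)
      = (\<integral>\<^sup>+b. \<integral>\<^sup>+h. F ([:b:] + [:-z, 1:] * pCons c h) \<partial>polyL m \<partial>lborel)" .
  qed
  also have "\<dots> = (\<integral>\<^sup>+b. \<integral>\<^sup>+c. \<integral>\<^sup>+h. F ([:b:] + [:-z, 1:] * pCons c h) \<partial>polyL m \<partial>lborel \<partial>lborel)"
    by (rule lborel_pair.Fubini') measurable
  also have "\<dots> = (\<integral>\<^sup>+b. \<integral>\<^sup>+f. F ([:b:] + [:-z, 1:] * f) \<partial>polyL (Suc m) \<partial>lborel)"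
    by (intro nn_integral_cong nn_integral_polyL_Suc[symmetric]) measurable
  finally show ?case .
qed

text \<open>The map below sends a quotient \<open>h\<close> to the non-constant part of \<open>(X - z) h\<close>.\<close>

lemma nn_integral_polyL_shear:
  assumes [measurable]: "F \<in> borel_measurable pm"
  shows "(\<integral>\<^sup>+h. F (h - smult z (poly_shift 1 h)) \<partial>polyL m) = (\<integral>\<^sup>+h. F h \<partial>polyL m)"
  using assms
proof (induction m arbitrary: F)
  case 0
  note [measurable] = 0
  show ?case by (simp add: nn_integral_polyL_0 del: polyL.simps)
next
  case (Suc m)
  note [measurable] = Suc.prems
  have eq: "pCons c h - smult z (poly_shift 1 (pCons c h)) = pCons (- z * coeff h 0 + c) (h - smult z (poly_shift 1 h))" for c h
    by (simp add: poly_eq_iff coeff_pCons coeff_poly_shift split: nat.split)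
  have "(\<integral>\<^sup>+h. F (h - smult z (poly_shift 1 h)) \<partial>polyL (Suc m)) =
    (\<integral>\<^sup>+c. \<integral>\<^sup>+h. F (pCons (- z * coeff h 0 + c) (h - smult z (poly_shift 1 h))) \<partial>polyL m \<partial>lborel)"
    by (subst nn_integral_polyL_Suc) (simp_all only: eq, measurable)
  also have "\<dots> = (\<integral>\<^sup>+h. \<integral>\<^sup>+c. F (pCons (- z * coeff h 0 + c) (h - smult z (poly_shift 1 h))) \<partial>lborel \<partial>polyL m)"
    by (rule pair_sigma_finite.Fubini') (unfold_locales, measurable)
  also have "\<dots> = (\<integral>\<^sup>+h. \<integral>\<^sup>+c. F (pCons c (h - smult z (poly_shift 1 h))) \<partial>lborel \<partial>polyL m)"
    by (intro nn_integral_cong nn_integral_lborel_translation[where F="\<lambda>c. F (pCons c _)"]) measurable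
  also have "\<dots> = (\<integral>\<^sup>+c. \<integral>\<^sup>+h. F (pCons c (h - smult z (poly_shift 1 h))) \<partial>polyL m \<partial>lborel)"
    by (rule pair_sigma_finite.Fubini'[symmetric]) (unfold_locales, measurable)
  also have "\<dots> = (\<integral>\<^sup>+c. \<integral>\<^sup>+h. F (pCons c h) \<partial>polyL m \<partial>lborel)"
    by (intro nn_integral_cong Suc.IH[where F="\<lambda>h. F (pCons _ h)"]) measurable
  finally show ?case by (simp add: nn_integral_polyL_Suc del: polyL.simps)
qed

text \<open>With the other coefficients fixed, the zeros of \<open>c + X h\<close> are the points
  where \<open>- X h\<close> takes the value \<open>c\<close>, and integrating over \<open>c\<close>
  is the area formula for \<open>- X h\<close>. The shear then replaces \<open>h\<close> by the
  quotient of the polynomial by \<open>X - z\<close>, whose value at \<open>z\<close> is the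
  derivative there.\<close>

lemma zero_count_step:
  assumes B: "open B" and [measurable]: "\<Phi> \<in> borel_measurable pm"
  shows "(\<integral>\<^sup>+f. of_nat (card ({z. poly f z = 0} \<inter> B)) * \<Phi> f \<partial>polyL (Suc m)) =
    (\<integral>\<^sup>+z. indicator B z * (\<integral>\<^sup>+h. ennreal ((cmod (poly h z))\<^sup>2) * \<Phi> ([:-z, 1:] * h) \<partial>polyL m) \<partial>lborel)"
proof -
  note measurable_compose[OF measurable_card_zeros[OF _ B], measurable (raw)]
  have [measurable]: "B \<in> sets borel" using B by simp
  have [measurable]: "(\<lambda>f. of_nat (card ({z. poly f z = 0} \<inter> B)) :: ennreal) \<in> borel_measurable pm"
    by (rule measurable_compose[OF measurable_card_zeros[OF _ B]]) auto
  have "(\<integral>\<^sup>+f. of_nat (card ({z. poly f z = 0} \<inter> B)) * \<Phi> f \<partial>polyL (Suc m)) =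
    (\<integral>\<^sup>+c. \<integral>\<^sup>+h. of_nat (card ({z. poly (pCons c h) z = 0} \<inter> B)) * \<Phi> (pCons c h) \<partial>polyL m \<partial>lborel)"
    by (rule nn_integral_polyL_Suc) measurable
  also have "\<dots> = (\<integral>\<^sup>+h. \<integral>\<^sup>+c. of_nat (card ({z. poly (pCons c h) z = 0} \<inter> B)) * \<Phi> (pCons c h) \<partial>lborel \<partial>polyL m)"
    by (rule pair_sigma_finite.Fubini') (unfold_locales, measurable)
  also have "\<dots> = (\<integral>\<^sup>+h. \<integral>\<^sup>+z. indicator B z * (ennreal ((cmod (poly (pderiv (pCons 0 h)) z))\<^sup>2) * \<Phi> (pCons (- (z * poly h z)) h)) \<partial>lborel \<partial>polyL m)"
  proof (rule nn_integral_cong)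
    fix h :: "complex poly"
    have nd: "cmod (poly (pderiv (- pCons 0 h)) z) = cmod (poly (pderiv (pCons 0 h)) z)" for z
      by (simp only: pderiv_minus poly_minus norm_minus_cancel)
    have neg: "c + w = 0 \<longleftrightarrow> - w = c" for c w :: complex by (auto simp: add_eq_0_iff)
    have eq: "{z. poly (pCons c h) z = 0} = {z. poly (- pCons 0 h) z = c}" for c
      by (simp add: poly_minus neg)
    have "(\<integral>\<^sup>+c. of_nat (card ({z. poly (pCons c h) z = 0} \<inter> B)) * \<Phi> (pCons c h) \<partial>lborel) =
      (\<integral>\<^sup>+c. \<Phi> (pCons c h) * of_nat (card ({z. poly (- pCons 0 h) z = c} \<inter> B)) \<partial>lborel)"
      unfolding eq by (simp add: mult.commute)
    also have "\<dots> = (\<integral>\<^sup>+z. \<Phi> (pCons (poly (- pCons 0 h) z) h) * ennreal ((cmod (poly (pderiv (pCons 0 h)) z))\<^sup>2) * indicator B z \<partial>lborel)"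
      unfolding nd[symmetric] by (rule area_formula[OF B, where G="\<lambda>c. \<Phi> (pCons c h)"]) measurable
    finally show "(\<integral>\<^sup>+c. of_nat (card ({z. poly (pCons c h) z = 0} \<inter> B)) * \<Phi> (pCons c h) \<partial>lborel) =
      (\<integral>\<^sup>+z. indicator B z * (ennreal ((cmod (poly (pderiv (pCons 0 h)) z))\<^sup>2) * \<Phi> (pCons (- (z * poly h z)) h)) \<partial>lborel)"
      by (simp add: mult_ac)
  qed
  also have "\<dots> = (\<integral>\<^sup>+z. \<integral>\<^sup>+h. indicator B z * (ennreal ((cmod (poly (pderiv (pCons 0 h)) z))\<^sup>2) * \<Phi> (pCons (- (z * poly h z)) h)) \<partial>polyL m \<partial>lborel)"
    by (rule pair_sigma_finite.Fubini'[symmetric]) (unfold_locales, measurable)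
  also have "\<dots> = (\<integral>\<^sup>+z. indicator B z * (\<integral>\<^sup>+h. ennreal ((cmod (poly (pderiv (pCons 0 h)) z))\<^sup>2) * \<Phi> (pCons (- (z * poly h z)) h) \<partial>polyL m) \<partial>lborel)"
    by (intro nn_integral_cong nn_integral_cmult) measurable
  also have "\<dots> = (\<integral>\<^sup>+z. indicator B z * (\<integral>\<^sup>+h. ennreal ((cmod (poly h z))\<^sup>2) * \<Phi> ([:-z, 1:] * h) \<partial>polyL m) \<partial>lborel)"
  proof (rule nn_integral_cong)
    fix z :: complex
    define T where "T h = h - smult z (poly_shift 1 h)" for h
    have sh: "h = pCons (coeff h 0) (poly_shift 1 h)" for h :: "complex poly"
      by (simp add: poly_eq_iff coeff_pCons coeff_poly_shift split: nat.split)
    have T: "pCons (- (z * coeff h 0)) (T h) = [:-z, 1:] * h" for h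
      by (simp add: T_def poly_eq_iff coeff_pCons coeff_poly_shift split: nat.split)
    have p0: "z * poly (T h) z = z * coeff h 0" for h
      using arg_cong[OF T[of h], of "\<lambda>p. poly p z"] by simp
    have "pCons 0 (T h) = [:-z, 1:] * h + [:z * coeff h 0:]" for h
      unfolding T[symmetric] by simp
    then have pd: "poly (pderiv (pCons 0 (T h))) z = poly h z" for h
      by (simp only: pderiv_add pderiv_mult) (simp add: pderiv_pCons)
    define G where "G h = ennreal ((cmod (poly (pderiv (pCons 0 h)) z))\<^sup>2) * \<Phi> (pCons (- (z * poly h z)) h)" for h
    have [measurable]: "G \<in> borel_measurable pm" unfolding G_def by measurable
    have "G (T h) = ennreal ((cmod (poly h z))\<^sup>2) * \<Phi> ([:-z, 1:] * h)" for h
      by (simp only: G_def pd p0 T)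
    then have "(\<integral>\<^sup>+h. G h \<partial>polyL m) = (\<integral>\<^sup>+h. ennreal ((cmod (poly h z))\<^sup>2) * \<Phi> ([:-z, 1:] * h) \<partial>polyL m)"
      using nn_integral_polyL_shear[of G m z] by (simp add: T_def)
    then show "indicator B z * (\<integral>\<^sup>+h. ennreal ((cmod (poly (pderiv (pCons 0 h)) z))\<^sup>2) * \<Phi> (pCons (- (z * poly h z)) h) \<partial>polyL m) =
      indicator B z * (\<integral>\<^sup>+h. ennreal ((cmod (poly h z))\<^sup>2) * \<Phi> ([:-z, 1:] * h) \<partial>polyL m)"
      by (simp only: G_def)
  qed
  finally show ?thesis .
qed

section \<open>Lebesgue measure on tuples of complex numbers\<close>

abbreviation cL :: "nat \<Rightarrow> (nat \<Rightarrow> complex) measure" where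
  "cL k \<equiv> PiM {..<k} (\<lambda>_. lborel)"

interpretation cL: product_sigma_finite "\<lambda>_::nat. lborel :: complex measure" ..

lemma sigma_finite_cL: "sigma_finite_measure (cL k)"
  by (rule cL.sigma_finite) simp

interpretation cLk: sigma_finite_measure "cL k" for k
  by (rule sigma_finite_cL)

lemma measurable_cL_component [measurable (raw)]:
  assumes [measurable]: "f \<in> measurable M (cL k)"
  shows "(\<lambda>x. f x i) \<in> borel_measurable M"
proof (cases "i < k")
  case True
  then show ?thesis
    using measurable_compose[OF assms measurable_component_singleton[of i "{..<k}"]] by simp
next
  case False
  have "f x i = undefined" if "x \<in> space M" for x
    using measurable_space[OF assms that] False by (auto simp: space_PiM PiE_def extensional_def)
  then show ?thesis by (subst measurable_cong) auto
qed

lemma measurable_cL_upd [measurable (raw)]: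
  assumes [measurable]: "f \<in> measurable M (cL k)" "g \<in> borel_measurable M"
  shows "(\<lambda>x. (f x)(k := g x)) \<in> measurable M (cL (Suc k))"
proof (rule measurable_PiM_single')
  fix i assume "i \<in> {..<Suc k}"
  show "(\<lambda>x. ((f x)(k := g x)) i) \<in> measurable M lborel"
    by (cases "i = k") simp_all
next
  show "(\<lambda>x. (f x)(k := g x)) \<in> space M \<rightarrow> {..<Suc k} \<rightarrow>\<^sub>E space lborel"
    using measurable_space[OF assms(1)] by (auto simp: space_PiM PiE_def extensional_def Pi_def less_Suc_eq)
qed

lemma nn_integral_PiM_empty: "(\<integral>\<^sup>+x. F x \<partial>PiM {} (\<lambda>_. lborel)) = F (\<lambda>_. undefined)"
  by (simp add: PiM_empty nn_integral_count_space_finite)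

lemma emeasure_space_PiM_empty [simp]:
  "emeasure (PiM {} (\<lambda>_. lborel)) (space (PiM {} (\<lambda>_. lborel))) = 1"
  by (simp add: PiM_empty)

lemma nn_integral_cL_Suc:
  assumes "F \<in> borel_measurable (cL (Suc k))"
  shows "(\<integral>\<^sup>+x. F x \<partial>cL (Suc k)) = (\<integral>\<^sup>+x. \<integral>\<^sup>+t. F (x(k := t)) \<partial>lborel \<partial>cL k)"
  using cL.product_nn_integral_insert[of "{..<k}" k F] assms by (simp add: lessThan_Suc)

text \<open>Each coordinate undergoes an affine substitution in one complex variable, of real
  Jacobian \<open>|s i|^2\<close>. The shifts may be arbitrary measurable functions of the earlier
  coordinates, which is what the triangular Newton coordinates will require.\<close>

lemma nn_integral_cL_triangular:
  fixes s :: "nat \<Rightarrow> complex"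
  assumes s: "\<And>i. i < k \<Longrightarrow> s i \<noteq> 0" and A: "\<And>i. i < k \<Longrightarrow> A i \<in> borel_measurable (cL i)"
    and F: "F \<in> borel_measurable (cL k)"
  shows "(\<integral>\<^sup>+x. F x \<partial>cL k) =
    (\<Prod>i<k. ennreal ((cmod (s i))\<^sup>2)) * (\<integral>\<^sup>+x. F (\<lambda>i\<in>{..<k}. A i (restrict x {..<i}) + s i * x i) \<partial>cL k)"
  using assms
proof (induction k arbitrary: F)
  case 0
  show ?case by (simp add: nn_integral_PiM_empty)
next
  case (Suc k)
  note [measurable] = Suc.prems(3)
  have res [measurable]: "(\<lambda>x. restrict x {..<i}) \<in> measurable (cL k) (cL i)" if "i \<le> k" for i k
    using that by (intro measurable_restrict_subset) auto
  have A [measurable]: "A i \<in> borel_measurable (cL i)" if "i < Suc k" for i using Suc.prems(2)[OF that] .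
  have Ai [measurable]: "(\<lambda>x. A i (restrict x {..<i})) \<in> borel_measurable (cL k)" if "i \<le> k" for i
    using that by (intro measurable_compose[OF res A]) auto
  define V where "V k x = (\<lambda>i\<in>{..<k}. A i (restrict x {..<i}) + s i * x i)" for k x
  have V [measurable]: "V k \<in> measurable (cL k) (cL k)"
    unfolding V_def
  proof (rule measurable_restrict)
    fix i assume "i \<in> {..<k}"
    then have [measurable]: "(\<lambda>x. A i (restrict x {..<i})) \<in> borel_measurable (cL k)" by (intro Ai) auto
    show "(\<lambda>x. A i (restrict x {..<i}) + s i * x i) \<in> measurable (cL k) lborel" by measurable
  qed
  have "(\<integral>\<^sup>+x. F x \<partial>cL (Suc k)) = (\<integral>\<^sup>+x. \<integral>\<^sup>+t. F (x(k := t)) \<partial>lborel \<partial>cL k)"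
    by (rule nn_integral_cL_Suc) measurable
  also have "\<dots> = (\<Prod>i<k. ennreal ((cmod (s i))\<^sup>2)) * (\<integral>\<^sup>+x. \<integral>\<^sup>+t. F ((V k x)(k := t)) \<partial>lborel \<partial>cL k)"
    unfolding V_def
  proof (rule Suc.IH)
    show "(\<lambda>x. \<integral>\<^sup>+t. F (x(k := t)) \<partial>lborel) \<in> borel_measurable (cL k)" by measurable
  qed (use Suc.prems in auto)
  also have "(\<integral>\<^sup>+x. \<integral>\<^sup>+t. F ((V k x)(k := t)) \<partial>lborel \<partial>cL k) =
    (\<integral>\<^sup>+x. ennreal ((cmod (s k))\<^sup>2) * (\<integral>\<^sup>+t. F (V (Suc k) (x(k := t))) \<partial>lborel) \<partial>cL k)"
  proof (rule nn_integral_cong)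
    fix x assume x: "x \<in> space (cL k)"
    have "(\<integral>\<^sup>+t. F ((V k x)(k := t)) \<partial>lborel) =
      ennreal ((cmod (s k))\<^sup>2) * (\<integral>\<^sup>+t. F ((V k x)(k := A k x + s k * t)) \<partial>lborel)"
    proof (rule nn_integral_complex_affine)
      show "s k \<noteq> 0" using Suc.prems(1) by simp
      have "V k x \<in> space (cL k)" using measurable_space[OF V x] .
      then have "(\<lambda>t. (V k x)(k := t)) \<in> measurable borel (cL (Suc k))" by measurable
      then show "(\<lambda>t. F ((V k x)(k := t))) \<in> borel_measurable borel" by measurable
    qed
    moreover have "(V k x)(k := A k x + s k * t) = V (Suc k) (x(k := t))" for t
    proof -
      have r1: "restrict (x(k := t)) {..<i} = restrict x {..<i}" if "i \<le> k" for i
        using that by (auto simp: restrict_def)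
      have r2: "restrict x {..<k} = x"
        using x by (intro extensional_restrict) (auto simp: space_PiM PiE_def)
      show ?thesis
      proof (rule ext)
        fix i
        consider "i < k" | "i = k" | "i > k" by linarith
        then show "((V k x)(k := A k x + s k * t)) i = V (Suc k) (x(k := t)) i"
          by cases (simp_all add: V_def r1 r2 del: fun_upd_apply, simp_all)
      qed
    qed
    ultimately show "(\<integral>\<^sup>+t. F ((V k x)(k := t)) \<partial>lborel) =
      ennreal ((cmod (s k))\<^sup>2) * (\<integral>\<^sup>+t. F (V (Suc k) (x(k := t))) \<partial>lborel)" by simp
  qed
  also have "\<dots> = ennreal ((cmod (s k))\<^sup>2) * (\<integral>\<^sup>+x. \<integral>\<^sup>+t. F (V (Suc k) (x(k := t))) \<partial>lborel \<partial>cL k)"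
  proof (rule nn_integral_cmult)
    have "V (Suc k) \<in> measurable (cL (Suc k)) (cL (Suc k))"
      unfolding V_def
    proof (rule measurable_restrict)
      fix i assume "i \<in> {..<Suc k}"
      then have [measurable]: "(\<lambda>x. A i (restrict x {..<i})) \<in> borel_measurable (cL (Suc k))"
        by (intro measurable_compose[OF res A]) auto
      show "(\<lambda>x. A i (restrict x {..<i}) + s i * x i) \<in> measurable (cL (Suc k)) lborel" by measurable
    qed
    note [measurable] = this
    show "(\<lambda>x. \<integral>\<^sup>+t. F (V (Suc k) (x(k := t))) \<partial>lborel) \<in> borel_measurable (cL k)" by measurable
  qed
  also have "(\<integral>\<^sup>+x. \<integral>\<^sup>+t. F (V (Suc k) (x(k := t))) \<partial>lborel \<partial>cL k) = (\<integral>\<^sup>+x. F (V (Suc k) x) \<partial>cL (Suc k))"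
  proof (rule nn_integral_cL_Suc[symmetric])
    have "V (Suc k) \<in> measurable (cL (Suc k)) (cL (Suc k))"
      unfolding V_def
    proof (rule measurable_restrict)
      fix i assume "i \<in> {..<Suc k}"
      then have [measurable]: "(\<lambda>x. A i (restrict x {..<i})) \<in> borel_measurable (cL (Suc k))"
        by (intro measurable_compose[OF res A]) auto
      show "(\<lambda>x. A i (restrict x {..<i}) + s i * x i) \<in> measurable (cL (Suc k)) lborel" by measurable
    qed
    then show "(\<lambda>x. F (V (Suc k) x)) \<in> borel_measurable (cL (Suc k))" by measurable
  qed
  finally show ?case unfolding V_def by (simp only: prod.lessThan_Suc mult_ac)
qed

lemma nn_integral_cL_affine:
  fixes s a :: "nat \<Rightarrow> complex"
  assumes s: "\<And>i. i < k \<Longrightarrow> s i \<noteq> 0" and F: "F \<in> borel_measurable (cL k)"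
  shows "(\<integral>\<^sup>+x. F x \<partial>cL k) =
    (\<Prod>i<k. ennreal ((cmod (s i))\<^sup>2)) * (\<integral>\<^sup>+x. F (\<lambda>i\<in>{..<k}. a i + s i * x i) \<partial>cL k)"
  by (rule nn_integral_cL_triangular[where A="\<lambda>i _. a i"]) (use assms in auto)

definition append_fun :: "nat \<Rightarrow> nat \<Rightarrow> (nat \<Rightarrow> complex) \<Rightarrow> (nat \<Rightarrow> complex) \<Rightarrow> nat \<Rightarrow> complex" where
  "append_fun p q x y = (\<lambda>i\<in>{..<p+q}. if i < p then x i else y (i - p))"

lemma measurable_append_fun [measurable (raw)]:
  assumes [measurable]: "f \<in> measurable M (cL p)" "g \<in> measurable M (cL q)"
  shows "(\<lambda>x. append_fun p q (f x) (g x)) \<in> measurable M (cL (p + q))"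
  unfolding append_fun_def
proof (rule measurable_restrict)
  fix i show "(\<lambda>x. if i < p then f x i else g x (i - p)) \<in> measurable M lborel"
    by (cases "i < p") simp_all
qed

lemma nn_integral_cL_append:
  assumes "F \<in> borel_measurable (cL (p + q))"
  shows "(\<integral>\<^sup>+x. F x \<partial>cL (p + q)) = (\<integral>\<^sup>+x. \<integral>\<^sup>+y. F (append_fun p q x y) \<partial>cL q \<partial>cL p)"
  using assms
proof (induction q arbitrary: F)
  case 0
  have "append_fun p 0 x y = x" if "x \<in> space (cL p)" for x y
    using that by (auto simp: append_fun_def space_PiM PiE_def extensional_def fun_eq_iff)
  then have "(\<integral>\<^sup>+x. \<integral>\<^sup>+y. F (append_fun p 0 x y) \<partial>cL 0 \<partial>cL p) = (\<integral>\<^sup>+x. F x \<partial>cL p)"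
    by (intro nn_integral_cong) simp
  then show ?case by simp
next
  case (Suc q)
  have [measurable]: "F \<in> borel_measurable (cL (Suc (p + q)))" "F \<in> borel_measurable (cL (p + Suc q))" using Suc.prems by simp_all
  have "(\<integral>\<^sup>+x. F x \<partial>cL (p + Suc q)) = (\<integral>\<^sup>+x. \<integral>\<^sup>+t. F (x(p + q := t)) \<partial>lborel \<partial>cL (p + q))"
    using nn_integral_cL_Suc[of F "p + q"] by simp
  also have "\<dots> = (\<integral>\<^sup>+x. \<integral>\<^sup>+y. \<integral>\<^sup>+t. F ((append_fun p q x y)(p + q := t)) \<partial>lborel \<partial>cL q \<partial>cL p)"
    by (rule Suc.IH) measurable
  also have "\<dots> = (\<integral>\<^sup>+x. \<integral>\<^sup>+y. \<integral>\<^sup>+t. F (append_fun p (Suc q) x (y(q := t))) \<partial>lborel \<partial>cL q \<partial>cL p)"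
  proof -
    have "(append_fun p q x y)(p + q := t) = append_fun p (Suc q) x (y(q := t))" for x y t
      by (auto simp: append_fun_def fun_eq_iff)
    then show ?thesis by simp
  qed
  also have "\<dots> = (\<integral>\<^sup>+x. \<integral>\<^sup>+y. F (append_fun p (Suc q) x y) \<partial>cL (Suc q) \<partial>cL p)"
  proof (intro nn_integral_cong nn_integral_cL_Suc[symmetric])
    fix x assume [measurable]: "x \<in> space (cL p)"
    show "(\<lambda>y. F (append_fun p (Suc q) x y)) \<in> borel_measurable (cL (Suc q))" by measurable
  qed
  finally show ?case .
qed

subsection \<open>A Kac--Rice formula\<close>

definition rootp :: "nat \<Rightarrow> (nat \<Rightarrow> complex) \<Rightarrow> complex poly" where
  "rootp k z = (\<Prod>j<k. [:- z j, 1:])"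

text \<open>The modulus of the Vandermonde determinant.\<close>

definition vdm :: "nat \<Rightarrow> (nat \<Rightarrow> complex) \<Rightarrow> real" where
  "vdm k z = (\<Prod>j<k. \<Prod>i<j. cmod (z j - z i))"

lemma poly_rootp: "poly (rootp k z) w = (\<Prod>j<k. w - z j)"
  by (simp add: rootp_def poly_prod)

lemma rootp_Suc_upd: "rootp (Suc k) (z(k := t)) = [:-t, 1:] * rootp k z"
  by (simp add: rootp_def mult.commute)

lemma vdm_Suc_upd: "vdm (Suc k) (z(k := t)) = vdm k z * (\<Prod>i<k. cmod (t - z i))"
proof -
  have "(\<Prod>j<k. \<Prod>i<j. cmod ((z(k := t)) j - (z(k := t)) i)) = vdm k z"
    unfolding vdm_def by (intro prod.cong) auto
  moreover have "(\<Prod>i<k. cmod (t - (z(k := t)) i)) = (\<Prod>i<k. cmod (t - z i))"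
    by (intro prod.cong) auto
  ultimately show ?thesis by (simp add: vdm_def)
qed

lemma measurable_rootp [measurable (raw)]:
  assumes [measurable]: "f \<in> measurable M (cL k)"
  shows "(\<lambda>x. rootp k (f x)) \<in> measurable M pm"
  unfolding rootp_def by measurable

lemma measurable_vdm [measurable (raw)]:
  assumes [measurable]: "f \<in> measurable M (cL k)"
  shows "(\<lambda>x. vdm k (f x)) \<in> borel_measurable M"
  unfolding vdm_def by measurable

text \<open>Roots are split off one at a time. Each new root \<open>t\<close> brings the weight
  \<open>|h t|^2\<close>, where \<open>h\<close> contains the linear factors of the remaining roots;
  these supply the squared Vandermonde determinant.\<close>

theorem nn_integral_zero_counts:
  assumes B: "\<And>j. j < k \<Longrightarrow> open (B j)" and dj: "disjoint_family_on B {..<k}"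
    and "\<Phi> \<in> borel_measurable pm"
  shows "(\<integral>\<^sup>+f. (\<Prod>j<k. of_nat (card ({z. poly f z = 0} \<inter> B j))) * \<Phi> f \<partial>polyL (m + k)) =
    (\<integral>\<^sup>+z. (\<Prod>j<k. indicator (B j) (z j)) * (ennreal ((vdm k z)\<^sup>2) *
      (\<integral>\<^sup>+g. (\<Prod>j<k. ennreal ((cmod (poly g (z j)))\<^sup>2)) * \<Phi> (rootp k z * g) \<partial>polyL m)) \<partial>cL k)"
  using assms
proof (induction k arbitrary: \<Phi>)
  case 0
  then show ?case by (simp add: nn_integral_PiM_empty vdm_def rootp_def)
next
  case (Suc k)
  note [measurable] = Suc.prems(3)
  have oB: "\<And>j. j < k \<Longrightarrow> open (B j)" "open (B k)" using Suc.prems(1) by auto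
  have [measurable]: "(\<lambda>f. of_nat (card ({z. poly f z = 0} \<inter> B j)) :: ennreal) \<in> borel_measurable pm" if "j < k" for j
    by (rule measurable_compose[OF measurable_card_zeros[OF _ oB(1)[OF that]]]) auto
  have [measurable]: "B k \<in> sets borel" "\<And>j. j < k \<Longrightarrow> B j \<in> sets borel" using oB by auto
  have dj: "disjoint_family_on B {..<k}" using Suc.prems(2) by (auto simp: disjoint_family_on_def)
  have "(\<integral>\<^sup>+f. (\<Prod>j<Suc k. of_nat (card ({z. poly f z = 0} \<inter> B j))) * \<Phi> f \<partial>polyL (m + Suc k)) =
    (\<integral>\<^sup>+f. of_nat (card ({z. poly f z = 0} \<inter> B k)) * ((\<Prod>j<k. of_nat (card ({z. poly f z = 0} \<inter> B j))) * \<Phi> f) \<partial>polyL (Suc (m + k)))"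
    by (simp add: mult_ac del: polyL.simps)
  also have "\<dots> = (\<integral>\<^sup>+t. indicator (B k) t * (\<integral>\<^sup>+h. ennreal ((cmod (poly h t))\<^sup>2) *
    ((\<Prod>j<k. of_nat (card ({z. poly ([:-t, 1:] * h) z = 0} \<inter> B j))) * \<Phi> ([:-t, 1:] * h)) \<partial>polyL (m + k)) \<partial>lborel)"
    by (rule zero_count_step[OF oB(2)]) measurable
  also have "\<dots> = (\<integral>\<^sup>+t. indicator (B k) t * (\<integral>\<^sup>+z. (\<Prod>j<k. indicator (B j) (z j)) * (ennreal ((vdm k z)\<^sup>2) *
      (\<integral>\<^sup>+g. (\<Prod>j<k. ennreal ((cmod (poly g (z j)))\<^sup>2)) *
        (ennreal ((cmod (poly (rootp k z * g) t))\<^sup>2) * \<Phi> ([:-t, 1:] * (rootp k z * g))) \<partial>polyL m)) \<partial>cL k) \<partial>lborel)"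
  proof (rule nn_integral_cong)
    fix t
    show "indicator (B k) t * (\<integral>\<^sup>+h. ennreal ((cmod (poly h t))\<^sup>2) *
      ((\<Prod>j<k. of_nat (card ({z. poly ([:-t, 1:] * h) z = 0} \<inter> B j))) * \<Phi> ([:-t, 1:] * h)) \<partial>polyL (m + k)) =
      indicator (B k) t * (\<integral>\<^sup>+z. (\<Prod>j<k. indicator (B j) (z j)) * (ennreal ((vdm k z)\<^sup>2) *
      (\<integral>\<^sup>+g. (\<Prod>j<k. ennreal ((cmod (poly g (z j)))\<^sup>2)) *
        (ennreal ((cmod (poly (rootp k z * g) t))\<^sup>2) * \<Phi> ([:-t, 1:] * (rootp k z * g))) \<partial>polyL m)) \<partial>cL k)"
    proof (cases "t \<in> B k")
      case True
      \<comment> \<open>Here disjointness enters: a root at \<open>t\<close> in \<open>B k\<close>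
        adds no zero in the other sets.\<close>
      have "{z. poly ([:-t, 1:] * h) z = 0} \<inter> B j = {z. poly h z = 0} \<inter> B j" if "j < k" for h j
      proof -
        have "B j \<inter> B k = {}" using Suc.prems(2) that by (auto simp: disjoint_family_on_def)
        then show ?thesis using True by auto
      qed
      then have "(\<integral>\<^sup>+h. ennreal ((cmod (poly h t))\<^sup>2) *
        ((\<Prod>j<k. of_nat (card ({z. poly ([:-t, 1:] * h) z = 0} \<inter> B j))) * \<Phi> ([:-t, 1:] * h)) \<partial>polyL (m + k)) =
        (\<integral>\<^sup>+h. (\<Prod>j<k. of_nat (card ({z. poly h z = 0} \<inter> B j))) * (ennreal ((cmod (poly h t))\<^sup>2) * \<Phi> ([:-t, 1:] * h)) \<partial>polyL (m + k))"
        by (simp add: mult_ac del: mult_pCons_left)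
      also have "\<dots> = (\<integral>\<^sup>+z. (\<Prod>j<k. indicator (B j) (z j)) * (ennreal ((vdm k z)\<^sup>2) *
      (\<integral>\<^sup>+g. (\<Prod>j<k. ennreal ((cmod (poly g (z j)))\<^sup>2)) *
        (ennreal ((cmod (poly (rootp k z * g) t))\<^sup>2) * \<Phi> ([:-t, 1:] * (rootp k z * g))) \<partial>polyL m)) \<partial>cL k)"
        by (rule Suc.IH[OF oB(1) dj]) auto
      finally show ?thesis by simp
    qed simp
  qed
  also have "\<dots> = (\<integral>\<^sup>+t. \<integral>\<^sup>+z. indicator (B k) t * ((\<Prod>j<k. indicator (B j) (z j)) * (ennreal ((vdm k z)\<^sup>2) *
      (\<integral>\<^sup>+g. (\<Prod>j<k. ennreal ((cmod (poly g (z j)))\<^sup>2)) *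
        (ennreal ((cmod (poly (rootp k z * g) t))\<^sup>2) * \<Phi> ([:-t, 1:] * (rootp k z * g))) \<partial>polyL m))) \<partial>cL k \<partial>lborel)"
    by (intro nn_integral_cong nn_integral_cmult[symmetric]) measurable
  also have "\<dots> = (\<integral>\<^sup>+z. \<integral>\<^sup>+t. indicator (B k) t * ((\<Prod>j<k. indicator (B j) (z j)) * (ennreal ((vdm k z)\<^sup>2) *
      (\<integral>\<^sup>+g. (\<Prod>j<k. ennreal ((cmod (poly g (z j)))\<^sup>2)) *
        (ennreal ((cmod (poly (rootp k z * g) t))\<^sup>2) * \<Phi> ([:-t, 1:] * (rootp k z * g))) \<partial>polyL m))) \<partial>lborel \<partial>cL k)"
    by (rule pair_sigma_finite.Fubini') (unfold_locales, measurable)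
  also have "\<dots> = (\<integral>\<^sup>+z. \<integral>\<^sup>+t. (\<Prod>j<Suc k. indicator (B j) ((z(k := t)) j)) * (ennreal ((vdm (Suc k) (z(k := t)))\<^sup>2) *
      (\<integral>\<^sup>+g. (\<Prod>j<Suc k. ennreal ((cmod (poly g ((z(k := t)) j)))\<^sup>2)) * \<Phi> (rootp (Suc k) (z(k := t)) * g) \<partial>polyL m)) \<partial>lborel \<partial>cL k)"
  proof (intro nn_integral_cong)
    fix z t assume z [measurable]: "z \<in> space (cL k)"
    have 1: "(\<Prod>j<Suc k. indicator (B j) ((z(k := t)) j)) = indicator (B k) t * (\<Prod>j<k. indicator (B j) (z j) :: ennreal)"
    proof -
      have "(\<Prod>j<k. indicator (B j) ((z(k := t)) j)) = (\<Prod>j<k. indicator (B j) (z j) :: ennreal)"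
        by (intro prod.cong) auto
      then show ?thesis by (simp add: mult.commute del: fun_upd_apply) simp
    qed
    have 2: "(\<Prod>j<Suc k. ennreal ((cmod (poly g ((z(k := t)) j)))\<^sup>2)) = ennreal ((cmod (poly g t))\<^sup>2) * (\<Prod>j<k. ennreal ((cmod (poly g (z j)))\<^sup>2))" for g
    proof -
      have "(\<Prod>j<k. ennreal ((cmod (poly g ((z(k := t)) j)))\<^sup>2)) = (\<Prod>j<k. ennreal ((cmod (poly g (z j)))\<^sup>2))"
        by (intro prod.cong) auto
      then show ?thesis by (simp add: mult.commute del: fun_upd_apply) simp
    qed
    define V where "V = ennreal ((\<Prod>i<k. cmod (t - z i))\<^sup>2)"
    have 3: "ennreal ((vdm (Suc k) (z(k := t)))\<^sup>2) = ennreal ((vdm k z)\<^sup>2) * V"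
      unfolding vdm_Suc_upd V_def by (simp add: power_mult_distrib ennreal_mult)
    have 4: "ennreal ((cmod (poly (rootp k z * g) t))\<^sup>2) = V * ennreal ((cmod (poly g t))\<^sup>2)" for g
      unfolding V_def by (simp add: poly_rootp norm_mult prod_norm[symmetric] power_mult_distrib ennreal_mult)
    have 5: "[:-t, 1:] * (rootp k z * g) = rootp (Suc k) (z(k := t)) * g" for g
      unfolding rootp_Suc_upd by (simp only: mult.assoc)
    have [measurable]: "(\<lambda>g. rootp (Suc k) (z(k := t)) * g) \<in> measurable pm pm"
      by measurable
    have "(\<integral>\<^sup>+g. (\<Prod>j<k. ennreal ((cmod (poly g (z j)))\<^sup>2)) *
        (ennreal ((cmod (poly (rootp k z * g) t))\<^sup>2) * \<Phi> ([:-t, 1:] * (rootp k z * g))) \<partial>polyL m) =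
      (\<integral>\<^sup>+g. V * ((\<Prod>j<Suc k. ennreal ((cmod (poly g ((z(k := t)) j)))\<^sup>2)) * \<Phi> (rootp (Suc k) (z(k := t)) * g)) \<partial>polyL m)"
      unfolding 2 4 5 by (simp add: mult_ac)
    also have "\<dots> = V * (\<integral>\<^sup>+g. (\<Prod>j<Suc k. ennreal ((cmod (poly g ((z(k := t)) j)))\<^sup>2)) * \<Phi> (rootp (Suc k) (z(k := t)) * g) \<partial>polyL m)"
      by (rule nn_integral_cmult) measurable
    finally show "indicator (B k) t * ((\<Prod>j<k. indicator (B j) (z j)) * (ennreal ((vdm k z)\<^sup>2) *
      (\<integral>\<^sup>+g. (\<Prod>j<k. ennreal ((cmod (poly g (z j)))\<^sup>2)) *
        (ennreal ((cmod (poly (rootp k z * g) t))\<^sup>2) * \<Phi> ([:-t, 1:] * (rootp k z * g))) \<partial>polyL m))) =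
      (\<Prod>j<Suc k. indicator (B j) ((z(k := t)) j)) * (ennreal ((vdm (Suc k) (z(k := t)))\<^sup>2) *
      (\<integral>\<^sup>+g. (\<Prod>j<Suc k. ennreal ((cmod (poly g ((z(k := t)) j)))\<^sup>2)) * \<Phi> (rootp (Suc k) (z(k := t)) * g) \<partial>polyL m))"
      unfolding 1 3 by (simp add: mult_ac)
  qed
  also have "\<dots> = (\<integral>\<^sup>+z. (\<Prod>j<Suc k. indicator (B j) (z j)) * (ennreal ((vdm (Suc k) z)\<^sup>2) *
      (\<integral>\<^sup>+g. (\<Prod>j<Suc k. ennreal ((cmod (poly g (z j)))\<^sup>2)) * \<Phi> (rootp (Suc k) z * g) \<partial>polyL m)) \<partial>cL (Suc k))"
  proof (rule nn_integral_cL_Suc[symmetric])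
    have [measurable]: "(\<lambda>z::nat \<Rightarrow> complex. indicator (B j) (z j) :: ennreal) \<in> borel_measurable (cL (Suc k))" if "j < Suc k" for j
    proof -
      have [measurable]: "B j \<in> sets borel" using Suc.prems(1)[OF that] by simp
      show ?thesis by measurable
    qed
    show "(\<lambda>z. (\<Prod>j<Suc k. indicator (B j) (z j)) * (ennreal ((vdm (Suc k) z)\<^sup>2) *
      (\<integral>\<^sup>+g. (\<Prod>j<Suc k. ennreal ((cmod (poly g (z j)))\<^sup>2)) * \<Phi> (rootp (Suc k) z * g) \<partial>polyL m))) \<in> borel_measurable (cL (Suc k))"
      by measurable
  qed
  finally show ?case .
qed

declare polyL.simps [simp del]

subsection \<open>Interpolation coordinates\<close>

text \<open>The recursion divides by \<open>X - z k\<close> at each stage. This matches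
  \<open>nn_integral_polyL_divide\<close> and makes the change of variables below an
  induction.\<close>

fun interp :: "nat \<Rightarrow> (nat \<Rightarrow> complex) \<Rightarrow> (nat \<Rightarrow> complex) \<Rightarrow> complex poly" where
  "interp 0 z x = 0"
| "interp (Suc k) z x = [:x k:] + [:- z k, 1:] * interp k z (\<lambda>j. (x j - x k) / (z j - z k))"

lemma degree_interp: "interp k z x = 0 \<or> degree (interp k z x) < k"
proof (induction k arbitrary: x)
  case (Suc k)
  define h where "h = interp k z (\<lambda>j. (x j - x k) / (z j - z k))"
  have "degree ([:x k:] + [:- z k, 1:] * h) \<le> max (degree [:x k:]) (degree ([:- z k, 1:] * h))"
    by (rule degree_add_le_max)
  also have "\<dots> < Suc k"
  proof (cases "h = 0")
    case False
    then have "degree ([:- z k, 1:] * h) \<le> 1 + degree h"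
      using degree_mult_le[of "[:- z k, 1:]" h] by simp
    then show ?thesis using Suc.IH[of "\<lambda>j. (x j - x k) / (z j - z k)"] False by (simp add: h_def)
  qed simp
  finally show ?case by (simp add: h_def)
qed simp

lemma poly_interp:
  assumes "inj_on z {..<k}" "j < k"
  shows "poly (interp k z x) (z j) = x j"
  using assms
proof (induction k arbitrary: x)
  case (Suc k)
  show ?case
  proof (cases "j = k")
    case False
    then have "j < k" using Suc.prems by simp
    moreover have "inj_on z {..<k}" using Suc.prems(1) by (auto intro: inj_on_subset)
    ultimately have IH: "poly (interp k z (\<lambda>j. (x j - x k) / (z j - z k))) (z j) = (x j - x k) / (z j - z k)"
      by (rule Suc.IH[rotated])
    have "poly (interp (Suc k) z x) (z j) = x k + (z j - z k) * ((x j - x k) / (z j - z k))"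
      unfolding IH[symmetric] by (simp add: algebra_simps)
    moreover have "z j \<noteq> z k" using Suc.prems False by (auto simp: inj_on_def)
    ultimately show ?thesis by simp
  qed simp
qed simp

lemma measurable_interp:
  "(\<And>j. j < k \<Longrightarrow> (\<lambda>w. x w j) \<in> borel_measurable M) \<Longrightarrow> (\<lambda>w. interp k z (x w)) \<in> measurable M pm"
proof (induction k arbitrary: x)
  case (Suc k)
  have [measurable]: "(\<lambda>w. x w j) \<in> borel_measurable M" if "j < Suc k" for j using Suc.prems[OF that] .
  have [measurable]: "(\<lambda>w. interp k z (\<lambda>j. (x w j - x w k) / (z j - z k))) \<in> measurable M pm"
    by (rule Suc.IH) measurable
  show ?case by simp measurable
qed simp

lemma measurable_interp_cL [measurable (raw)]:
  assumes [measurable]: "f \<in> measurable M (cL k)"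
  shows "(\<lambda>x. interp k z (f x)) \<in> measurable M pm"
  by (rule measurable_interp) measurable

lemma interp_cong: "(\<And>j. j < k \<Longrightarrow> x j = y j) \<Longrightarrow> interp k z x = interp k z y"
proof (induction k arbitrary: x y)
  case (Suc k)
  then have "interp k z (\<lambda>j. (x j - x k) / (z j - z k)) = interp k z (\<lambda>j. (y j - y k) / (z j - z k))"
    by (intro Suc.IH) auto
  then show ?case using Suc.prems[of k] by simp
qed simp

lemma vdm_pos: "inj_on z {..<k} \<Longrightarrow> vdm k z > 0"
  unfolding vdm_def by (intro prod_pos ballI) (auto dest: inj_onD)

lemma vdm_Suc: "vdm (Suc k) z = vdm k z * (\<Prod>i<k. cmod (z k - z i))"
  by (simp add: vdm_def)

lemma rootp_Suc: "rootp (Suc k) z = [:- z k, 1:] * rootp k z"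
  by (simp add: rootp_def mult.commute)

text \<open>Values at the nodes together with the quotient by the root polynomial are linear
  coordinates on the polynomials. The complex Jacobian is the Vandermonde determinant up to modulus,
  and a complex factor counts with its squared modulus. In the induction the passage from values to
  divided differences produces the new distances.\<close>

lemma nn_integral_polyL_interp:
  assumes "inj_on z {..<k}" "F \<in> borel_measurable pm"
  shows "ennreal ((vdm k z)\<^sup>2) * (\<integral>\<^sup>+f. F f \<partial>polyL (m + k)) =
    (\<integral>\<^sup>+x. \<integral>\<^sup>+g. F (interp k z x + rootp k z * g) \<partial>polyL m \<partial>cL k)"
  using assms
proof (induction k arbitrary: F)
  case 0
  then show ?case by (simp add: nn_integral_PiM_empty vdm_def rootp_def)
next
  case (Suc k)
  note [measurable] = Suc.prems(2)
  have inj: "inj_on z {..<k}" using Suc.prems(1) by (auto intro: inj_on_subset)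
  define V where "V = (\<Prod>i<k. ennreal ((cmod (z k - z i))\<^sup>2))"
  have nz: "z i - z k \<noteq> 0" if "i < k" for i
    using Suc.prems(1) that by (auto simp: inj_on_def)
  have V: "V * (\<Prod>i<k. ennreal ((cmod (1 / (z i - z k)))\<^sup>2)) = 1"
    unfolding V_def prod.distrib[symmetric]
  proof (rule prod.neutral, rule ballI)
    fix i assume "i \<in> {..<k}"
    then show "ennreal ((cmod (z k - z i))\<^sup>2) * ennreal ((cmod (1 / (z i - z k)))\<^sup>2) = 1"
      using nz[of i] by (simp add: ennreal_mult[symmetric] norm_divide norm_minus_commute power_divide)
  qed
  have vdm: "ennreal ((vdm (Suc k) z)\<^sup>2) = ennreal ((vdm k z)\<^sup>2) * V"
    by (simp add: vdm_Suc V_def power_mult_distrib ennreal_mult prod_ennreal prod_power_distrib prod_nonneg)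
  have [measurable]: "(\<lambda>x. interp k z x) \<in> measurable (cL k) pm"
    using measurable_interp_cL[OF measurable_ident] by simp
  have [measurable]: "(\<lambda>w. interp k z (\<lambda>j. (fst w j - snd w) / (z j - z k))) \<in> measurable (cL k \<Otimes>\<^sub>M lborel) pm"
    by (rule measurable_interp) measurable
  have mI [measurable]: "(\<lambda>w. interp k z (\<lambda>j. (snd w j - fst w) / (z j - z k))) \<in> measurable (lborel \<Otimes>\<^sub>M cL k) pm"
    by (rule measurable_interp) measurable
  have "ennreal ((vdm (Suc k) z)\<^sup>2) * (\<integral>\<^sup>+f. F f \<partial>polyL (m + Suc k)) =
    V * (ennreal ((vdm k z)\<^sup>2) * (\<integral>\<^sup>+c. \<integral>\<^sup>+h. F ([:c:] + [:-z k, 1:] * h) \<partial>polyL (m + k) \<partial>lborel))"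
    using nn_integral_polyL_divide[of F "m + k" "z k"] by (simp add: vdm mult_ac del: polyL.simps mult_pCons_left)
  also have "\<dots> = V * (\<integral>\<^sup>+c. ennreal ((vdm k z)\<^sup>2) * (\<integral>\<^sup>+h. F ([:c:] + [:-z k, 1:] * h) \<partial>polyL (m + k)) \<partial>lborel)"
    by (subst nn_integral_cmult) measurable
  also have "\<dots> = V * (\<integral>\<^sup>+c. \<integral>\<^sup>+y. \<integral>\<^sup>+g. F ([:c:] + [:-z k, 1:] * (interp k z y + rootp k z * g)) \<partial>polyL m \<partial>cL k \<partial>lborel)"
    by (intro arg_cong2[where f="(*)"] refl nn_integral_cong Suc.IH[OF inj]) measurable
  also have "\<dots> = (\<integral>\<^sup>+c. V * (\<integral>\<^sup>+y. \<integral>\<^sup>+g. F ([:c:] + [:-z k, 1:] * (interp k z y + rootp k z * g)) \<partial>polyL m \<partial>cL k) \<partial>lborel)"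
    by (subst nn_integral_cmult) measurable
  also have "\<dots> = (\<integral>\<^sup>+c. \<integral>\<^sup>+x. \<integral>\<^sup>+g. F ([:c:] + [:-z k, 1:] * (interp k z (\<lambda>j. (x j - c) / (z j - z k)) + rootp k z * g)) \<partial>polyL m \<partial>cL k \<partial>lborel)"
  proof (rule nn_integral_cong)
    fix c
    have "(\<integral>\<^sup>+y. \<integral>\<^sup>+g. F ([:c:] + [:-z k, 1:] * (interp k z y + rootp k z * g)) \<partial>polyL m \<partial>cL k) =
      (\<Prod>i<k. ennreal ((cmod (1 / (z i - z k)))\<^sup>2)) * (\<integral>\<^sup>+x. \<integral>\<^sup>+g. F ([:c:] + [:-z k, 1:] *
        (interp k z (\<lambda>i\<in>{..<k}. - c / (z i - z k) + 1 / (z i - z k) * x i) + rootp k z * g)) \<partial>polyL m \<partial>cL k)"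
    proof (rule nn_integral_cL_affine)
      show "1 / (z i - z k) \<noteq> 0" if "i < k" for i using nz[OF that] by simp
      show "(\<lambda>y. \<integral>\<^sup>+g. F ([:c:] + [:-z k, 1:] * (interp k z y + rootp k z * g)) \<partial>polyL m) \<in> borel_measurable (cL k)"
        by measurable
    qed
    moreover have "interp k z (\<lambda>i\<in>{..<k}. - c / (z i - z k) + 1 / (z i - z k) * x i) = interp k z (\<lambda>j. (x j - c) / (z j - z k))" for x
      by (rule interp_cong) (simp add: diff_divide_distrib)
    ultimately show "V * (\<integral>\<^sup>+y. \<integral>\<^sup>+g. F ([:c:] + [:-z k, 1:] * (interp k z y + rootp k z * g)) \<partial>polyL m \<partial>cL k) =
      (\<integral>\<^sup>+x. \<integral>\<^sup>+g. F ([:c:] + [:-z k, 1:] * (interp k z (\<lambda>j. (x j - c) / (z j - z k)) + rootp k z * g)) \<partial>polyL m \<partial>cL k)"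
      using V by (simp only: mult.assoc[symmetric] mult_1_left)
  qed
  also have "\<dots> = (\<integral>\<^sup>+x. \<integral>\<^sup>+c. \<integral>\<^sup>+g. F ([:c:] + [:-z k, 1:] * (interp k z (\<lambda>j. (x j - c) / (z j - z k)) + rootp k z * g)) \<partial>polyL m \<partial>lborel \<partial>cL k)"
    by (rule pair_sigma_finite.Fubini'[symmetric]) (unfold_locales, measurable)
  also have "\<dots> = (\<integral>\<^sup>+x. \<integral>\<^sup>+c. \<integral>\<^sup>+g. F (interp (Suc k) z (x(k := c)) + rootp (Suc k) z * g) \<partial>polyL m \<partial>lborel \<partial>cL k)"
  proof -
    have "[:c:] + [:-z k, 1:] * (interp k z (\<lambda>j. (x j - c) / (z j - z k)) + rootp k z * g) =
      interp (Suc k) z (x(k := c)) + rootp (Suc k) z * g" for x c g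
    proof -
      have "interp k z (\<lambda>j. ((x(k := c)) j - (x(k := c)) k) / (z j - z k)) = interp k z (\<lambda>j. (x j - c) / (z j - z k))"
        by (rule interp_cong) simp
      then show ?thesis unfolding interp.simps rootp_Suc by (simp only: fun_upd_same distrib_left mult.assoc add.assoc)
    qed
    then show ?thesis by (simp only:)
  qed
  also have "\<dots> = (\<integral>\<^sup>+x. \<integral>\<^sup>+g. F (interp (Suc k) z x + rootp (Suc k) z * g) \<partial>polyL m \<partial>cL (Suc k))"
  proof (rule nn_integral_cL_Suc[symmetric])
    have [measurable]: "(\<lambda>x. interp (Suc k) z x) \<in> measurable (cL (Suc k)) pm"
      by (rule measurable_interp) measurable
    show "(\<lambda>x. \<integral>\<^sup>+g. F (interp (Suc k) z x + rootp (Suc k) z * g) \<partial>polyL m) \<in> borel_measurable (cL (Suc k))"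
      by measurable
  qed
  finally show ?case .
qed

subsection \<open>The law of the random polynomial\<close>

lemma nn_integral_gaussian: "(\<integral>\<^sup>+x. ennreal (exp (- (x::real)\<^sup>2)) \<partial>lborel) = ennreal (sqrt pi)"
proof -
  have "has_bochner_integral lborel (\<lambda>x::real. exp (- x\<^sup>2)) (2 *\<^sub>R (sqrt pi / 2))"
    by (rule has_bochner_integral_even_function[OF gaussian_moment_0]) simp
  then show ?thesis
    by (simp add: has_bochner_integral_iff nn_integral_eq_integral)
qed

lemma nn_integral_complex_gaussian: "(\<integral>\<^sup>+z. ennreal (exp (- (cmod z)\<^sup>2)) \<partial>lborel) = ennreal pi"
proof -
  have "(\<integral>\<^sup>+z. ennreal (exp (- (cmod z)\<^sup>2)) \<partial>lborel) = (\<integral>\<^sup>+z. (\<Prod>b\<in>Basis. ennreal (exp (- (z \<bullet> b)\<^sup>2))) \<partial>(lborel :: complex measure))"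
    by (intro nn_integral_cong) (simp add: Basis_complex_def cmod_power2 exp_add[symmetric] ennreal_mult[symmetric] inner_complex_def)
  also have "\<dots> = (\<Prod>b\<in>(Basis :: complex set). \<integral>\<^sup>+x. ennreal (exp (- x\<^sup>2)) \<partial>lborel)"
    by (rule nn_integral_lborel_prod) auto
  also have "\<dots> = ennreal pi"
    by (simp add: nn_integral_gaussian Basis_complex_def ennreal_mult[symmetric])
  finally show ?thesis .
qed

lemma emeasure_std_complex_gaussian: "emeasure std_complex_gaussian UNIV = 1"
proof -
  have "emeasure std_complex_gaussian UNIV = (\<integral>\<^sup>+z. ennreal (exp (- (cmod z)\<^sup>2)) * ennreal (1 / pi) \<partial>lborel)"
    by (simp add: std_complex_gaussian_def emeasure_density ennreal_mult[symmetric])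
  also have "\<dots> = ennreal pi * ennreal (1 / pi)"
    by (subst nn_integral_multc) (simp_all add: nn_integral_complex_gaussian)
  also have "\<dots> = 1" by (simp add: ennreal_mult[symmetric])
  finally show ?thesis .
qed

lemma sets_std_complex_gaussian [simp, measurable_cong]: "sets std_complex_gaussian = sets borel"
  by (simp add: std_complex_gaussian_def)

lemma space_std_complex_gaussian [simp]: "space std_complex_gaussian = UNIV"
  by (simp add: std_complex_gaussian_def)

interpretation gauss: prob_space std_complex_gaussian
  by standard (simp add: emeasure_std_complex_gaussian)

interpretation gaussP: product_sigma_finite "\<lambda>_::nat. std_complex_gaussian" ..

text \<open>\<open>polyL\<close> grows at the constant coefficient, the product of the Gaussian laws
  at the last index. Splitting off the top coefficient lets the two inductions meet.\<close>

lemma nn_integral_polyL_top: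
  assumes [measurable]: "F \<in> borel_measurable pm"
  shows "(\<integral>\<^sup>+f. F f \<partial>polyL (Suc m)) = (\<integral>\<^sup>+h. \<integral>\<^sup>+c. F (h + monom c m) \<partial>lborel \<partial>polyL m)"
  using assms
proof (induction m arbitrary: F)
  case 0
  note [measurable] = 0
  have mon: "monom c 0 = pCons c 0" for c :: complex by (simp add: monom_0)
  show ?case unfolding mon by (subst nn_integral_polyL_0, measurable)
    (simp add: nn_integral_polyL_Suc nn_integral_polyL_0 del: polyL.simps)
next
  case (Suc m)
  note [measurable] = Suc.prems
  have [measurable]: "(\<lambda>c. monom c j) \<in> measurable borel pm" for j
    by (rule measurable_pmI) (simp add: coeff_monom)
  have "(\<integral>\<^sup>+f. F f \<partial>polyL (Suc (Suc m))) = (\<integral>\<^sup>+b. \<integral>\<^sup>+f. F (pCons b f) \<partial>polyL (Suc m) \<partial>lborel)"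
    by (rule nn_integral_polyL_Suc) measurable
  also have "\<dots> = (\<integral>\<^sup>+b. \<integral>\<^sup>+h. \<integral>\<^sup>+c. F (pCons b (h + monom c m)) \<partial>lborel \<partial>polyL m \<partial>lborel)"
    by (intro nn_integral_cong Suc.IH) measurable
  also have "\<dots> = (\<integral>\<^sup>+b. \<integral>\<^sup>+h. \<integral>\<^sup>+c. F (pCons b h + monom c (Suc m)) \<partial>lborel \<partial>polyL m \<partial>lborel)"
    by (simp add: monom_Suc)
  also have "\<dots> = (\<integral>\<^sup>+h. \<integral>\<^sup>+c. F (h + monom c (Suc m)) \<partial>lborel \<partial>polyL (Suc m))"
    by (rule nn_integral_polyL_Suc[symmetric]) measurable
  finally show ?case .
qed

text \<open>Substituting the weighted coefficients moves the weights into the density, which becomes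
  a Gaussian in the coefficients of the polynomial.\<close>

lemma nn_integral_gaussian_polynomial:
  assumes w: "\<And>j. w j > 0" and "F \<in> borel_measurable pm"
  shows "(\<integral>\<^sup>+a. F (\<Sum>j<m. monom (a j * of_real (w j)) j) \<partial>PiM {..<m} (\<lambda>_. std_complex_gaussian)) =
    (\<Prod>j<m. ennreal (1 / (pi * (w j)\<^sup>2))) *
    (\<integral>\<^sup>+f. F f * ennreal (exp (- (\<Sum>j<m. (cmod (coeff f j))\<^sup>2 / (w j)\<^sup>2))) \<partial>polyL m)"
  using assms(2)
proof (induction m arbitrary: F)
  case 0
  then show ?case by (simp add: nn_integral_polyL_0 PiM_empty nn_integral_count_space_finite nn_integral_return)
next
  case (Suc m)
  note [measurable] = Suc.prems
  have mon [measurable (raw)]: "(\<lambda>x. monom (c x) j) \<in> measurable M pm" if [measurable]: "c \<in> borel_measurable M" for c j and M :: "'a measure"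
    by (rule measurable_pmI) (simp add: coeff_monom)
  have mon2 [measurable (raw)]: "(\<lambda>x. monom (c x) j) \<in> measurable M pm" if [measurable]: "c \<in> borel_measurable M" for c j and M :: "(complex poly \<times> complex) measure"
    by (rule measurable_pmI) (simp add: coeff_monom)
  have mon3 [measurable (raw)]: "(\<lambda>x. monom (c x) j) \<in> measurable M pm" if [measurable]: "c \<in> borel_measurable M" for c j and M :: "complex measure"
    by (rule measurable_pmI) (simp add: coeff_monom)
  have mon4 [measurable (raw)]: "(\<lambda>x. monom (c x) j) \<in> measurable M pm" if [measurable]: "c \<in> borel_measurable M" for c j and M :: "(nat \<Rightarrow> complex) measure"
    by (rule measurable_pmI) (simp add: coeff_monom)
  have [measurable_cong]: "sets (PiM {..<m} (\<lambda>_. std_complex_gaussian)) = sets (cL m)" for m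
    by (rule sets_PiM_cong) auto
  define E where "E m f = ennreal (exp (- (\<Sum>j<m. (cmod (coeff f j))\<^sup>2 / (w j)\<^sup>2)))" for m f
  have [measurable]: "E m \<in> borel_measurable pm" for m unfolding E_def by measurable
  have wn: "w m \<noteq> 0" using w[of m] by simp
  have "(\<integral>\<^sup>+a. F (\<Sum>j<Suc m. monom (a j * of_real (w j)) j) \<partial>PiM {..<Suc m} (\<lambda>_. std_complex_gaussian)) =
    (\<integral>\<^sup>+a. \<integral>\<^sup>+t. F (\<Sum>j<Suc m. monom ((a(m := t)) j * of_real (w j)) j) \<partial>std_complex_gaussian \<partial>PiM {..<m} (\<lambda>_. std_complex_gaussian))"
    unfolding lessThan_Suc[of m]
  proof (rule gaussP.product_nn_integral_insert)
    show "(\<lambda>a. F (\<Sum>j\<in>insert m {..<m}. monom (a j * of_real (w j)) j)) \<in> borel_measurable (PiM (insert m {..<m}) (\<lambda>_. std_complex_gaussian))"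
      unfolding lessThan_Suc[of m, symmetric] by measurable
  qed auto
  also have "\<dots> = (\<integral>\<^sup>+a. \<integral>\<^sup>+t. F ((\<Sum>j<m. monom (a j * of_real (w j)) j) + monom (t * of_real (w m)) m) \<partial>std_complex_gaussian \<partial>PiM {..<m} (\<lambda>_. std_complex_gaussian))"
  proof -
    have "(\<Sum>j<m. monom ((a(m := t)) j * of_real (w j)) j) = (\<Sum>j<m. monom (a j * of_real (w j)) j)" for a t
      by (intro sum.cong) auto
    then show ?thesis by simp
  qed
  also have "\<dots> = (\<Prod>j<m. ennreal (1 / (pi * (w j)\<^sup>2))) *
    (\<integral>\<^sup>+f. (\<integral>\<^sup>+t. F (f + monom (t * of_real (w m)) m) \<partial>std_complex_gaussian) * E m f \<partial>polyL m)"
    unfolding E_def by (rule Suc.IH) measurable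
  also have "(\<integral>\<^sup>+f. (\<integral>\<^sup>+t. F (f + monom (t * of_real (w m)) m) \<partial>std_complex_gaussian) * E m f \<partial>polyL m) =
    (\<integral>\<^sup>+f. ennreal (1 / (pi * (w m)\<^sup>2)) * (\<integral>\<^sup>+c. F (f + monom c m) * E (Suc m) (f + monom c m) \<partial>lborel) \<partial>polyL m)"
  proof (rule nn_integral_cong_AE, rule AE_mp[OF AE_polyL_degree[of m]], intro AE_I2 impI)
    fix f :: "complex poly" assume f: "f = 0 \<or> degree f < m"
    have cf: "coeff f m = 0" using f by (auto simp: coeff_eq_0)
    have E: "E (Suc m) (f + monom c m) = E m f * ennreal (exp (- ((cmod c)\<^sup>2 / (w m)\<^sup>2)))" for c
      by (simp add: E_def cf exp_add[symmetric] ennreal_mult[symmetric] exp_diff exp_minus field_simps)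
    have [measurable]: "(\<lambda>t. monom (of_real (w m) * t) m) \<in> measurable borel pm" "(\<lambda>t. monom t m) \<in> measurable borel pm"
      by (rule measurable_pmI, simp add: coeff_monom)+
    have Em: "(\<lambda>t. F (f + monom (of_real (w m) * t) m) * E (Suc m) (f + monom (of_real (w m) * t) m)) \<in> borel_measurable borel"
      "(\<lambda>t. F (f + monom t m) * E (Suc m) (f + monom t m)) \<in> borel_measurable borel"
      by measurable
    have "(\<lambda>t. monom (t * of_real (w m)) m) \<in> measurable borel pm"
      by (rule measurable_pmI) (simp add: coeff_monom)
    then have fm: "(\<lambda>t. F (f + monom (t * of_real (w m)) m)) \<in> borel_measurable borel" by measurable
    have "(\<integral>\<^sup>+t. F (f + monom (t * of_real (w m)) m) \<partial>std_complex_gaussian) =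
      (\<integral>\<^sup>+t. ennreal (exp (- (cmod t)\<^sup>2) / pi) * F (f + monom (t * of_real (w m)) m) \<partial>lborel)"
      unfolding std_complex_gaussian_def using fm by (intro nn_integral_density) auto
    then have "(\<integral>\<^sup>+t. F (f + monom (t * of_real (w m)) m) \<partial>std_complex_gaussian) * E m f =
      E m f * (\<integral>\<^sup>+t. ennreal (exp (- (cmod t)\<^sup>2) / pi) * F (f + monom (t * of_real (w m)) m) \<partial>lborel)"
      by (simp add: mult.commute)
    also have "\<dots> = (\<integral>\<^sup>+t. E m f * (ennreal (exp (- (cmod t)\<^sup>2) / pi) * F (f + monom (t * of_real (w m)) m)) \<partial>lborel)"
      using fm by (intro nn_integral_cmult[symmetric]) auto
    also have "\<dots> = (\<integral>\<^sup>+t. ennreal (1 / pi) * (F (f + monom (of_real (w m) * t) m) * E (Suc m) (f + monom (of_real (w m) * t) m)) \<partial>lborel)"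
    proof (rule nn_integral_cong)
      fix t
      have "(cmod (of_real (w m) * t))\<^sup>2 / (w m)\<^sup>2 = (cmod t)\<^sup>2"
        using wn by (simp add: norm_mult power_mult_distrib)
      then have "E (Suc m) (f + monom (of_real (w m) * t) m) = E m f * ennreal (exp (- (cmod t)\<^sup>2))"
        unfolding E by simp
      moreover have "ennreal (exp (- (cmod t)\<^sup>2) / pi) = ennreal (1 / pi) * ennreal (exp (- (cmod t)\<^sup>2))"
        by (simp add: ennreal_mult[symmetric])
      ultimately show "E m f * (ennreal (exp (- (cmod t)\<^sup>2) / pi) * F (f + monom (t * of_real (w m)) m)) =
        ennreal (1 / pi) * (F (f + monom (of_real (w m) * t) m) * E (Suc m) (f + monom (of_real (w m) * t) m))"
        by (simp add: mult_ac)
    qed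
    also have "\<dots> = ennreal (1 / pi) * (\<integral>\<^sup>+t. F (f + monom (of_real (w m) * t) m) * E (Suc m) (f + monom (of_real (w m) * t) m) \<partial>lborel)"
      using Em by (intro nn_integral_cmult) auto
    also have "\<dots> = ennreal (1 / (pi * (w m)\<^sup>2)) * (\<integral>\<^sup>+c. F (f + monom c m) * E (Suc m) (f + monom c m) \<partial>lborel)"
    proof -
      have "(\<integral>\<^sup>+c. F (f + monom c m) * E (Suc m) (f + monom c m) \<partial>lborel) = ennreal ((cmod (of_real (w m)))\<^sup>2) *
        (\<integral>\<^sup>+t. F (f + monom (of_real (w m) * t) m) * E (Suc m) (f + monom (of_real (w m) * t) m) \<partial>lborel)"
        using Em wn by (intro nn_integral_complex_mult) auto
      moreover have "ennreal (1 / (pi * (w m)\<^sup>2)) * ennreal ((cmod (of_real (w m)))\<^sup>2) = ennreal (1 / pi)"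
        using wn by (simp add: ennreal_mult[symmetric])
      ultimately show ?thesis by (simp only: mult.assoc[symmetric])
    qed
    finally show "(\<integral>\<^sup>+t. F (f + monom (t * of_real (w m)) m) \<partial>std_complex_gaussian) * E m f =
      ennreal (1 / (pi * (w m)\<^sup>2)) * (\<integral>\<^sup>+c. F (f + monom c m) * E (Suc m) (f + monom c m) \<partial>lborel)" .
  qed
  also have "\<dots> = ennreal (1 / (pi * (w m)\<^sup>2)) * (\<integral>\<^sup>+f. \<integral>\<^sup>+c. F (f + monom c m) * E (Suc m) (f + monom c m) \<partial>lborel \<partial>polyL m)"
    by (rule nn_integral_cmult) measurable
  also have "(\<integral>\<^sup>+f. \<integral>\<^sup>+c. F (f + monom c m) * E (Suc m) (f + monom c m) \<partial>lborel \<partial>polyL m) =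
    (\<integral>\<^sup>+f. F f * E (Suc m) f \<partial>polyL (Suc m))"
    by (rule nn_integral_polyL_top[symmetric]) measurable
  finally show ?case by (simp add: E_def mult_ac del: polyL.simps)
qed

text \<open>The squared norm that makes the coefficients of \<open>gauss_poly\<close> orthonormal coordinates.\<close>

definition nrm2 :: "nat \<Rightarrow> complex poly \<Rightarrow> real" where
  "nrm2 n f = (\<Sum>j\<le>n. (cmod (coeff f j))\<^sup>2 / real (n choose j))"

lemma measurable_nrm2 [measurable (raw)]:
  assumes [measurable]: "f \<in> measurable M pm"
  shows "(\<lambda>x. nrm2 n (f x)) \<in> borel_measurable M"
  unfolding nrm2_def by measurable

definition gauss_const :: "nat \<Rightarrow> ennreal" where
  "gauss_const n = (\<Prod>j\<le>n. ennreal (1 / (pi * real (n choose j))))"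

lemma nn_integral_coeff_law:
  assumes [measurable]: "F \<in> borel_measurable pm"
  shows "(\<integral>\<^sup>+a. F (\<Sum>j\<le>n. monom (a j * of_real (sqrt (real (n choose j)))) j) \<partial>coeff_law n) =
    gauss_const n * (\<integral>\<^sup>+f. F f * ennreal (exp (- nrm2 n f)) \<partial>polyL (Suc n))"
proof -
  define w where "w j = (if j \<le> n then sqrt (real (n choose j)) else 1)" for j
  have w: "w j > 0" for j by (simp add: w_def)
  have wsq: "(w j)\<^sup>2 = real (n choose j)" if "j \<le> n" for j using that by (simp add: w_def)
  have S: "(\<Sum>j<Suc n. (cmod (coeff f j))\<^sup>2 / (w j)\<^sup>2) = nrm2 n f" for f
    unfolding nrm2_def lessThan_Suc_atMost by (intro sum.cong) (auto simp: wsq)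
  have C: "(\<Prod>j<Suc n. ennreal (1 / (pi * (w j)\<^sup>2))) = gauss_const n"
    unfolding gauss_const_def lessThan_Suc_atMost by (intro prod.cong) (auto simp: wsq)
  have P: "(\<Sum>j<Suc n. monom (a j * of_real (w j)) j) = (\<Sum>j\<le>n. monom (a j * of_real (sqrt (real (n choose j)))) j)" for a
    unfolding lessThan_Suc_atMost by (intro sum.cong) (auto simp: w_def)
  show ?thesis
    using nn_integral_gaussian_polynomial[of w F "Suc n", OF w assms]
    unfolding S C P by (simp add: coeff_law_def lessThan_Suc_atMost del: polyL.simps)
qed

lemma poly_gauss_poly: "poly (\<Sum>j\<le>n. monom (a j * of_real (sqrt (real (n choose j)))) j) z = gauss_poly n a z"
  by (simp add: poly_sum poly_monom gauss_poly_def)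

text \<open>The law of the coefficients has total mass one. This identity replaces an explicit
  evaluation of the normalising constant later on.\<close>

lemma gauss_const_total: "gauss_const n * (\<integral>\<^sup>+f. ennreal (exp (- nrm2 n f)) \<partial>polyL (Suc n)) = 1"
proof -
  have "prob_space (coeff_law n)" unfolding coeff_law_def by (rule prob_space_PiM) unfold_locales
  then show ?thesis
    using nn_integral_coeff_law[of "\<lambda>_. 1" n] by (simp add: prob_space.emeasure_space_1)
qed

text \<open>Here \<open>g\<close> is the quotient of the random polynomial by the one with roots \<open>z j\<close>.\<close>

definition zero_density :: "nat \<Rightarrow> nat \<Rightarrow> (nat \<Rightarrow> complex) \<Rightarrow> ennreal" where
  "zero_density n k z = gauss_const n * (ennreal ((vdm k z)\<^sup>2) *
    (\<integral>\<^sup>+g. (\<Prod>j<k. ennreal ((cmod (poly g (z j)))\<^sup>2)) * ennreal (exp (- nrm2 n (rootp k z * g))) \<partial>polyL (Suc n - k)))"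

lemma measurable_zero_density [measurable]: "zero_density n k \<in> borel_measurable (cL k)"
  unfolding zero_density_def[abs_def] by measurable

lemma nn_integral_zero_density:
  assumes k: "k \<le> n" and B: "\<And>j. j < k \<Longrightarrow> open (B j)" and dj: "disjoint_family_on B {..<k}"
  shows "(\<integral>\<^sup>+ a. (\<Prod>j<k. of_nat (card (zero_set n a \<inter> B j))) \<partial>coeff_law n) =
    (\<integral>\<^sup>+z. (\<Prod>j<k. indicator (B j) (z j)) * zero_density n k z \<partial>cL k)"
proof -
  have [measurable]: "(\<lambda>f. of_nat (card ({z. poly f z = 0} \<inter> B j)) :: ennreal) \<in> borel_measurable pm" if "j < k" for j
    by (rule measurable_compose[OF measurable_card_zeros[OF _ B[OF that]]]) auto
  have [measurable]: "\<And>j. j < k \<Longrightarrow> B j \<in> sets borel" using B by auto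
  have [measurable]: "(\<lambda>z::nat \<Rightarrow> complex. indicator (B j) (z j) :: ennreal) \<in> borel_measurable (cL k)" if "j < k" for j
    using that by measurable
  have "(\<integral>\<^sup>+ a. (\<Prod>j<k. of_nat (card (zero_set n a \<inter> B j))) \<partial>coeff_law n) =
    gauss_const n * (\<integral>\<^sup>+f. (\<Prod>j<k. of_nat (card ({z. poly f z = 0} \<inter> B j))) * ennreal (exp (- nrm2 n f)) \<partial>polyL (Suc n))"
    unfolding zero_set_def poly_gauss_poly[symmetric]
    by (rule nn_integral_coeff_law) measurable
  also have "Suc n = (Suc n - k) + k" using k by simp
  also have "(\<integral>\<^sup>+f. (\<Prod>j<k. of_nat (card ({z. poly f z = 0} \<inter> B j))) * ennreal (exp (- nrm2 n f)) \<partial>polyL (Suc n - k + k)) =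
    (\<integral>\<^sup>+z. (\<Prod>j<k. indicator (B j) (z j)) * (ennreal ((vdm k z)\<^sup>2) *
      (\<integral>\<^sup>+g. (\<Prod>j<k. ennreal ((cmod (poly g (z j)))\<^sup>2)) * ennreal (exp (- nrm2 n (rootp k z * g))) \<partial>polyL (Suc n - k))) \<partial>cL k)"
    by (rule nn_integral_zero_counts[OF B dj]) measurable
  also have "gauss_const n * \<dots> = (\<integral>\<^sup>+z. gauss_const n * ((\<Prod>j<k. indicator (B j) (z j)) * (ennreal ((vdm k z)\<^sup>2) *
      (\<integral>\<^sup>+g. (\<Prod>j<k. ennreal ((cmod (poly g (z j)))\<^sup>2)) * ennreal (exp (- nrm2 n (rootp k z * g))) \<partial>polyL (Suc n - k)))) \<partial>cL k)"
    by (rule nn_integral_cmult[symmetric]) measurable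
  also have "\<dots> = (\<integral>\<^sup>+z. (\<Prod>j<k. indicator (B j) (z j)) * zero_density n k z \<partial>cL k)"
    by (simp add: zero_density_def mult_ac)
  finally show ?thesis .
qed

subsection \<open>The reproducing kernel space of polynomials\<close>

text \<open>The Bombieri-Weyl inner product. It is invariant under rotations of the sphere, and its
  reproducing kernel \<open>(1 + X cnj a) ^ n\<close> is the covariance kernel of the random
  polynomial.\<close>

definition ip :: "nat \<Rightarrow> complex poly \<Rightarrow> complex poly \<Rightarrow> complex" where
  "ip n F G = (\<Sum>j\<le>n. coeff F j * cnj (coeff G j) / of_nat (n choose j))"

lemma ip_add_left: "ip n (F + G) H = ip n F H + ip n G H"
  by (simp add: ip_def distrib_right add_divide_distrib sum.distrib)

lemma ip_diff_left: "ip n (F - G) H = ip n F H - ip n G H"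
  by (simp add: ip_def left_diff_distrib diff_divide_distrib sum_subtractf)

lemma ip_smult_left: "ip n (smult c F) H = c * ip n F H"
  by (simp add: ip_def sum_distrib_left mult.assoc)

lemma ip_cnj: "cnj (ip n F G) = ip n G F"
  by (simp add: ip_def mult.commute)

lemma ip_add_right: "ip n H (F + G) = ip n H F + ip n H G"
  by (simp add: ip_def distrib_left add_divide_distrib sum.distrib)

lemma ip_smult_right: "ip n H (smult c F) = cnj c * ip n H F"
  by (simp add: ip_def sum_distrib_left mult_ac)

lemma ip_zero_left [simp]: "ip n 0 F = 0" and ip_zero_right [simp]: "ip n F 0 = 0"
  by (simp_all add: ip_def)

lemma mult_cnj_cmod: "z * cnj z = complex_of_real ((cmod z)\<^sup>2)"
  by (rule complex_norm_square[symmetric])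

lemma ip_self: "ip n F F = of_real (nrm2 n F)"
  by (simp add: ip_def nrm2_def mult_cnj_cmod)

lemma nrm2_nonneg [simp]: "nrm2 n F \<ge> 0"
  by (simp add: nrm2_def sum_nonneg)

lemma nrm2_zero [simp]: "nrm2 n 0 = 0"
  by (simp add: nrm2_def)

lemma nrm2_eq_0: "nrm2 n F = 0 \<Longrightarrow> degree F \<le> n \<Longrightarrow> F = 0"
proof (rule poly_eqI)
  fix j assume *: "nrm2 n F = 0" "degree F \<le> n"
  show "coeff F j = coeff 0 j"
  proof (cases "j \<le> n")
    case True
    have "\<forall>j\<in>{..n}. (cmod (coeff F j))\<^sup>2 / real (n choose j) = 0"
      using *(1) unfolding nrm2_def by (subst (asm) sum_nonneg_eq_0_iff) auto
    then show ?thesis using True by auto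
  qed (use * in \<open>simp add: coeff_eq_0\<close>)
qed

lemma nrm2_add: "nrm2 n (F + G) = nrm2 n F + nrm2 n G + 2 * Re (ip n F G)"
proof -
  have "of_real (nrm2 n (F + G)) = of_real (nrm2 n F) + of_real (nrm2 n G) + (ip n F G + cnj (ip n F G))"
    unfolding ip_self[symmetric] ip_cnj by (simp add: ip_add_left ip_add_right)
  from arg_cong[OF this, of Re] show ?thesis by simp
qed

lemma nrm2_smult: "nrm2 n (smult c F) = (cmod c)\<^sup>2 * nrm2 n F"
  by (simp add: nrm2_def norm_mult power_mult_distrib sum_distrib_left)

lemma nrm2_add_le: "nrm2 n (F + G) \<le> 2 * nrm2 n F + 2 * nrm2 n G"
proof -
  have "nrm2 n (F - G) = nrm2 n F + nrm2 n G - 2 * Re (ip n F G)"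
    using nrm2_add[of n F "smult (-1) G"] nrm2_smult[of n "-1" G] ip_smult_right[of n F "-1" G] by simp
  then show ?thesis using nrm2_add[of n F G] nrm2_nonneg[of n "F - G"] by linarith
qed

lemma ip_cauchy_schwarz: "(cmod (ip n F G))\<^sup>2 \<le> nrm2 n F * nrm2 n G"
proof (cases "nrm2 n G = 0")
  case True
  have "coeff G j = 0" if "j \<le> n" for j
  proof -
    have "\<forall>j\<in>{..n}. (cmod (coeff G j))\<^sup>2 / real (n choose j) = 0"
      using True unfolding nrm2_def by (subst (asm) sum_nonneg_eq_0_iff) auto
    then show ?thesis using that by auto
  qed
  then have "ip n F G = 0" by (simp add: ip_def)
  then show ?thesis by simp
next
  case False
  then have pos: "nrm2 n G > 0" using nrm2_nonneg[of n G] by linarith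
  define c where "c = - ip n F G / of_real (nrm2 n G)"
  have "0 \<le> nrm2 n (F + smult c G)" by simp
  also have "\<dots> = nrm2 n F + (cmod c)\<^sup>2 * nrm2 n G + 2 * Re (cnj c * ip n F G)"
    by (simp add: nrm2_add nrm2_smult ip_smult_right)
  also have "cnj c * ip n F G = of_real (- (cmod (ip n F G))\<^sup>2 / nrm2 n G)"
  proof -
    have "cnj c * ip n F G = - (ip n F G * cnj (ip n F G)) / of_real (nrm2 n G)" by (simp add: c_def)
    then show ?thesis by (simp only: mult_cnj_cmod of_real_minus of_real_divide)
  qed
  also have "(cmod c)\<^sup>2 * nrm2 n G = (cmod (ip n F G))\<^sup>2 / nrm2 n G"
    using pos by (simp add: c_def norm_divide power_divide power2_eq_square)
  finally have "(cmod (ip n F G))\<^sup>2 / nrm2 n G \<le> nrm2 n F" by simp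
  then show ?thesis using pos by (simp add: field_simps)
qed

text \<open>This is \<open>(1 + X cnj a) ^ n\<close> written out, and \<open>dker\<close> is its
  derivative in \<open>cnj a\<close>: the representers of the value and of the derivative at
  \<open>a\<close>. In the term \<open>j = 0\<close> of \<open>dker\<close> the truncated exponent
  \<open>j - 1\<close> is multiplied by 0.\<close>

definition ker :: "nat \<Rightarrow> complex \<Rightarrow> complex poly" where
  "ker n a = (\<Sum>j\<le>n. monom (of_nat (n choose j) * cnj a ^ j) j)"

definition dker :: "nat \<Rightarrow> complex \<Rightarrow> complex poly" where
  "dker n a = (\<Sum>j\<le>n. monom (of_nat (n choose j) * (of_nat j * cnj a ^ (j - 1))) j)"

lemma coeff_sum_monom: "coeff (\<Sum>j\<le>n. monom (c j) j) i = (if i \<le> n then c i else 0)"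
  by (simp add: coeff_sum coeff_monom)

lemma degree_sum_monom: "degree (\<Sum>j\<le>n. monom (c j) j) \<le> n"
  by (rule degree_le) (simp add: coeff_sum_monom)

lemma degree_ker: "degree (ker n a) \<le> n" and degree_dker: "degree (dker n a) \<le> n"
  by (simp_all add: ker_def dker_def degree_sum_monom)

lemma poly_eq_sum_le: "degree F \<le> n \<Longrightarrow> poly (F :: complex poly) a = (\<Sum>j\<le>n. coeff F j * a ^ j)"
  unfolding poly_altdef by (intro sum.mono_neutral_left) (auto simp: coeff_eq_0)

lemma ip_ker: "degree F \<le> n \<Longrightarrow> ip n F (ker n a) = poly F a"
  by (simp add: ip_def ker_def coeff_sum_monom poly_eq_sum_le)

lemma ip_dker:
  assumes "degree F \<le> n"
  shows "ip n F (dker n a) = poly (pderiv F) a"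
proof -
  have "degree (pderiv F) \<le> n" using assms by (simp add: degree_pderiv)
  then have "poly (pderiv F) a = (\<Sum>j\<le>n. of_nat (Suc j) * coeff F (Suc j) * a ^ j)"
    by (subst poly_eq_sum_le) (auto simp: coeff_pderiv)
  also have "\<dots> = (\<Sum>j<n. of_nat (Suc j) * coeff F (Suc j) * a ^ j)"
    using assms by (simp add: lessThan_Suc_atMost[symmetric] coeff_eq_0)
  also have "\<dots> = (\<Sum>j\<le>n. of_nat j * coeff F j * a ^ (j - 1))"
    by (simp add: lessThan_Suc_atMost[symmetric] sum.lessThan_Suc_shift del: sum.lessThan_Suc)
  also have "\<dots> = ip n F (dker n a)"
    unfolding ip_def dker_def coeff_sum_monom by (intro sum.cong) auto
  finally show ?thesis by simp
qed

section \<open>Spans of jet representers and orthogonal projection\<close>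

definition lspan1 :: "complex poly set \<Rightarrow> complex poly \<Rightarrow> complex poly set" where
  "lspan1 S w = {F + smult c w | F c. F \<in> S}"

text \<open>The span of the representers of value and derivative at the first \<open>k\<close>
  points. One vector is adjoined at a time, so that orthogonal projections exist by induction even
  when the vectors are dependent.\<close>

fun kers :: "nat \<Rightarrow> nat \<Rightarrow> (nat \<Rightarrow> complex) \<Rightarrow> complex poly set" where
  "kers n 0 z = {0}"
| "kers n (Suc k) z = lspan1 (lspan1 (kers n k z) (ker n (z k))) (dker n (z k))"

definition proj_subspace :: "nat \<Rightarrow> complex poly set \<Rightarrow> bool" where
  "proj_subspace n S \<longleftrightarrow> 0 \<in> S \<and> (\<forall>F\<in>S. \<forall>G\<in>S. F + G \<in> S) \<and> (\<forall>c. \<forall>F\<in>S. smult c F \<in> S) \<and>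
     (\<forall>F\<in>S. degree F \<le> n) \<and> (\<forall>F. degree F \<le> n \<longrightarrow> (\<exists>G\<in>S. \<forall>H\<in>S. ip n (F - G) H = 0))"

text \<open>A Gram-Schmidt step: \<open>w'\<close> is the component of \<open>w\<close> orthogonal
  to \<open>S\<close>. If it vanishes, the span does not grow; otherwise the component along
  \<open>w'\<close> is added to the projection onto \<open>S\<close>.\<close>

lemma proj_subspace_lspan1:
  assumes S: "proj_subspace n S" and w: "degree w \<le> n"
  shows "proj_subspace n (lspan1 S w)"
  unfolding proj_subspace_def
proof (intro conjI ballI allI impI)
  note S' = S[unfolded proj_subspace_def]
  have S0: "0 \<in> S" and Sadd: "\<And>F G. F \<in> S \<Longrightarrow> G \<in> S \<Longrightarrow> F + G \<in> S" and Ssm: "\<And>c F. F \<in> S \<Longrightarrow> smult c F \<in> S"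
    and Sdeg: "\<And>F. F \<in> S \<Longrightarrow> degree F \<le> n" and Spr: "\<And>F. degree F \<le> n \<Longrightarrow> \<exists>G\<in>S. \<forall>H\<in>S. ip n (F - G) H = 0"
    using S' by blast+
  show "0 \<in> lspan1 S w" unfolding lspan1_def using S0 by (intro CollectI exI[of _ 0]) simp
  show "F + G \<in> lspan1 S w" if FG: "F \<in> lspan1 S w" "G \<in> lspan1 S w" for F G
  proof -
    obtain F' c G' d where *: "F = F' + smult c w" "G = G' + smult d w" "F' \<in> S" "G' \<in> S"
      using FG by (auto simp: lspan1_def)
    then have "F + G = (F' + G') + smult (c + d) w" by (simp add: smult_add_left)
    then show ?thesis unfolding lspan1_def using Sadd * by blast
  qed
  show "smult d F \<in> lspan1 S w" if FS: "F \<in> lspan1 S w" for d F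
  proof -
    obtain F' c where *: "F = F' + smult c w" "F' \<in> S" using FS by (auto simp: lspan1_def)
    then have "smult d F = smult d F' + smult (d * c) w" by (simp add: smult_add_right)
    then show ?thesis unfolding lspan1_def using Ssm * by blast
  qed
  show "degree F \<le> n" if "F \<in> lspan1 S w" for F
    using that w Sdeg by (auto simp: lspan1_def intro!: degree_add_le order_trans[OF degree_smult_le])
  fix F :: "complex poly" assume F: "degree F \<le> n"
  obtain p where p: "p \<in> S" "\<And>H. H \<in> S \<Longrightarrow> ip n (w - p) H = 0" using Spr[OF w] by blast
  obtain G where G: "G \<in> S" "\<And>H. H \<in> S \<Longrightarrow> ip n (F - G) H = 0" using Spr[OF F] by blast
  define w' where "w' = w - p"
  have dw: "degree w' \<le> n" unfolding w'_def using w Sdeg[OF p(1)] by (rule degree_diff_le)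
  have mem: "G + smult c w' \<in> lspan1 S w" for c
  proof -
    have "G + smult c w' = (G + smult (- c) p) + smult c w" by (simp add: w'_def smult_diff_right)
    moreover have "G + smult (- c) p \<in> S" using G(1) p(1) Sadd Ssm by blast
    ultimately show ?thesis unfolding lspan1_def by blast
  qed
  show "\<exists>G\<in>lspan1 S w. \<forall>H\<in>lspan1 S w. ip n (F - G) H = 0"
  proof (cases "nrm2 n w' = 0")
    case True
    then have "w' = 0" using nrm2_eq_0 dw by blast
    then have "w \<in> S" using p(1) by (simp add: w'_def)
    have "lspan1 S w = S"
    proof (intro equalityI subsetI)
      show "x \<in> S" if "x \<in> lspan1 S w" for x using that \<open>w \<in> S\<close> Sadd Ssm by (auto simp: lspan1_def)
      show "x \<in> lspan1 S w" if "x \<in> S" for x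
        unfolding lspan1_def using that by (intro CollectI exI[of _ x] exI[of _ 0]) simp
    qed
    then show ?thesis using G by auto
  next
    case False
    define c where "c = ip n F w' / of_real (nrm2 n w')"
    have o: "ip n w' H = 0" if "H \<in> S" for H using p(2)[OF that] by (simp add: w'_def)
    have oS: "ip n (F - (G + smult c w')) H = 0" if "H \<in> S" for H
      using G(2)[OF that] o[OF that] by (simp add: ip_diff_left ip_add_left ip_smult_left)
    have "ip n G w' = 0" using o[OF G(1)] ip_cnj[of n w' G] by simp
    then have ow: "ip n (F - (G + smult c w')) w' = 0"
      using False by (simp add: ip_diff_left ip_add_left ip_smult_left ip_self c_def)
    have "ip n (F - (G + smult c w')) H = 0" if HS: "H \<in> lspan1 S w" for H
    proof -
      obtain H' d where H: "H = H' + smult d w" "H' \<in> S" using HS by (auto simp: lspan1_def)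
      have "H = H' + smult d p + smult d w'" unfolding H(1) w'_def by (simp add: smult_diff_right)
      moreover have "H' + smult d p \<in> S" using H(2) p(1) Sadd Ssm by blast
      ultimately obtain K where "H = K + smult d w'" "K \<in> S" by blast
      then show ?thesis using oS ow by (simp add: ip_add_right ip_smult_right)
    qed
    then show ?thesis using mem by blast
  qed
qed

lemma proj_subspace_kers: "proj_subspace n (kers n k z)"
proof (induction k)
  case 0
  show ?case by (auto simp: proj_subspace_def)
next
  case (Suc k)
  then show ?case by (simp add: proj_subspace_lspan1 degree_ker degree_dker)
qed

lemma kers_add: "F \<in> kers n k z \<Longrightarrow> G \<in> kers n k z \<Longrightarrow> F + G \<in> kers n k z"
  and kers_smult: "F \<in> kers n k z \<Longrightarrow> smult c F \<in> kers n k z"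
  and kers_degree: "F \<in> kers n k z \<Longrightarrow> degree F \<le> n"
  and kers_zero: "0 \<in> kers n k z"
  and kers_proj: "degree F \<le> n \<Longrightarrow> \<exists>G\<in>kers n k z. \<forall>H\<in>kers n k z. ip n (F - G) H = 0"
  using proj_subspace_kers[of n k z] unfolding proj_subspace_def by blast+

lemma kers_diff: "F \<in> kers n k z \<Longrightarrow> G \<in> kers n k z \<Longrightarrow> F - G \<in> kers n k z"
  using kers_add[of F n k z "smult (-1) G"] kers_smult[of G n k z "-1"] by simp

lemma kers_sum: "(\<And>i. i \<in> A \<Longrightarrow> f i \<in> kers n k z) \<Longrightarrow> sum f A \<in> kers n k z"
  by (induction A rule: infinite_finite_induct) (auto intro: kers_zero kers_add)

lemma kers_orth:
  assumes "F \<in> kers n k z" "degree G \<le> n"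
    "\<And>j. j < k \<Longrightarrow> poly G (z j) = 0" "\<And>j. j < k \<Longrightarrow> poly (pderiv G) (z j) = 0"
  shows "ip n G F = 0"
  using assms
proof (induction k arbitrary: F)
  case (Suc k)
  then show ?case
    by (auto simp: lspan1_def ip_add_right ip_smult_right ip_ker ip_dker)
qed simp

lemma lspan1_mono: "0 \<in> S \<Longrightarrow> w \<in> lspan1 S w" "S \<subseteq> lspan1 S w"
  unfolding lspan1_def by (force intro: exI[of _ 0] exI[of _ 1])+

lemma ker_in_kers: "j < k \<Longrightarrow> ker n (z j) \<in> kers n k z \<and> dker n (z j) \<in> kers n k z"
proof (induction k)
  case (Suc k)
  show ?case
  proof (cases "j = k")
    case True
    have "0 \<in> lspan1 (kers n k z) (ker n (z k))" using lspan1_mono(2) kers_zero by blast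
    then show ?thesis using lspan1_mono kers_zero True by (metis kers.simps(2) subsetD)
  next
    case False
    then show ?thesis using Suc lspan1_mono(2) by (metis kers.simps(2) less_SucE subsetD)
  qed
qed simp

lemma orth_kers_imp_jet_zero:
  assumes "degree G \<le> n" "\<And>F. F \<in> kers n k z \<Longrightarrow> ip n G F = 0" "j < k"
  shows "poly G (z j) = 0 \<and> poly (pderiv G) (z j) = 0"
  using assms(2)[of "ker n (z j)"] assms(2)[of "dker n (z j)"] ker_in_kers[OF assms(3), of n z]
    ip_ker[OF assms(1), of "z j"] ip_dker[OF assms(1), of "z j"] by simp

section \<open>Root polynomials and double roots\<close>

lemma degree_rootp: "degree (rootp k z) = k" and rootp_nz: "rootp k z \<noteq> 0"
proof (induction k)
  case (Suc k)
  { case 1 then show ?case using Suc by (simp add: rootp_Suc degree_mult_eq del: mult_pCons_left) }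
  { case 2 then show ?case using Suc by (simp add: rootp_Suc del: mult_pCons_left) }
qed (simp_all add: rootp_def)

text \<open>A point with vanishing value and derivative is a double root. After division by
  \<open>(X - z k)^2\<close> the jets at the other points still vanish, as these differ from
  \<open>z k\<close>.\<close>

lemma rootp_square_dvd:
  assumes "inj_on z {..<k}" "\<And>j. j < k \<Longrightarrow> poly G (z j) = 0" "\<And>j. j < k \<Longrightarrow> poly (pderiv G) (z j) = 0"
  shows "rootp k z * rootp k z dvd G"
  using assms
proof (induction k arbitrary: G)
  case 0
  then show ?case by (simp add: rootp_def)
next
  case (Suc k)
  obtain G1 where G1: "G = [:- z k, 1:] * G1"
    using Suc.prems(2)[of k] by (auto simp: poly_eq_0_iff_dvd elim: dvdE)
  have "poly (pderiv G) (z k) = poly G1 (z k)"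
    unfolding G1 pderiv_mult by (simp add: pderiv_pCons)
  then have "poly G1 (z k) = 0" using Suc.prems(3)[of k] by simp
  then obtain G2 where G2: "G1 = [:- z k, 1:] * G2" by (auto simp: poly_eq_0_iff_dvd elim: dvdE)
  have jet: "poly G2 (z j) = 0 \<and> poly (pderiv G2) (z j) = 0" if "j < k" for j
  proof -
    have ne: "z j \<noteq> z k" using Suc.prems(1) that by (auto simp: inj_on_def)
    have "poly G (z j) = (z j - z k) * ((z j - z k) * poly G2 (z j))" unfolding G1 G2 by (simp add: algebra_simps)
    then have 1: "poly G2 (z j) = 0" using Suc.prems(2)[of j] that ne by simp
    have "poly (pderiv G) (z j) = (z j - z k) * ((z j - z k) * poly (pderiv G2) (z j)) + 2 * (z j - z k) * poly G2 (z j)"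
      unfolding G1 G2 pderiv_mult by (simp add: pderiv_pCons algebra_simps)
    then have "poly (pderiv G2) (z j) = 0" using Suc.prems(3)[of j] that ne 1 by simp
    with 1 show ?thesis by simp
  qed
  have "rootp k z * rootp k z dvd G2"
    by (rule Suc.IH) (use Suc.prems(1) jet in \<open>auto intro: inj_on_subset\<close>)
  then have "[:- z k, 1:] * [:- z k, 1:] * (rootp k z * rootp k z) dvd [:- z k, 1:] * [:- z k, 1:] * G2"
    by (rule mult_dvd_mono[OF dvd_refl])
  then show ?case unfolding G1 G2 rootp_Suc by (simp only: mult_ac)
qed

lemma poly_rootp_at: "j < k \<Longrightarrow> poly (rootp k z) (z j) = 0"
  by (auto simp: poly_rootp)

lemma pderiv_rootp_nz:
  assumes "inj_on z {..<k}" "j < k"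
  shows "poly (pderiv (rootp k z)) (z j) \<noteq> 0"
proof
  assume 0: "poly (pderiv (rootp k z)) (z j) = 0"
  have "[:- z j, 1:] * [:- z j, 1:] dvd rootp k z"
    using rootp_square_dvd[of "\<lambda>_. z j" 1 "rootp k z"] 0 poly_rootp_at[OF assms(2)]
    by (simp add: rootp_def inj_on_def del: mult_pCons_left)
  moreover have "rootp k z = [:- z j, 1:] * (\<Prod>i\<in>{..<k}-{j}. [:- z i, 1:])"
    unfolding rootp_def using assms(2) by (subst prod.remove[of _ j]) auto
  ultimately have "[:- z j, 1:] dvd (\<Prod>i\<in>{..<k}-{j}. [:- z i, 1:])"
    by (simp only: dvd_mult_cancel_left) auto
  then have "(\<Prod>i\<in>{..<k}-{j}. z j - z i) = 0"
    by (simp add: poly_eq_0_iff_dvd[symmetric] poly_prod)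
  then show False using assms by (auto simp: inj_on_def)
qed

text \<open>The discriminant: each pair of points contributes its distance twice, once in the
  derivative at either point.\<close>

lemma prod_pderiv_rootp: "(\<Prod>j<k. cmod (poly (pderiv (rootp k z)) (z j))) = (vdm k z)\<^sup>2"
proof (induction k)
  case 0
  then show ?case by (simp add: vdm_def)
next
  case (Suc k)
  have d: "pderiv (rootp (Suc k) z) = [:- z k, 1:] * pderiv (rootp k z) + rootp k z"
    unfolding rootp_Suc pderiv_mult by (simp add: pderiv_pCons del: mult_pCons_left mult_pCons_right)
  have 1: "cmod (poly (pderiv (rootp (Suc k) z)) (z j)) = cmod (z k - z j) * cmod (poly (pderiv (rootp k z)) (z j))" if "j < k" for j
    unfolding d using poly_rootp_at[OF that] by (simp add: norm_mult[symmetric] norm_minus_commute algebra_simps)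
  have 2: "cmod (poly (pderiv (rootp (Suc k) z)) (z k)) = (\<Prod>i<k. cmod (z k - z i))"
    unfolding d by (simp add: poly_rootp prod_norm)
  have "(\<Prod>j<Suc k. cmod (poly (pderiv (rootp (Suc k) z)) (z j))) =
    (\<Prod>j<k. cmod (z k - z j) * cmod (poly (pderiv (rootp k z)) (z j))) * (\<Prod>i<k. cmod (z k - z i))"
    by (simp only: prod.lessThan_Suc 2) (simp add: 1)
  also have "\<dots> = (vdm (Suc k) z)\<^sup>2"
    by (simp only: prod.distrib Suc.IH vdm_Suc) (simp add: power2_eq_square mult_ac)
  finally show ?case .
qed

subsection \<open>Polynomials of minimal norm with prescribed jets\<close>

definition has_jet :: "nat \<Rightarrow> (nat \<Rightarrow> complex) \<Rightarrow> (nat \<Rightarrow> complex) \<Rightarrow> (nat \<Rightarrow> complex) \<Rightarrow> complex poly \<Rightarrow> bool" where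
  "has_jet k z v u F \<longleftrightarrow> (\<forall>j<k. poly F (z j) = v j \<and> poly (pderiv F) (z j) = u j)"

text \<open>A polynomial in the span of the kernels is orthogonal to all polynomials with vanishing jets,
  so among those with its jets it has minimal norm. It exists and is unique only if the points are
  distinct and \<open>2 * k \<le> n + 1\<close>; otherwise \<open>minpoly\<close> is meaningless.\<close>

definition minpoly :: "nat \<Rightarrow> nat \<Rightarrow> (nat \<Rightarrow> complex) \<Rightarrow> (nat \<Rightarrow> complex) \<Rightarrow> (nat \<Rightarrow> complex) \<Rightarrow> complex poly" where
  "minpoly n k z v u = (SOME F. F \<in> kers n k z \<and> has_jet k z v u F)"

text \<open>For distinct points and \<open>2 * k \<le> n + 1\<close> this is the inverse covariance
  form of the random jets, whose density is proportional to \<open>exp (- qform)\<close>.\<close>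

definition qform :: "nat \<Rightarrow> nat \<Rightarrow> (nat \<Rightarrow> complex) \<Rightarrow> (nat \<Rightarrow> complex) \<Rightarrow> (nat \<Rightarrow> complex) \<Rightarrow> real" where
  "qform n k z v u = nrm2 n (minpoly n k z v u)"

text \<open>Hermite interpolation in two layers: the first summand has the values \<open>v\<close>,
  the second vanishes at the points and adjusts only the derivatives there.\<close>

definition lift_jet :: "nat \<Rightarrow> (nat \<Rightarrow> complex) \<Rightarrow> (nat \<Rightarrow> complex) \<Rightarrow> (nat \<Rightarrow> complex) \<Rightarrow> complex poly" where
  "lift_jet k z v x = interp k z v + rootp k z * interp k z x"

lemma degree_lift_jet:
  assumes "2 * k \<le> Suc n" shows "degree (lift_jet k z v x) \<le> n"
proof (cases k)
  case (Suc k')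
  have d: "degree (interp k z x) \<le> k'" for x using degree_interp[of k z x] Suc by auto
  have "degree (rootp k z * interp k z x) \<le> k + k'"
    using degree_mult_le[of "rootp k z" "interp k z x"] d[of x] by (simp add: degree_rootp)
  moreover have "k + k' \<le> n" "k' \<le> n" using assms Suc by auto
  ultimately show ?thesis unfolding lift_jet_def using d[of v] by (intro degree_add_le) auto
qed (simp add: lift_jet_def)

lemma has_jet_lift_jet:
  assumes "inj_on z {..<k}"
  shows "has_jet k z v (\<lambda>j. poly (pderiv (interp k z v)) (z j) + poly (pderiv (rootp k z)) (z j) * x j) (lift_jet k z v x)"
  unfolding has_jet_def lift_jet_def
  by (auto simp: poly_interp[OF assms] poly_rootp_at pderiv_add pderiv_mult)

lemma has_jet_add: "has_jet k z v u F \<Longrightarrow> has_jet k z v' u' G \<Longrightarrow> has_jet k z (\<lambda>j. v j + v' j) (\<lambda>j. u j + u' j) (F + G)"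
  and has_jet_smult: "has_jet k z v u F \<Longrightarrow> has_jet k z (\<lambda>j. c * v j) (\<lambda>j. c * u j) (smult c F)"
  by (auto simp: has_jet_def pderiv_add pderiv_smult)

lemma has_jet_diff_zero:
  assumes "has_jet k z v u F" "has_jet k z v u G" "j < k"
  shows "poly (F - G) (z j) = 0" "poly (pderiv (F - G)) (z j) = 0"
  using assms by (auto simp: has_jet_def pderiv_diff)

text \<open>A Hermite interpolant is projected onto the span of the representers: what is removed is
  orthogonal to all of them, so it has vanishing jets.\<close>

lemma minpoly_exists:
  assumes inj: "inj_on z {..<k}" and k: "2 * k \<le> Suc n"
  shows "\<exists>F. F \<in> kers n k z \<and> has_jet k z v u F"
proof -
  define x where "x j = (u j - poly (pderiv (interp k z v)) (z j)) / poly (pderiv (rootp k z)) (z j)" for j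
  define F where "F = lift_jet k z v x"
  have F: "has_jet k z v u F"
    using has_jet_lift_jet[OF inj, of v x] pderiv_rootp_nz[OF inj] by (auto simp: has_jet_def F_def x_def)
  have dF: "degree F \<le> n" unfolding F_def by (rule degree_lift_jet[OF k])
  obtain G where G: "G \<in> kers n k z" "\<And>H. H \<in> kers n k z \<Longrightarrow> ip n (F - G) H = 0"
    using kers_proj[OF dF, of k z] by blast
  have "degree (F - G) \<le> n" using dF kers_degree[OF G(1)] by (rule degree_diff_le)
  from orth_kers_imp_jet_zero[OF this G(2)] have "has_jet k z v u G"
    using F by (auto simp: has_jet_def pderiv_diff)
  then show ?thesis using G(1) by blast
qed

lemma minpoly_kers: "inj_on z {..<k} \<Longrightarrow> 2 * k \<le> Suc n \<Longrightarrow> minpoly n k z v u \<in> kers n k z"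
  and minpoly_jet: "inj_on z {..<k} \<Longrightarrow> 2 * k \<le> Suc n \<Longrightarrow> has_jet k z v u (minpoly n k z v u)"
  using someI_ex[OF minpoly_exists, of z k n v u] by (auto simp: minpoly_def)

lemma minpoly_unique:
  assumes inj: "inj_on z {..<k}" and k: "2 * k \<le> Suc n"
    and F: "F \<in> kers n k z" "has_jet k z v u F"
  shows "minpoly n k z v u = F"
proof -
  let ?G = "minpoly n k z v u"
  have d: "?G - F \<in> kers n k z" by (rule kers_diff[OF minpoly_kers[OF inj k] F(1)])
  have "ip n (?G - F) (?G - F) = 0"
    by (rule kers_orth[OF d kers_degree[OF d] has_jet_diff_zero[OF minpoly_jet[OF inj k] F(2)]])
  then have "nrm2 n (?G - F) = 0" by (simp add: ip_self)
  from nrm2_eq_0[OF this kers_degree[OF d]] show ?thesis by simp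
qed

lemma minpoly_add:
  assumes "inj_on z {..<k}" "2 * k \<le> Suc n"
  shows "minpoly n k z (\<lambda>j. v j + v' j) (\<lambda>j. u j + u' j) = minpoly n k z v u + minpoly n k z v' u'"
  by (intro minpoly_unique kers_add has_jet_add minpoly_kers minpoly_jet assms)

lemma minpoly_smult:
  assumes "inj_on z {..<k}" "2 * k \<le> Suc n"
  shows "minpoly n k z (\<lambda>j. c * v j) (\<lambda>j. c * u j) = smult c (minpoly n k z v u)"
  by (intro minpoly_unique kers_smult has_jet_smult minpoly_kers minpoly_jet assms)

lemma minpoly_cong:
  assumes "\<And>j. j < k \<Longrightarrow> v j = v' j" "\<And>j. j < k \<Longrightarrow> u j = u' j"
  shows "minpoly n k z v u = minpoly n k z v' u'"
proof -
  have "has_jet k z v u = has_jet k z v' u'" using assms by (auto simp: has_jet_def fun_eq_iff)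
  then show ?thesis by (simp add: minpoly_def)
qed

lemma qform_cong:
  assumes "\<And>j. j < k \<Longrightarrow> v j = v' j" "\<And>j. j < k \<Longrightarrow> u j = u' j"
  shows "qform n k z v u = qform n k z v' u'"
  unfolding qform_def by (subst minpoly_cong[OF assms]) auto

lemma qform_smult:
  assumes "inj_on z {..<k}" "2 * k \<le> Suc n"
  shows "qform n k z (\<lambda>j. c * v j) (\<lambda>j. c * u j) = (cmod c)\<^sup>2 * qform n k z v u"
  by (simp add: qform_def minpoly_smult[OF assms] nrm2_smult)

text \<open>Pythagoras: two polynomials with the same jets differ by one that is orthogonal to the
  representers, hence to \<open>minpoly\<close>.\<close>

lemma qform_decomp:
  assumes inj: "inj_on z {..<k}" and k: "2 * k \<le> Suc n"
    and F: "degree F \<le> n" "has_jet k z v u F"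
  shows "nrm2 n F = qform n k z v u + nrm2 n (F - minpoly n k z v u)"
proof -
  let ?G = "minpoly n k z v u"
  have "ip n (F - ?G) ?G = 0"
    by (rule kers_orth[OF minpoly_kers[OF inj k] degree_diff_le[OF F(1) kers_degree[OF minpoly_kers[OF inj k]]]
          has_jet_diff_zero[OF F(2) minpoly_jet[OF inj k]]])
  then have "Re (ip n ?G (F - ?G)) = 0" using ip_cnj[of n "F - ?G" ?G] by simp
  then show ?thesis using nrm2_add[of n ?G "F - ?G"] by (simp add: qform_def)
qed

lemma qform_le:
  assumes "inj_on z {..<k}" "2 * k \<le> Suc n" "degree F \<le> n" "has_jet k z v u F"
  shows "qform n k z v u \<le> nrm2 n F"
  using qform_decomp[OF assms] by simp

lemma pderiv_sum: "pderiv (sum f A) = (\<Sum>i\<in>A. pderiv (f i))"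
  by (induction A rule: infinite_finite_induct) (auto simp: pderiv_add)

text \<open>\<open>minpoly\<close> is defined by choice; a linear expression in the jets with fixed
  polynomials is what makes it, and so \<open>qform\<close>, measurable.\<close>

lemma minpoly_linear:
  assumes inj: "inj_on z {..<k}" and k: "2 * k \<le> Suc n"
  shows "minpoly n k z v u = (\<Sum>j<k. smult (v j) (minpoly n k z (\<lambda>i. of_bool (i = j)) (\<lambda>_. 0)) +
    smult (u j) (minpoly n k z (\<lambda>_. 0) (\<lambda>i. of_bool (i = j))))"
proof (rule minpoly_unique[OF inj k])
  show "(\<Sum>j<k. smult (v j) (minpoly n k z (\<lambda>i. of_bool (i = j)) (\<lambda>_. 0)) +
    smult (u j) (minpoly n k z (\<lambda>_. 0) (\<lambda>i. of_bool (i = j)))) \<in> kers n k z"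
    by (intro kers_sum kers_add kers_smult minpoly_kers[OF inj k])
  have V: "poly (minpoly n k z v u) (z i) = v i" "poly (pderiv (minpoly n k z v u)) (z i) = u i" if "i < k" for v u i
    using minpoly_jet[OF inj k, of v u] that by (auto simp: has_jet_def)
  show "has_jet k z v u (\<Sum>j<k. smult (v j) (minpoly n k z (\<lambda>i. of_bool (i = j)) (\<lambda>_. 0)) +
    smult (u j) (minpoly n k z (\<lambda>_. 0) (\<lambda>i. of_bool (i = j))))"
    unfolding has_jet_def by (auto simp: poly_sum pderiv_sum pderiv_add pderiv_smult V)
qed

lemma measurable_qform:
  assumes inj: "inj_on z {..<k}" and k: "2 * k \<le> Suc n"
    and v: "\<And>j. j < k \<Longrightarrow> (\<lambda>w. v w j) \<in> borel_measurable M" and u: "\<And>j. j < k \<Longrightarrow> (\<lambda>w. u w j) \<in> borel_measurable M"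
  shows "(\<lambda>w. qform n k z (v w) (u w)) \<in> borel_measurable M"
proof -
  have "(\<lambda>w. minpoly n k z (v w) (u w)) \<in> measurable M pm"
    unfolding minpoly_linear[OF inj k, of "v _" "u _"]
    by (intro measurable_pm_sum measurable_pm_add measurable_pm_smult v u measurable_const) auto
  then show ?thesis unfolding qform_def by (rule measurable_nrm2)
qed

text \<open>The \<open>T\<close> of the overview, an integral over values and derivatives;
  \<open>jet_moment\<close> below is its \<open>J\<close>, over the derivatives only, with all
  values set to 0.\<close>

definition jet_total :: "nat \<Rightarrow> nat \<Rightarrow> (nat \<Rightarrow> complex) \<Rightarrow> ennreal" where
  "jet_total n k z = (\<integral>\<^sup>+v. \<integral>\<^sup>+u. ennreal (exp (- qform n k z v u)) \<partial>cL k \<partial>cL k)"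

definition jet_moment :: "nat \<Rightarrow> nat \<Rightarrow> (nat \<Rightarrow> complex) \<Rightarrow> ennreal" where
  "jet_moment n k z = (\<integral>\<^sup>+u. (\<Prod>j<k. ennreal ((cmod (u j))\<^sup>2)) * ennreal (exp (- qform n k z (\<lambda>_. 0) u)) \<partial>cL k)"

text \<open>The polynomials with the jets of \<open>F\<close> form the affine space
  \<open>F + P^2 g\<close>. A translation in \<open>g\<close> moves its origin to
  \<open>minpoly\<close>, where orthogonality splits off \<open>exp (- qform)\<close>; the integral
  that remains is independent of the jets.\<close>

lemma nn_integral_fibre:
  assumes inj: "inj_on z {..<k}" and k: "2 * k \<le> Suc n" and F: "degree F \<le> n" "has_jet k z v u F"
  shows "(\<integral>\<^sup>+g. ennreal (exp (- nrm2 n (F + rootp k z * rootp k z * g))) \<partial>polyL (Suc n - 2 * k)) =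
    ennreal (exp (- qform n k z v u)) * (\<integral>\<^sup>+g. ennreal (exp (- nrm2 n (rootp k z * rootp k z * g))) \<partial>polyL (Suc n - 2 * k))"
proof -
  let ?P = "rootp k z * rootp k z" and ?G = "minpoly n k z v u" and ?m = "Suc n - 2 * k"
  have dP: "degree ?P = 2 * k" by (simp add: degree_mult_eq rootp_nz degree_rootp)
  have Pnz: "?P \<noteq> 0" by (simp add: rootp_nz)
  have dG: "degree ?G \<le> n" by (rule kers_degree[OF minpoly_kers[OF inj k]])
  have "?P dvd F - ?G"
    by (rule rootp_square_dvd[OF inj has_jet_diff_zero[OF F(2) minpoly_jet[OF inj k]]])
  then obtain g0 where g0: "F - ?G = ?P * g0" by (elim dvdE)
  have dg0: "g0 = 0 \<or> degree g0 < ?m"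
  proof (cases "g0 = 0")
    case False
    have "degree (?P * g0) = 2 * k + degree g0" using False Pnz dP by (subst degree_mult_eq) auto
    moreover have "degree (F - ?G) \<le> n" using F(1) dG by (rule degree_diff_le)
    ultimately show ?thesis unfolding g0 by linarith
  qed simp
  have "(\<integral>\<^sup>+g. ennreal (exp (- nrm2 n (F + ?P * g))) \<partial>polyL ?m) = (\<integral>\<^sup>+g. ennreal (exp (- nrm2 n (?G + ?P * (g0 + g)))) \<partial>polyL ?m)"
  proof -
    have "F + ?P * g = ?G + ?P * (g0 + g)" for g
      using g0 by (simp add: distrib_left algebra_simps)
    then show ?thesis by simp
  qed
  also have "\<dots> = (\<integral>\<^sup>+g. ennreal (exp (- nrm2 n (?G + ?P * g))) \<partial>polyL ?m)"
    by (rule nn_integral_polyL_translate[OF _ dg0, where F="\<lambda>g. ennreal (exp (- nrm2 n (?G + ?P * g)))"]) measurable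
  also have "\<dots> = (\<integral>\<^sup>+g. ennreal (exp (- qform n k z v u)) * ennreal (exp (- nrm2 n (?P * g))) \<partial>polyL ?m)"
  proof (rule nn_integral_cong_AE, rule AE_mp[OF AE_polyL_degree[of ?m]], intro AE_I2 impI)
    fix g :: "complex poly" assume g: "g = 0 \<or> degree g < ?m"
    have "degree (?P * g) \<le> n"
      using g degree_mult_le[of ?P g] dP by (cases "g = 0") auto
    moreover have jP: "poly (?P * g) (z j) = 0 \<and> poly (pderiv (?P * g)) (z j) = 0" if "j < k" for j
      using poly_rootp_at[OF that, of z] by (simp add: pderiv_mult)
    ultimately have "ip n (?P * g) ?G = 0"
      by (intro kers_orth[OF minpoly_kers[OF inj k]]) auto
    then have "Re (ip n ?G (?P * g)) = 0" using ip_cnj[of n "?P * g" ?G] by simp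
    then have "nrm2 n (?G + ?P * g) = qform n k z v u + nrm2 n (?P * g)"
      unfolding nrm2_add qform_def by simp
    then show "ennreal (exp (- nrm2 n (?G + ?P * g))) = ennreal (exp (- qform n k z v u)) * ennreal (exp (- nrm2 n (?P * g)))"
      by (simp add: ennreal_mult[symmetric] exp_add[symmetric])
  qed
  also have "\<dots> = ennreal (exp (- qform n k z v u)) * (\<integral>\<^sup>+g. ennreal (exp (- nrm2 n (?P * g))) \<partial>polyL ?m)"
    by (rule nn_integral_cmult) measurable
  finally show ?thesis .
qed

text \<open>This is the Kac--Rice formula: given \<open>f (z j) = 0\<close> for all \<open>j\<close>, the derivatives have a density
  proportional to \<open>exp (- qform n k z 0 u)\<close>.\<close>

lemma zero_density_eq:
  assumes inj: "inj_on z {..<k}" and k: "2 * k \<le> Suc n"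
  shows "zero_density n k z * jet_total n k z = jet_moment n k z"
    and "jet_total n k z \<noteq> 0" and "jet_total n k z \<noteq> \<infinity>"
proof -
  let ?P = "rootp k z" and ?m = "Suc n - 2 * k"
  define d where "d j = poly (pderiv ?P) (z j)" for j
  define \<kappa> where "\<kappa> = (\<integral>\<^sup>+g. ennreal (exp (- nrm2 n (?P * ?P * g))) \<partial>polyL ?m)"
  define V where "V = ennreal ((vdm k z)\<^sup>2)"
  define W where "W = (\<Prod>j<k. ennreal ((cmod (d j))\<^sup>2))"
  have dnz: "d j \<noteq> 0" if "j < k" for j unfolding d_def by (rule pderiv_rootp_nz[OF inj that])
  \<comment> \<open>\<open>W\<close> is the Jacobian of the substitution
    \<open>u j = d j * x j\<close>, and the product of the \<open>|d j|\<close> is the squared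
    Vandermonde determinant.\<close>
  have WV: "W = V * V"
  proof -
    have "W = ennreal ((\<Prod>j<k. cmod (d j))\<^sup>2)"
      unfolding W_def by (simp add: prod_ennreal prod_power_distrib)
    also have "(\<Prod>j<k. cmod (d j)) = (vdm k z)\<^sup>2" unfolding d_def by (rule prod_pderiv_rootp)
    finally show ?thesis by (simp add: V_def ennreal_mult[symmetric] power2_eq_square)
  qed
  have V0: "V \<noteq> 0" "V \<noteq> \<infinity>" using vdm_pos[OF inj] by (auto simp: V_def)
  have W0: "W \<noteq> 0" "W \<noteq> \<infinity>" using V0 by (auto simp: WV ennreal_mult_eq_top_iff)
  have mq [measurable]: "(\<lambda>u. qform n k z v u) \<in> borel_measurable (cL k)" for v
    by (rule measurable_qform[OF inj k]) measurable
  have mI [measurable]: "interp k z \<in> measurable (cL k) pm"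
    using measurable_interp_cL[OF measurable_ident] by simp
  have n1: "Suc n - k = ?m + k" using k by simp
  have n2: "Suc n = (Suc n - k) + k" using k by simp
  have assoc: "?P * (interp k z x + ?P * g) = ?P * interp k z x + ?P * ?P * g" for x g
    by (simp add: algebra_simps)
  have mq2: "(\<lambda>x. qform n k z v (\<lambda>j. a j + d j * x j)) \<in> borel_measurable (cL k)" for v a
    by (rule measurable_qform[OF inj k]) measurable
  \<comment> \<open>The quotient is written in terms of its values \<open>x\<close> at the points
    and a further quotient. The polynomial with the prescribed roots then has the derivatives
    \<open>d j * x j\<close> there.\<close>
  have den: "zero_density n k z = gauss_const n * (\<kappa> * (\<integral>\<^sup>+x. (\<Prod>j<k. ennreal ((cmod (x j))\<^sup>2)) * ennreal (exp (- qform n k z (\<lambda>_. 0) (\<lambda>j. d j * x j))) \<partial>cL k))"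
  proof -
    have "ennreal ((vdm k z)\<^sup>2) * (\<integral>\<^sup>+g. (\<Prod>j<k. ennreal ((cmod (poly g (z j)))\<^sup>2)) * ennreal (exp (- nrm2 n (?P * g))) \<partial>polyL (?m + k)) =
      (\<integral>\<^sup>+x. \<integral>\<^sup>+g. (\<Prod>j<k. ennreal ((cmod (poly (interp k z x + ?P * g) (z j)))\<^sup>2)) * ennreal (exp (- nrm2 n (?P * (interp k z x + ?P * g)))) \<partial>polyL ?m \<partial>cL k)"
      by (rule nn_integral_polyL_interp[OF inj]) measurable
    also have "\<dots> = (\<integral>\<^sup>+x. (\<Prod>j<k. ennreal ((cmod (x j))\<^sup>2)) * (ennreal (exp (- qform n k z (\<lambda>_. 0) (\<lambda>j. d j * x j))) * \<kappa>) \<partial>cL k)"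
    proof (rule nn_integral_cong)
      fix x
      have "(\<Prod>j<k. ennreal ((cmod (poly (interp k z x + ?P * g) (z j)))\<^sup>2)) = (\<Prod>j<k. ennreal ((cmod (x j))\<^sup>2))" for g
        by (intro prod.cong) (auto simp: poly_interp[OF inj] poly_rootp_at)
      then have "(\<integral>\<^sup>+g. (\<Prod>j<k. ennreal ((cmod (poly (interp k z x + ?P * g) (z j)))\<^sup>2)) * ennreal (exp (- nrm2 n (?P * (interp k z x + ?P * g)))) \<partial>polyL ?m) =
        (\<Prod>j<k. ennreal ((cmod (x j))\<^sup>2)) * (\<integral>\<^sup>+g. ennreal (exp (- nrm2 n (?P * interp k z x + ?P * ?P * g))) \<partial>polyL ?m)"
        unfolding assoc by (simp only:) (rule nn_integral_cmult, measurable)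
      also have "(\<integral>\<^sup>+g. ennreal (exp (- nrm2 n (?P * interp k z x + ?P * ?P * g))) \<partial>polyL ?m) = ennreal (exp (- qform n k z (\<lambda>_. 0) (\<lambda>j. d j * x j))) * \<kappa>"
        unfolding \<kappa>_def
      proof (rule nn_integral_fibre[OF inj k])
        have z: "interp k z (\<lambda>_. 0) = 0" by (induction k) auto
        have l: "?P * interp k z x = lift_jet k z (\<lambda>_. 0) x" by (simp add: lift_jet_def z)
        show "degree (?P * interp k z x) \<le> n" unfolding l by (rule degree_lift_jet[OF k])
        show "has_jet k z (\<lambda>_. 0) (\<lambda>j. d j * x j) (?P * interp k z x)"
          unfolding l using has_jet_lift_jet[OF inj, of "\<lambda>_. 0" x] by (simp add: z d_def)
      qed
      finally show "(\<integral>\<^sup>+g. (\<Prod>j<k. ennreal ((cmod (poly (interp k z x + ?P * g) (z j)))\<^sup>2)) * ennreal (exp (- nrm2 n (?P * (interp k z x + ?P * g)))) \<partial>polyL ?m) =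
        (\<Prod>j<k. ennreal ((cmod (x j))\<^sup>2)) * (ennreal (exp (- qform n k z (\<lambda>_. 0) (\<lambda>j. d j * x j))) * \<kappa>)" .
    qed
    also have "\<dots> = (\<integral>\<^sup>+x. \<kappa> * ((\<Prod>j<k. ennreal ((cmod (x j))\<^sup>2)) * ennreal (exp (- qform n k z (\<lambda>_. 0) (\<lambda>j. d j * x j)))) \<partial>cL k)"
      by (simp only: mult_ac)
    also have "\<dots> = \<kappa> * (\<integral>\<^sup>+x. (\<Prod>j<k. ennreal ((cmod (x j))\<^sup>2)) * ennreal (exp (- qform n k z (\<lambda>_. 0) (\<lambda>j. d j * x j))) \<partial>cL k)"
      using mq2[of "\<lambda>_. 0" "\<lambda>_. 0"] by (intro nn_integral_cmult) (simp, measurable)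
    finally show ?thesis unfolding zero_density_def n1 by simp
  qed
  \<comment> \<open>One factor \<open>W\<close> is the Jacobian of \<open>u j = d j * x j\<close>,
    the other comes from the factors \<open>|u j|^2\<close>.\<close>
  have mom: "jet_moment n k z = W * W * (\<integral>\<^sup>+x. (\<Prod>j<k. ennreal ((cmod (x j))\<^sup>2)) * ennreal (exp (- qform n k z (\<lambda>_. 0) (\<lambda>j. d j * x j))) \<partial>cL k)"
  proof -
    have "jet_moment n k z = W * (\<integral>\<^sup>+x. (\<Prod>j<k. ennreal ((cmod ((\<lambda>i\<in>{..<k}. 0 + d i * x i) j))\<^sup>2)) * ennreal (exp (- qform n k z (\<lambda>_. 0) (\<lambda>i\<in>{..<k}. 0 + d i * x i))) \<partial>cL k)"
      unfolding jet_moment_def W_def by (rule nn_integral_cL_affine) (use dnz in \<open>simp, measurable\<close>)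
    also have "(\<integral>\<^sup>+x. (\<Prod>j<k. ennreal ((cmod ((\<lambda>i\<in>{..<k}. 0 + d i * x i) j))\<^sup>2)) * ennreal (exp (- qform n k z (\<lambda>_. 0) (\<lambda>i\<in>{..<k}. 0 + d i * x i))) \<partial>cL k) =
      (\<integral>\<^sup>+x. W * ((\<Prod>j<k. ennreal ((cmod (x j))\<^sup>2)) * ennreal (exp (- qform n k z (\<lambda>_. 0) (\<lambda>j. d j * x j)))) \<partial>cL k)"
    proof (rule nn_integral_cong)
      fix x
      have "(\<Prod>j<k. ennreal ((cmod ((\<lambda>i\<in>{..<k}. 0 + d i * x i) j))\<^sup>2)) = W * (\<Prod>j<k. ennreal ((cmod (x j))\<^sup>2))"
        unfolding W_def prod.distrib[symmetric] by (intro prod.cong) (auto simp: norm_mult power_mult_distrib ennreal_mult)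
      moreover have "qform n k z (\<lambda>_. 0) (\<lambda>i\<in>{..<k}. 0 + d i * x i) = qform n k z (\<lambda>_. 0) (\<lambda>j. d j * x j)"
        by (rule qform_cong) auto
      ultimately show "(\<Prod>j<k. ennreal ((cmod ((\<lambda>i\<in>{..<k}. 0 + d i * x i) j))\<^sup>2)) * ennreal (exp (- qform n k z (\<lambda>_. 0) (\<lambda>i\<in>{..<k}. 0 + d i * x i))) =
        W * ((\<Prod>j<k. ennreal ((cmod (x j))\<^sup>2)) * ennreal (exp (- qform n k z (\<lambda>_. 0) (\<lambda>j. d j * x j))))"
        by (simp only: mult.assoc)
    qed
    also have "\<dots> = W * (\<integral>\<^sup>+x. (\<Prod>j<k. ennreal ((cmod (x j))\<^sup>2)) * ennreal (exp (- qform n k z (\<lambda>_. 0) (\<lambda>j. d j * x j))) \<partial>cL k)"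
      using mq2[of "\<lambda>_. 0" "\<lambda>_. 0"] by (intro nn_integral_cmult) (simp, measurable)
    finally show ?thesis by (simp only: mult.assoc)
  qed
  \<comment> \<open>Total mass one, written in jet coordinates: interpolation is used for the values
    and again for the derivatives. The identity determines \<open>gauss_const n * \<kappa>\<close>
    and shows that \<open>jet_total\<close> is neither 0 nor infinite.\<close>
  have tot: "W * W = gauss_const n * \<kappa> * jet_total n k z"
  proof -
    have inner: "V * (\<integral>\<^sup>+g. ennreal (exp (- nrm2 n (interp k z v + ?P * g))) \<partial>polyL (?m + k)) =
      (\<integral>\<^sup>+x. ennreal (exp (- qform n k z v (\<lambda>j. poly (pderiv (interp k z v)) (z j) + d j * x j))) * \<kappa> \<partial>cL k)" for v
    proof -
      have "V * (\<integral>\<^sup>+g. ennreal (exp (- nrm2 n (interp k z v + ?P * g))) \<partial>polyL (?m + k)) =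
        (\<integral>\<^sup>+x. \<integral>\<^sup>+g. ennreal (exp (- nrm2 n (interp k z v + ?P * (interp k z x + ?P * g)))) \<partial>polyL ?m \<partial>cL k)"
        unfolding V_def by (rule nn_integral_polyL_interp[OF inj]) measurable
      also have "\<dots> = (\<integral>\<^sup>+x. \<integral>\<^sup>+g. ennreal (exp (- nrm2 n (lift_jet k z v x + ?P * ?P * g))) \<partial>polyL ?m \<partial>cL k)"
        unfolding assoc lift_jet_def by (simp only: add.assoc)
      also have "\<dots> = (\<integral>\<^sup>+x. ennreal (exp (- qform n k z v (\<lambda>j. poly (pderiv (interp k z v)) (z j) + d j * x j))) * \<kappa> \<partial>cL k)"
        unfolding \<kappa>_def d_def
        by (intro nn_integral_cong nn_integral_fibre[OF inj k] degree_lift_jet[OF k] has_jet_lift_jet[OF inj])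
      finally show ?thesis .
    qed
    have aff: "(\<integral>\<^sup>+u. ennreal (exp (- qform n k z v u)) \<partial>cL k) =
      W * (\<integral>\<^sup>+x. ennreal (exp (- qform n k z v (\<lambda>j. poly (pderiv (interp k z v)) (z j) + d j * x j))) \<partial>cL k)" for v
    proof -
      have "(\<integral>\<^sup>+u. ennreal (exp (- qform n k z v u)) \<partial>cL k) =
        W * (\<integral>\<^sup>+x. ennreal (exp (- qform n k z v (\<lambda>i\<in>{..<k}. poly (pderiv (interp k z v)) (z i) + d i * x i))) \<partial>cL k)"
        unfolding W_def by (rule nn_integral_cL_affine) (use dnz in \<open>simp, measurable\<close>)
      moreover have "qform n k z v (\<lambda>i\<in>{..<k}. poly (pderiv (interp k z v)) (z i) + d i * x i) =
        qform n k z v (\<lambda>j. poly (pderiv (interp k z v)) (z j) + d j * x j)" for x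
        by (rule qform_cong) auto
      ultimately show ?thesis by simp
    qed
    have both: "W * (V * (\<integral>\<^sup>+g. ennreal (exp (- nrm2 n (interp k z v + ?P * g))) \<partial>polyL (?m + k))) =
      \<kappa> * (\<integral>\<^sup>+u. ennreal (exp (- qform n k z v u)) \<partial>cL k)" for v
    proof -
      have "(\<integral>\<^sup>+x. ennreal (exp (- qform n k z v (\<lambda>j. poly (pderiv (interp k z v)) (z j) + d j * x j))) * \<kappa> \<partial>cL k) =
        (\<integral>\<^sup>+x. ennreal (exp (- qform n k z v (\<lambda>j. poly (pderiv (interp k z v)) (z j) + d j * x j))) \<partial>cL k) * \<kappa>"
      proof -
        note [measurable] = mq2[of v "\<lambda>j. poly (pderiv (interp k z v)) (z j)"]
        show ?thesis by (rule nn_integral_multc) measurable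
      qed
      then show ?thesis unfolding inner aff by (simp only: mult_ac)
    qed
    have "V * (\<integral>\<^sup>+f. ennreal (exp (- nrm2 n f)) \<partial>polyL ((?m + k) + k)) =
      (\<integral>\<^sup>+v. \<integral>\<^sup>+g. ennreal (exp (- nrm2 n (interp k z v + ?P * g))) \<partial>polyL (?m + k) \<partial>cL k)"
      unfolding V_def by (rule nn_integral_polyL_interp[OF inj]) measurable
    then have "W * W * (\<integral>\<^sup>+f. ennreal (exp (- nrm2 n f)) \<partial>polyL ((?m + k) + k)) =
      W * V * (\<integral>\<^sup>+v. \<integral>\<^sup>+g. ennreal (exp (- nrm2 n (interp k z v + ?P * g))) \<partial>polyL (?m + k) \<partial>cL k)"
      by (simp only: WV mult_ac)
    also have "\<dots> = (\<integral>\<^sup>+v. W * V * (\<integral>\<^sup>+g. ennreal (exp (- nrm2 n (interp k z v + ?P * g))) \<partial>polyL (?m + k)) \<partial>cL k)"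
      by (rule nn_integral_cmult[symmetric]) measurable
    also have "\<dots> = (\<integral>\<^sup>+v. \<kappa> * (\<integral>\<^sup>+u. ennreal (exp (- qform n k z v u)) \<partial>cL k) \<partial>cL k)"
      by (simp only: mult.assoc both)
    also have "\<dots> = \<kappa> * jet_total n k z"
    proof -
      have "(\<lambda>w. qform n k z (fst w) (snd w)) \<in> borel_measurable (cL k \<Otimes>\<^sub>M cL k)"
        by (rule measurable_qform[OF inj k]) measurable
      then have "(\<lambda>v. \<integral>\<^sup>+u. ennreal (exp (- qform n k z v u)) \<partial>cL k) \<in> borel_measurable (cL k)" by measurable
      then show ?thesis unfolding jet_total_def by (rule nn_integral_cmult)
    qed
    finally have *: "W * W * (\<integral>\<^sup>+f. ennreal (exp (- nrm2 n f)) \<partial>polyL (Suc n)) = \<kappa> * jet_total n k z"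
      using k by simp
    have "W * W = W * W * (gauss_const n * (\<integral>\<^sup>+f. ennreal (exp (- nrm2 n f)) \<partial>polyL (Suc n)))"
      by (simp add: gauss_const_total)
    also have "\<dots> = gauss_const n * (\<kappa> * jet_total n k z)" unfolding *[symmetric] by (simp only: mult_ac)
    finally show ?thesis by (simp only: mult.assoc)
  qed
  have WW: "W * W \<noteq> 0" "W * W \<noteq> \<infinity>" using W0 by (auto simp: ennreal_mult_eq_top_iff)
  show nz: "jet_total n k z \<noteq> 0" using tot WW by auto
  have g\<kappa>: "gauss_const n * \<kappa> \<noteq> 0" using tot WW by auto
  show "jet_total n k z \<noteq> \<infinity>" using tot WW g\<kappa> by (auto simp: ennreal_mult_eq_top_iff)
  have "zero_density n k z * jet_total n k z * (W * W) = jet_moment n k z * (W * W)"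
    unfolding den mom by (subst (3) tot) (simp only: mult_ac)
  then show "zero_density n k z * jet_total n k z = jet_moment n k z"
    using WW ennreal_mult_cancel_left[of "W * W" "zero_density n k z * jet_total n k z" "jet_moment n k z"]
    by (simp add: mult.commute top_unique)
qed

subsection \<open>Homogenised evaluation\<close>

text \<open>The form of degree \<open>n\<close> in homogeneous coordinates, with
  \<open>hev n F a 1 = poly F a\<close> if the degree is at most \<open>n\<close>. Rotations of the
  sphere act linearly on \<open>(x, y)\<close>, which spares fractional linear maps.\<close>

definition hev :: "nat \<Rightarrow> complex poly \<Rightarrow> complex \<Rightarrow> complex \<Rightarrow> complex" where
  "hev n F x y = (\<Sum>j\<le>n. coeff F j * x ^ j * y ^ (n - j))"

definition sw :: "complex \<Rightarrow> real" where
  "sw a = sqrt (1 + (cmod a)\<^sup>2)"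

text \<open>Half of \<open>sphere_dist\<close>: the sine of the angle between the complex lines
  through \<open>(a, 1)\<close> and \<open>(b, 1)\<close>.\<close>

definition hdist :: "complex \<Rightarrow> complex \<Rightarrow> real" where
  "hdist a b = cmod (a - b) / (sw a * sw b)"

definition hn :: "nat \<Rightarrow> complex poly \<Rightarrow> real" where
  "hn n F = sqrt (nrm2 n F)"

lemma sw_ge_1: "sw a \<ge> 1"
  by (simp add: sw_def)

lemma sw_pos [simp]: "sw a > 0"
  using sw_ge_1[of a] by linarith

lemma sw_nz [simp]: "sw a \<noteq> 0"
  using sw_pos[of a] by linarith

lemma sw_sq: "(sw a)\<^sup>2 = 1 + (cmod a)\<^sup>2"
  by (simp add: sw_def)

lemma hdist_nonneg [simp]: "hdist a b \<ge> 0"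
  by (simp add: hdist_def less_imp_le)

lemma sphere_dist_hdist: "sphere_dist a b = 2 * hdist a b"
  by (simp add: sphere_dist_def hdist_def sw_def)

lemma hn_nonneg [simp]: "hn n F \<ge> 0"
  by (simp add: hn_def)

lemma hn_sq: "(hn n F)\<^sup>2 = nrm2 n F"
  by (simp add: hn_def)

lemma ip_le_hn: "cmod (ip n F G) \<le> hn n F * hn n G"
  using ip_cauchy_schwarz[of n F G] unfolding hn_def real_sqrt_mult[symmetric] by (rule real_le_rsqrt)

lemma hn_smult: "hn n (smult c F) = cmod c * hn n F"
  by (simp add: hn_def nrm2_smult real_sqrt_mult)

lemma hn_triangle: "hn n (F + G) \<le> hn n F + hn n G"
proof (rule power2_le_imp_le)
  have "Re (ip n F G) \<le> hn n F * hn n G"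
    using ip_le_hn[of n F G] complex_Re_le_cmod order_trans by blast
  then show "(hn n (F + G))\<^sup>2 \<le> (hn n F + hn n G)\<^sup>2"
    by (simp add: hn_sq nrm2_add power2_sum)
qed simp

text \<open>Lagrange's identity: the squared sine and cosine of that angle add up to one.\<close>

lemma chord_sq: "(cmod (a - b))\<^sup>2 + (cmod (1 + cnj a * b))\<^sup>2 = (sw a * sw b)\<^sup>2"
proof -
  have "complex_of_real ((cmod (a - b))\<^sup>2 + (cmod (1 + cnj a * b))\<^sup>2) = complex_of_real ((1 + (cmod a)\<^sup>2) * (1 + (cmod b)\<^sup>2))"
    unfolding of_real_add of_real_mult complex_norm_square by (simp add: algebra_simps)
  then show ?thesis unfolding power_mult_distrib sw_sq of_real_eq_iff .
qed

lemma cmod_one_cnj: "cmod (1 + cnj a * b) = sw a * sw b * sqrt (1 - (hdist a b)\<^sup>2)"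
  and hdist_le_1: "hdist a b \<le> 1"
proof -
  have p: "sw a * sw b > 0" by simp
  have d: "cmod (a - b) = sw a * sw b * hdist a b" by (simp add: hdist_def)
  have eq: "(cmod (1 + cnj a * b))\<^sup>2 = (sw a * sw b)\<^sup>2 * (1 - (hdist a b)\<^sup>2)"
    using chord_sq[of a b] unfolding d power_mult_distrib by (simp add: algebra_simps)
  then have "0 \<le> (sw a * sw b)\<^sup>2 * (1 - (hdist a b)\<^sup>2)" by (metis zero_le_power2)
  moreover have "(sw a * sw b)\<^sup>2 > 0" using p by simp
  ultimately have "0 \<le> 1 - (hdist a b)\<^sup>2" by (meson mult_pos_neg not_le)
  then have h: "(hdist a b)\<^sup>2 \<le> 1" by simp
  then show "hdist a b \<le> 1" by (simp add: power2_le_iff_abs_le power_le_one_iff abs_square_le_1)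
  have "cmod (1 + cnj a * b) = sqrt ((sw a * sw b)\<^sup>2 * (1 - (hdist a b)\<^sup>2))"
    unfolding eq[symmetric] by simp
  then show "cmod (1 + cnj a * b) = sw a * sw b * sqrt (1 - (hdist a b)\<^sup>2)"
    using p by (simp add: real_sqrt_mult)
qed

lemma hev_add: "hev n (F + G) x y = hev n F x y + hev n G x y"
  by (simp add: hev_def distrib_right sum.distrib)

lemma hev_diff: "hev n (F - G) x y = hev n F x y - hev n G x y"
  by (simp add: hev_def left_diff_distrib sum_subtractf)

lemma hev_smult: "hev n (smult c F) x y = c * hev n F x y"
  by (simp add: hev_def sum_distrib_left mult.assoc)

lemma hev_pCons: "hev (Suc n) (pCons 0 F) x y = x * hev n F x y"
  unfolding hev_def by (subst sum.atMost_Suc_shift) (simp add: sum_distrib_left mult_ac)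

lemma hev_Suc: "degree F \<le> n \<Longrightarrow> hev (Suc n) F x y = y * hev n F x y"
  unfolding hev_def sum_distrib_left
  by (subst sum.atMost_Suc) (auto simp: coeff_eq_0 Suc_diff_le intro!: sum.cong)

lemma hev_linear:
  assumes "degree F \<le> n"
  shows "hev (Suc n) ([:b, c:] * F) x y = (b * y + c * x) * hev n F x y"
proof -
  have "[:b, c:] * F = smult b F + pCons 0 (smult c F)" by simp
  then show ?thesis using hev_Suc[OF assms] by (simp only: hev_add hev_smult hev_pCons) (simp add: algebra_simps)
qed

text \<open>The representer of evaluation at the homogeneous point \<open>(x, y)\<close>. As a power
  of a linear form it can be evaluated in closed form at every other point.\<close>

definition kerP :: "nat \<Rightarrow> complex \<Rightarrow> complex \<Rightarrow> complex poly" where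
  "kerP n x y = [:cnj y, cnj x:] ^ n"

lemma coeff_linear_pow: "coeff ([:b, c:] ^ n) j = of_nat (n choose j) * c ^ j * b ^ (n - j)"
  for b c :: complex
proof -
  have "[:b, c:] ^ n = (monom c 1 + [:b:]) ^ n" by (simp add: monom_altdef)
  also have "\<dots> = (\<Sum>i\<le>n. of_nat (n choose i) * monom c 1 ^ i * [:b:] ^ (n - i))"
    by (rule binomial_ring)
  also have "\<dots> = (\<Sum>i\<le>n. monom (of_nat (n choose i) * c ^ i * b ^ (n - i)) i)"
    by (intro sum.cong refl) (simp add: monom_power poly_const_pow of_nat_poly smult_monom mult_ac)
  finally show ?thesis by (simp add: coeff_sum_monom binomial_eq_0)
qed

lemma degree_linear_pow: "degree ([:b, c:] ^ n) \<le> n" for b c :: complex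
  by (rule degree_le) (simp add: coeff_linear_pow binomial_eq_0)

lemma hev_linear_pow: "hev n ([:b, c:] ^ n) x y = (b * y + c * x) ^ n"
proof -
  have "hev n ([:b, c:] ^ n) x y = (\<Sum>j\<le>n. of_nat (n choose j) * (c * x) ^ j * (b * y) ^ (n - j))"
    unfolding hev_def coeff_linear_pow by (intro sum.cong) (auto simp: power_mult_distrib)
  also have "\<dots> = (c * x + b * y) ^ n" by (rule binomial_ring[symmetric])
  finally show ?thesis by (simp add: add.commute)
qed

lemma ip_kerP: "ip n F (kerP n x y) = hev n F x y"
  unfolding ip_def hev_def kerP_def coeff_linear_pow by (intro sum.cong) (auto simp: binomial_eq_0_iff)

lemma degree_kerP: "degree (kerP n x y) \<le> n"
  unfolding kerP_def by (rule degree_linear_pow)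

lemma hev_kerP: "hev n (kerP n x y) u w = (cnj y * w + cnj x * u) ^ n"
  unfolding kerP_def by (rule hev_linear_pow)

lemma hev_bound: "(cmod (hev n F x y))\<^sup>2 \<le> nrm2 n F * ((cmod x)\<^sup>2 + (cmod y)\<^sup>2) ^ n"
proof -
  have "of_real (nrm2 n (kerP n x y)) = (cnj y * y + cnj x * x) ^ n"
    unfolding ip_self[symmetric] ip_kerP hev_kerP ..
  also have "\<dots> = of_real (((cmod x)\<^sup>2 + (cmod y)\<^sup>2) ^ n)"
  proof -
    have "cnj y * y + cnj x * x = of_real ((cmod x)\<^sup>2 + (cmod y)\<^sup>2)"
      unfolding of_real_add complex_norm_square by (simp add: mult.commute)
    then show ?thesis by simp
  qed
  finally have "nrm2 n (kerP n x y) = ((cmod x)\<^sup>2 + (cmod y)\<^sup>2) ^ n"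
    unfolding of_real_eq_iff .
  then show ?thesis using ip_cauchy_schwarz[of n F "kerP n x y"] by (simp add: ip_kerP)
qed

text \<open>The point \<open>(a + t, 1 - cnj a * t)\<close> is obtained from \<open>(t, 1)\<close> by a rotation of the sphere
  that moves \<open>0\<close> to \<open>a\<close>, up to the factor \<open>sw a\<close>.\<close>

lemma rotated_norm: "(cmod (a + t))\<^sup>2 + (cmod (1 - cnj a * t))\<^sup>2 = (sw a)\<^sup>2 * (1 + (cmod t)\<^sup>2)"
proof -
  have "complex_of_real ((cmod (a + t))\<^sup>2 + (cmod (1 - cnj a * t))\<^sup>2) = complex_of_real ((1 + (cmod a)\<^sup>2) * (1 + (cmod t)\<^sup>2))"
    unfolding of_real_add of_real_mult complex_norm_square by (simp add: algebra_simps)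
  then show ?thesis unfolding sw_sq of_real_eq_iff .
qed

text \<open>On the circle of radius \<open>1 / sqrt n\<close> the weight
  \<open>(1 + 1 / n) ^ n\<close> is at most \<open>e\<close>, here rounded up to 4, whose root is
  the factor 2. This makes \<open>1 / sqrt n\<close> the scale on which the norm controls
  values.\<close>

lemma hev_rotated_bound:
  assumes "n > 0" "cmod t = 1 / sqrt (real n)"
  shows "cmod (hev n F (a + t) (1 - cnj a * t)) \<le> 2 * hn n F * sw a ^ n"
proof (rule power2_le_imp_le)
  have "(1 + (cmod t)\<^sup>2) ^ n \<le> exp ((cmod t)\<^sup>2) ^ n"
    by (intro power_mono exp_ge_add_one_self) auto
  also have "\<dots> = exp (real n * (cmod t)\<^sup>2)" by (rule exp_of_nat_mult[symmetric])
  also have "real n * (cmod t)\<^sup>2 = 1" using assms by (simp add: power_divide)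
  also have "exp (1::real) \<le> 4" using exp_le by linarith
  finally have e: "(1 + (cmod t)\<^sup>2) ^ n \<le> 4" .
  have "(cmod (hev n F (a + t) (1 - cnj a * t)))\<^sup>2 \<le> nrm2 n F * ((sw a)\<^sup>2 * (1 + (cmod t)\<^sup>2)) ^ n"
    using hev_bound[of n F "a + t" "1 - cnj a * t"] unfolding rotated_norm .
  also have "\<dots> = (nrm2 n F * (sw a ^ n)\<^sup>2) * (1 + (cmod t)\<^sup>2) ^ n"
    by (simp add: power_mult_distrib power_mult[symmetric] mult.commute)
  also have "\<dots> \<le> (nrm2 n F * (sw a ^ n)\<^sup>2) * 4"
    by (intro mult_left_mono e) auto
  also have "\<dots> = (2 * hn n F * sw a ^ n)\<^sup>2" by (simp add: power_mult_distrib hn_sq)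
  finally show "(cmod (hev n F (a + t) (1 - cnj a * t)))\<^sup>2 \<le> (2 * hn n F * sw a ^ n)\<^sup>2" .
qed (simp add: less_imp_le)

subsection \<open>A Schwarz lemma\<close>

text \<open>A list, because each point will occur twice when values and derivatives are interpolated
  together.\<close>

definition lrootp :: "complex list \<Rightarrow> complex poly" where
  "lrootp A = prod_list (map (\<lambda>b. [:- b, 1:]) A)"

definition capped_dist :: "real \<Rightarrow> complex \<Rightarrow> complex \<Rightarrow> real" where
  "capped_dist r a b = max r (hdist a b)"

lemma lrootp_simps [simp]: "lrootp [] = 1" "lrootp (b # A) = [:- b, 1:] * lrootp A"
  by (simp_all add: lrootp_def)

lemma lrootp_append: "lrootp (A @ B) = lrootp A * lrootp B"
  by (simp add: lrootp_def)

lemma degree_lrootp: "degree (lrootp A) = length A" and lrootp_nz: "lrootp A \<noteq> 0"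
proof (induction A)
  case (Cons b A)
  { case 1 then show ?case using Cons by (simp add: degree_mult_eq del: mult_pCons_left) }
  { case 2 then show ?case using Cons by (simp del: mult_pCons_left) }
qed simp_all

lemma capped_dist_pos: "r > 0 \<Longrightarrow> capped_dist r a b > 0"
  by (simp add: capped_dist_def)

text \<open>Linear factors are removed one at a time, with the maximum principle at the end. A
  factor with its zero close to the centre is bounded below on the circle and divided out of the
  bound; one with its zero farther away is left inside the function, its value at the centre being
  large enough. Either way it costs a factor 4, whatever the mutual position of the zeros.\<close>

lemma schwarz_aux:
  assumes r: "0 < r" "r \<le> 1" and h: "h holomorphic_on UNIV"
    and B: "\<And>t. cmod t = r \<Longrightarrow> cmod (prod_list (map (\<lambda>b. (a - b) + t * (1 + cnj a * b)) A) * h t) \<le> B"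
  shows "cmod (h 0) * prod_list (map (\<lambda>b. sw a * sw b * capped_dist r a b) A) \<le> 4 ^ length A * B"
  using h B
proof (induction A arbitrary: h B)
  case Nil
  have "cmod (h 0) \<le> B"
  proof (rule maximum_modulus_frontier[of h "cball 0 r"])
    show "h holomorphic_on interior (cball 0 r)" "continuous_on (closure (cball 0 r)) h"
      using Nil(1) holomorphic_on_subset holomorphic_on_imp_continuous_on by blast+
    show "cmod (h z) \<le> B" if "z \<in> frontier (cball 0 r)" for z
      using Nil(2)[of z] that r by simp
  qed (use r in auto)
  then show ?case by simp
next
  case (Cons b A)
  define s where "s = sw a * sw b"
  have s: "s > 0" by (simp add: s_def)
  have d: "cmod (a - b) = s * hdist a b" by (simp add: hdist_def s_def)
  show ?case
  proof (cases "hdist a b \<le> r / 4")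
    \<comment> \<open>On the circle \<open>t * (1 + cnj a * b)\<close> has modulus at least
      \<open>3/4 * s * r\<close>, against at most \<open>s * r / 4\<close> for \<open>a - b\<close>;
      the difference exceeds the quarter of \<open>s * r\<close> that is needed.\<close>
    case True
    have m: "capped_dist r a b = r" using True r by (simp add: capped_dist_def)
    have "(hdist a b)\<^sup>2 \<le> (1/4)\<^sup>2" using True r by (intro power_mono) auto
    then have "(3/4)\<^sup>2 \<le> 1 - (hdist a b)\<^sup>2" by (simp add: power2_eq_square)
    then have "3/4 \<le> sqrt (1 - (hdist a b)\<^sup>2)" by (rule real_le_rsqrt)
    then have c: "cmod (1 + cnj a * b) \<ge> s * (3/4)"
      using s unfolding cmod_one_cnj s_def[symmetric] by (intro mult_left_mono) auto
    have low: "s * capped_dist r a b / 4 \<le> cmod ((a - b) + t * (1 + cnj a * b))" if t: "cmod t = r" for t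
    proof -
      have "r * (s * (3/4)) \<le> cmod (t * (1 + cnj a * b))"
        using c r by (simp add: norm_mult t mult_left_mono)
      then have "3/4 * (s * r) \<le> cmod (t * (1 + cnj a * b))" by (simp add: mult_ac)
      moreover have "cmod (a - b) \<le> s * (r / 4)" unfolding d using True s by (intro mult_left_mono) auto
      moreover have "cmod (t * (1 + cnj a * b)) - cmod (a - b) \<le> cmod ((a - b) + t * (1 + cnj a * b))"
        by (metis add.commute norm_diff_ineq)
      moreover have "s * r > 0" using s r by simp
      ultimately show ?thesis unfolding m by linarith
    qed
    define B' where "B' = 4 * B / (s * capped_dist r a b)"
    have sm: "s * capped_dist r a b > 0" using s capped_dist_pos[OF r(1)] by simp
    have "cmod (h 0) * prod_list (map (\<lambda>b. sw a * sw b * capped_dist r a b) A) \<le> 4 ^ length A * B'"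
    proof (rule Cons.IH[OF Cons.prems(1)])
      fix t assume t: "cmod t = r"
      let ?Q = "cmod (prod_list (map (\<lambda>b. (a - b) + t * (1 + cnj a * b)) A) * h t)"
      have "(s * capped_dist r a b / 4) * ?Q \<le> cmod ((a - b) + t * (1 + cnj a * b)) * ?Q"
        by (intro mult_right_mono low[OF t]) simp
      also have "\<dots> \<le> B" using Cons.prems(2)[OF t] by (simp add: norm_mult mult_ac)
      finally show "?Q \<le> B'" using sm by (simp add: B'_def field_simps)
    qed
    then have "s * capped_dist r a b * (cmod (h 0) * prod_list (map (\<lambda>b. sw a * sw b * capped_dist r a b) A)) \<le> s * capped_dist r a b * (4 ^ length A * B')"
      using sm by (intro mult_left_mono) auto
    also have "\<dots> = 4 ^ length (b # A) * B" using s capped_dist_pos[OF r(1), of a b] by (simp add: B'_def)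
    finally show ?thesis by (simp add: s_def mult_ac)
  next
    \<comment> \<open>The distance exceeds a quarter of \<open>r\<close>, so the capped distance is
      at most four times the distance and the factor may be absorbed into \<open>h'\<close>.\<close>
    case False
    have m: "capped_dist r a b \<le> 4 * hdist a b" using False r by (auto simp: capped_dist_def)
    define h' where "h' t = ((a - b) + t * (1 + cnj a * b)) * h t" for t
    have "cmod (h' 0) * prod_list (map (\<lambda>b. sw a * sw b * capped_dist r a b) A) \<le> 4 ^ length A * B"
    proof (rule Cons.IH)
      show "h' holomorphic_on UNIV" unfolding h'_def by (intro holomorphic_intros Cons.prems(1))
      show "cmod (prod_list (map (\<lambda>b. (a - b) + t * (1 + cnj a * b)) A) * h' t) \<le> B" if "cmod t = r" for t
        using Cons.prems(2)[OF that] by (simp add: h'_def mult_ac)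
    qed
    moreover have "prod_list (map (\<lambda>b. sw a * sw b * capped_dist r a b) A) \<ge> 0"
      using capped_dist_pos[OF r(1)] by (induction A) (auto simp: less_imp_le)
    moreover have "sw a * sw b * capped_dist r a b * cmod (h 0) \<le> 4 * cmod (h' 0)"
    proof -
      have "s * capped_dist r a b * cmod (h 0) \<le> s * (4 * hdist a b) * cmod (h 0)"
        using s m by (intro mult_right_mono mult_left_mono) auto
      then show ?thesis by (simp add: h'_def norm_mult d s_def mult_ac)
    qed
    ultimately have "sw a * sw b * capped_dist r a b * cmod (h 0) * prod_list (map (\<lambda>b. sw a * sw b * capped_dist r a b) A) \<le>
      4 * cmod (h' 0) * prod_list (map (\<lambda>b. sw a * sw b * capped_dist r a b) A)"
      by (intro mult_right_mono) auto
    also have "\<dots> \<le> 4 * (4 ^ length A * B)"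
      using \<open>cmod (h' 0) * prod_list (map (\<lambda>b. sw a * sw b * capped_dist r a b) A) \<le> 4 ^ length A * B\<close> by simp
    finally show ?thesis by (simp add: mult_ac)
  qed
qed

lemma hev_lrootp_mult:
  assumes "g = 0 \<or> degree g + length A \<le> n"
  shows "hev n (lrootp A * g) x y = prod_list (map (\<lambda>b. x - b * y) A) * hev (n - length A) g x y"
  using assms
proof (induction A arbitrary: n)
  case (Cons b A)
  show ?case
  proof (cases "g = 0")
    case True
    then show ?thesis by (simp add: hev_def)
  next
    case False
    then obtain n' where n: "n = Suc n'" "degree g + length A \<le> n'" using Cons.prems by (cases n) auto
    have "degree (lrootp A * g) \<le> n'"
      using n(2) False by (simp add: degree_mult_eq lrootp_nz degree_lrootp)
    then have "hev n ([:- b, 1:] * (lrootp A * g)) x y = (x - b * y) * hev n' (lrootp A * g) x y"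
      unfolding n(1) by (subst hev_linear) auto
    then show ?thesis using Cons.IH[of n'] n by (simp add: mult.assoc del: mult_pCons_left)
  qed
qed simp

text \<open>In the coordinate \<open>t\<close> of the rotation that moves 0 to \<open>a\<close>, the
  linear factor with root \<open>b\<close> becomes the affine function
  \<open>(a - b) + t * (1 + cnj a * b)\<close>.\<close>

lemma schwarz:
  assumes r: "0 < r" "r \<le> 1" and g: "g = 0 \<or> degree g + length A \<le> n"
    and B: "\<And>t. cmod t = r \<Longrightarrow> cmod (hev n (lrootp A * g) (a + t) (1 - cnj a * t)) \<le> B"
  shows "cmod (poly g a) * prod_list (map (\<lambda>b. sw a * sw b * capped_dist r a b) A) \<le> 4 ^ length A * B"
proof -
  let ?h = "\<lambda>t. hev (n - length A) g (a + t) (1 - cnj a * t)"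
  have "cmod (?h 0) * prod_list (map (\<lambda>b. sw a * sw b * capped_dist r a b) A) \<le> 4 ^ length A * B"
  proof (rule schwarz_aux[OF r])
    show "?h holomorphic_on UNIV" unfolding hev_def by (intro holomorphic_intros)
    show "cmod (prod_list (map (\<lambda>b. (a - b) + t * (1 + cnj a * b)) A) * ?h t) \<le> B" if "cmod t = r" for t
    proof -
      have eq: "map (\<lambda>b. (a + t) - b * (1 - cnj a * t)) A = map (\<lambda>b. (a - b) + t * (1 + cnj a * b)) A"
        by (auto simp: algebra_simps)
      show ?thesis using B[OF that] by (simp only: hev_lrootp_mult[OF g] eq)
    qed
  qed
  moreover have "?h 0 = poly g a"
    using g poly_eq_sum_le[of g "n - length A" a] by (cases "g = 0") (auto simp: hev_def)
  ultimately show ?thesis by simp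
qed

subsection \<open>Localised Newton polynomials\<close>

text \<open>The kernel at a rotated point expands in the rotated monomials \<open>E i\<close>.
  Pairing it with \<open>E j\<close> evaluates \<open>E j\<close> at that point, which gives a
  multiple of \<open>t ^ j\<close>; comparing coefficients of \<open>t ^ j\<close> yields the norm,
  a case of rotation invariance, without introducing the unitary group.\<close>

lemma nrm2_rotated_monomial:
  assumes "j \<le> n"
  shows "real (n choose j) * nrm2 n ([:- a, 1:] ^ j * [:1, cnj a:] ^ (n - j)) = ((sw a)\<^sup>2) ^ n"
proof -
  define E where "E j = [:- a, 1:] ^ j * [:1, cnj a:] ^ (n - j)" for j
  have hevE: "hev n (E j) (a + t) (1 - cnj a * t) = of_real ((sw a)\<^sup>2 ^ n) * t ^ j" if "j \<le> n" for t j
  proof -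
    have E: "E j = lrootp (replicate j a) * [:1, cnj a:] ^ (n - j)"
      by (simp add: E_def lrootp_def)
    have "hev n (E j) x y = (x - a * y) ^ j * (y + cnj a * x) ^ (n - j)" for x y
      unfolding E using that degree_linear_pow[of 1 "cnj a" "n - j"]
      by (subst hev_lrootp_mult) (auto simp: hev_linear_pow)
    moreover have "(a + t) - a * (1 - cnj a * t) = of_real ((sw a)\<^sup>2) * t"
      "(1 - cnj a * t) + cnj a * (a + t) = of_real ((sw a)\<^sup>2)"
      unfolding sw_sq of_real_add complex_norm_square by (simp_all add: algebra_simps)
    ultimately have "hev n (E j) (a + t) (1 - cnj a * t) = (of_real ((sw a)\<^sup>2) * t) ^ j * of_real ((sw a)\<^sup>2) ^ (n - j)"
      by simp
    also have "\<dots> = of_real ((sw a)\<^sup>2) ^ (j + (n - j)) * t ^ j"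
      by (simp only: power_mult_distrib power_add mult_ac)
    finally show ?thesis using that by simp
  qed
  have kE: "kerP n (a + t) (1 - cnj a * t) = (\<Sum>i\<le>n. smult (of_nat (n choose i) * cnj t ^ i) (E i))" for t
  proof -
    have "kerP n (a + t) (1 - cnj a * t) = (smult (cnj t) [:- a, 1:] + [:1, cnj a:]) ^ n"
      by (simp add: kerP_def add.commute mult.commute)
    also have "\<dots> = (\<Sum>i\<le>n. of_nat (n choose i) * smult (cnj t) [:- a, 1:] ^ i * [:1, cnj a:] ^ (n - i))"
      by (rule binomial_ring)
    also have "\<dots> = (\<Sum>i\<le>n. smult (of_nat (n choose i) * cnj t ^ i) (E i))"
    proof -
      have "of_nat m * smult c p ^ i * q = smult (of_nat m * c ^ i) (p ^ i * q)" for m c i and p q :: "complex poly"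
      proof -
        have "smult c p ^ i = smult (c ^ i) (p ^ i)" by (simp add: smult_power)
        then show ?thesis by (simp add: of_nat_poly mult_ac)
      qed
      then show ?thesis unfolding E_def by (intro sum.cong refl)
    qed
    finally show ?thesis .
  qed
  have "of_real ((sw a)\<^sup>2 ^ n) * t ^ j = (\<Sum>i\<le>n. of_nat (n choose i) * ip n (E j) (E i) * t ^ i)" for t
  proof -
    have "of_real ((sw a)\<^sup>2 ^ n) * t ^ j = ip n (E j) (kerP n (a + t) (1 - cnj a * t))"
      unfolding ip_kerP hevE[OF assms] ..
    also have "\<dots> = (\<Sum>i\<le>n. of_nat (n choose i) * ip n (E j) (E i) * t ^ i)"
    proof -
      have s: "ip n F (sum G A) = (\<Sum>i\<in>A. ip n F (G i))" if "finite A" for F A and G :: "nat \<Rightarrow> complex poly"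
        using that by (induction A) (auto simp: ip_add_right)
      show ?thesis unfolding kE by (subst s) (auto simp: ip_smult_right intro!: sum.cong)
    qed
    finally show ?thesis .
  qed
  then have "poly (monom (of_real ((sw a)\<^sup>2 ^ n)) j) = poly (\<Sum>i\<le>n. monom (of_nat (n choose i) * ip n (E j) (E i)) i)"
    by (simp add: fun_eq_iff poly_monom poly_sum)
  then have "monom (of_real ((sw a)\<^sup>2 ^ n)) j = (\<Sum>i\<le>n. monom (of_nat (n choose i) * ip n (E j) (E i)) i)"
    by (simp only: poly_eq_poly_eq_iff)
  from arg_cong[OF this, of "\<lambda>p. coeff p j"] assms
  have "of_real ((sw a)\<^sup>2 ^ n) = of_nat (n choose j) * ip n (E j) (E j)"
    by (simp add: coeff_sum_monom)
  then have "complex_of_real (((sw a)\<^sup>2) ^ n) = complex_of_real (real (n choose j) * nrm2 n (E j))"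
    by (simp add: ip_self)
  then show ?thesis unfolding of_real_eq_iff E_def by simp
qed

text \<open>By \<open>n choose j \<ge> (n / j) ^ j\<close> the norm decreases like
  \<open>n ^ (- j / 2)\<close>. The bound \<open>M\<close> replaces \<open>j\<close> so that a
  single ratio serves for all exponents.\<close>

lemma hn_rotated_monomial:
  assumes "j \<le> n" "j \<le> M"
  shows "hn n ([:- a, 1:] ^ j * [:1, cnj a:] ^ (n - j)) \<le> sw a ^ n * (sqrt (real M) / sqrt (real n)) ^ j"
proof (cases "j = 0")
  case True
  then have "nrm2 n ([:- a, 1:] ^ j * [:1, cnj a:] ^ (n - j)) = (sw a ^ n)\<^sup>2"
    using nrm2_rotated_monomial[OF assms(1), of a] by (simp add: power_mult[symmetric] mult.commute)
  then show ?thesis using True by (simp add: hn_def less_imp_le)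
next
  case False
  then have n: "n > 0" "M > 0" using assms by auto
  let ?E = "[:- a, 1:] ^ j * [:1, cnj a:] ^ (n - j)"
  have "(real n / real M) ^ j \<le> (real n / real j) ^ j"
    using False assms by (intro power_mono divide_left_mono) auto
  also have "\<dots> \<le> real (n choose j)"
    using binomial_ge_n_over_k_pow_k[OF assms(1), where 'a=real] by simp
  finally have "(real n / real M) ^ j * nrm2 n ?E \<le> ((sw a)\<^sup>2) ^ n"
    using nrm2_rotated_monomial[OF assms(1), of a] mult_right_mono[OF _ nrm2_nonneg[of n ?E]] by metis
  then have "nrm2 n ?E \<le> ((sw a)\<^sup>2) ^ n * (real M / real n) ^ j"
    using n by (simp add: power_divide field_simps)
  also have "\<dots> = (sw a ^ n * (sqrt (real M) / sqrt (real n)) ^ j)\<^sup>2"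
    by (simp add: power_mult_distrib power_mult[symmetric] mult.commute[of _ 2])
      (simp add: power_mult power_divide)
  finally show ?thesis unfolding hn_def by (intro real_le_lsqrt) (auto simp: less_imp_le)
qed

lemma linear_in_rotated_basis:
  "[:- b, 1:] = smult ((a - b) / of_real ((sw a)\<^sup>2)) [:1, cnj a:] + smult ((1 + cnj a * b) / of_real ((sw a)\<^sup>2)) [:- a, 1:]"
proof -
  have nz: "complex_of_real ((sw a)\<^sup>2) \<noteq> 0" by simp
  have s: "complex_of_real ((sw a)\<^sup>2) = 1 + a * cnj a" unfolding sw_sq of_real_add complex_norm_square by simp
  define S where "S = complex_of_real ((sw a)\<^sup>2)"
  have "(a - b) + (1 + cnj a * b) * (- a) = - b * S" "(a - b) * cnj a + (1 + cnj a * b) = S"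
    unfolding S_def s by (simp_all add: algebra_simps)
  then have e: "((a - b) + (1 + cnj a * b) * (- a)) / S = - b" "((a - b) * cnj a + (1 + cnj a * b)) / S = 1"
    using nz[folded S_def] by (simp_all del: mult_minus_right)
  define \<alpha> where "\<alpha> = (a - b) / S"
  define \<beta> where "\<beta> = (1 + cnj a * b) / S"
  have "\<alpha> + \<beta> * (- a) = ((a - b) + (1 + cnj a * b) * (- a)) / S" "\<alpha> * cnj a + \<beta> = ((a - b) * cnj a + (1 + cnj a * b)) / S"
    by (simp_all only: \<alpha>_def \<beta>_def times_divide_eq_left add_divide_distrib[symmetric])
  then have "\<alpha> - \<beta> * a = - b" "\<alpha> * cnj a + \<beta> = 1" unfolding e by simp_all
  then show ?thesis unfolding S_def[symmetric] \<alpha>_def[symmetric] \<beta>_def[symmetric] by (simp add: mult.commute)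
qed

text \<open>Up to \<open>sw b / sw a\<close>, each linear factor combines
  \<open>[:1, cnj a:]\<close> with a coefficient of size \<open>hdist a b\<close> and
  \<open>[:- a, 1:]\<close> with one of size at most 1. The first leaves the exponent
  \<open>i\<close> alone, the second raises it at the price \<open>R\<close>, so that factor by
  factor \<open>hdist a b + R\<close> accumulates.\<close>

lemma hn_lrootp_rotated:
  assumes "length A + i \<le> M" "length A + i + N = n"
  defines "R \<equiv> sqrt (real M) / sqrt (real n)"
  shows "hn n (lrootp A * [:- a, 1:] ^ i * [:1, cnj a:] ^ N) \<le>
    sw a ^ n * prod_list (map (\<lambda>b. sw b / sw a * (hdist a b + R)) A) * R ^ i"
  using assms(1,2)
proof (induction A arbitrary: i N)
  case Nil
  then have "N = n - i" by simp
  then show ?case using Nil hn_rotated_monomial[of i n M a] by (simp add: R_def)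
next
  case (Cons b A)
  let ?f = "[:- a, 1:]" and ?e = "[:1, cnj a:]" and ?P = "prod_list (map (\<lambda>b. sw b / sw a * (hdist a b + R)) A)"
  define \<alpha> where "\<alpha> = (a - b) / of_real ((sw a)\<^sup>2)"
  define \<beta> where "\<beta> = (1 + cnj a * b) / of_real ((sw a)\<^sup>2)"
  have R: "R \<ge> 0" by (simp add: R_def)
  have P: "?P \<ge> 0" using R by (induction A) (auto simp: less_imp_le intro!: mult_nonneg_nonneg)
  have a: "cmod \<alpha> = sw b / sw a * hdist a b"
    by (simp add: \<alpha>_def norm_divide norm_power norm_mult hdist_def power2_eq_square less_imp_le)
  have "cmod \<beta> = sw b / sw a * sqrt (1 - (hdist a b)\<^sup>2)"
    unfolding \<beta>_def norm_divide cmod_one_cnj by (simp add: norm_power norm_mult power2_eq_square less_imp_le)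
  also have "\<dots> \<le> sw b / sw a" by (intro mult_left_le) (auto simp: less_imp_le)
  finally have b: "cmod \<beta> \<le> sw b / sw a" .
  have lin: "[:- b, 1:] = smult \<alpha> ?e + smult \<beta> ?f" unfolding \<alpha>_def \<beta>_def by (rule linear_in_rotated_basis)
  have eq: "lrootp (b # A) * ?f ^ i * ?e ^ N = smult \<alpha> (lrootp A * ?f ^ i * ?e ^ Suc N) + smult \<beta> (lrootp A * ?f ^ Suc i * ?e ^ N)"
    unfolding lrootp_simps lin power_Suc
    by (simp only: distrib_right distrib_left mult_smult_left mult_smult_right smult_add_right mult_ac)
  have "hn n (lrootp (b # A) * ?f ^ i * ?e ^ N) \<le> cmod \<alpha> * hn n (lrootp A * ?f ^ i * ?e ^ Suc N) + cmod \<beta> * hn n (lrootp A * ?f ^ Suc i * ?e ^ N)"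
    unfolding eq by (rule order_trans[OF hn_triangle]) (simp only: hn_smult order_refl)
  also have "\<dots> \<le> cmod \<alpha> * (sw a ^ n * ?P * R ^ i) + (sw b / sw a) * (sw a ^ n * ?P * R ^ Suc i)"
    using Cons.prems by (intro add_mono mult_mono Cons.IH b order_refl) (auto simp: less_imp_le simp del: power_Suc mult_pCons_left)
  also have "\<dots> = sw a ^ n * prod_list (map (\<lambda>b. sw b / sw a * (hdist a b + R)) (b # A)) * R ^ i"
    unfolding a by (simp add: algebra_simps add_divide_distrib)
  finally show ?case .
qed

text \<open>The power of \<open>[:1, cnj a:]\<close> is peaked at \<open>a\<close> on the scale \<open>1 / sqrt n\<close>. Distances from \<open>a\<close> are
  capped from below at that scale, so that the norm stays bounded when points collide.\<close>

definition newton :: "nat \<Rightarrow> complex list \<Rightarrow> complex \<Rightarrow> complex poly" where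
  "newton n A a = smult (of_real (1 / (prod_list (map (\<lambda>b. sw b * capped_dist (1 / sqrt (real n)) a b) A) * sw a ^ (n - length A))))
     (lrootp A * [:1, cnj a:] ^ (n - length A))"

text \<open>Since \<open>R\<close> is \<open>sqrt (length A)\<close> times the cap,
  \<open>hdist a b + R\<close> is at most \<open>1 + sqrt (length A)\<close> times the capped
  distance by which \<open>newton\<close> is normalised.\<close>

lemma hn_newton:
  assumes "length A \<le> n" "n > 0"
  shows "hn n (newton n A a) \<le> (1 + sqrt (real (length A))) ^ length A"
proof -
  define r where "r = 1 / sqrt (real n)"
  have r: "r > 0" using assms by (simp add: r_def)
  define R where "R = sqrt (real (length A)) / sqrt (real n)"
  define D where "D = prod_list (map (\<lambda>b. sw b * capped_dist r a b) A) * sw a ^ (n - length A)"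
  have mp: "capped_dist r a b > 0" for b by (rule capped_dist_pos[OF r])
  have Dp: "prod_list (map (\<lambda>b. sw b * capped_dist r a b) A) > 0" using mp by (induction A) auto
  then have D: "D > 0" by (simp add: D_def)
  have "hn n (lrootp A * [:- a, 1:] ^ 0 * [:1, cnj a:] ^ (n - length A)) \<le>
    sw a ^ n * prod_list (map (\<lambda>b. sw b / sw a * (hdist a b + R)) A) * R ^ 0"
    unfolding R_def by (rule hn_lrootp_rotated) (use assms in auto)
  also have "\<dots> \<le> sw a ^ n * ((1 + sqrt (real (length A))) ^ length A * (prod_list (map (\<lambda>b. sw b * capped_dist r a b) A) / sw a ^ length A))"
  proof -
    have fac: "sw b / sw a * (hdist a b + R) \<le> (1 + sqrt (real (length A))) * (sw b * capped_dist r a b / sw a)" for b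
    proof -
      have "R = sqrt (real (length A)) * r" by (simp add: R_def r_def)
      also have "\<dots> \<le> sqrt (real (length A)) * capped_dist r a b" by (intro mult_left_mono) (auto simp: capped_dist_def)
      finally have "hdist a b + R \<le> (1 + sqrt (real (length A))) * capped_dist r a b"
        by (simp add: distrib_right capped_dist_def add_mono)
      then have "sw b / sw a * (hdist a b + R) \<le> sw b / sw a * ((1 + sqrt (real (length A))) * capped_dist r a b)"
        by (intro mult_left_mono) (auto simp: less_imp_le)
      then show ?thesis by (simp add: mult_ac)
    qed
    have R0: "R \<ge> 0" by (simp add: R_def)
    have gen: "prod_list (map (\<lambda>b. sw b / sw a * (hdist a b + R)) B) \<le>
      (1 + sqrt (real (length A))) ^ length B * (prod_list (map (\<lambda>b. sw b * capped_dist r a b) B) / sw a ^ length B)" for B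
    proof (induction B)
      case (Cons b B)
      have "prod_list (map (\<lambda>b. sw b * capped_dist r a b) B) \<ge> 0" using mp by (induction B) (auto simp: less_imp_le)
      then have "prod_list (map (\<lambda>b. sw b / sw a * (hdist a b + R)) (b # B)) \<le>
        ((1 + sqrt (real (length A))) * (sw b * capped_dist r a b / sw a)) * ((1 + sqrt (real (length A))) ^ length B * (prod_list (map (\<lambda>b. sw b * capped_dist r a b) B) / sw a ^ length B))"
        unfolding list.map prod_list.Cons
        by (intro mult_mono fac Cons.IH) (use mp R0 in \<open>auto simp: less_imp_le intro!: mult_nonneg_nonneg divide_nonneg_nonneg prod_list_nonneg add_nonneg_nonneg\<close>)
      then show ?case by (simp add: mult_ac)
    qed simp
    show ?thesis unfolding power_0 mult_1_right by (intro mult_left_mono gen) (simp add: less_imp_le)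
  qed
  also have "\<dots> = (1 + sqrt (real (length A))) ^ length A * D"
  proof -
    have "sw a ^ n = sw a ^ (n - length A) * sw a ^ length A"
      using assms by (simp add: power_add[symmetric])
    then show ?thesis by (simp add: D_def)
  qed
  finally have "hn n (lrootp A * [:1, cnj a:] ^ (n - length A)) \<le> (1 + sqrt (real (length A))) ^ length A * D" by simp
  then show ?thesis
    unfolding newton_def hn_smult r_def[symmetric] D_def[symmetric] using D
    by (simp add: norm_divide divide_le_eq)
qed

lemma degree_newton:
  assumes "length A \<le> n"
  shows "degree (newton n A a) \<le> n"
proof -
  have "degree (lrootp A * [:1, cnj a:] ^ (n - length A)) \<le> length A + (n - length A)"
    using degree_mult_le[of "lrootp A" "[:1, cnj a:] ^ (n - length A)"] degree_linear_pow[of 1 "cnj a" "n - length A"]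
    by (simp add: degree_lrootp)
  then show ?thesis unfolding newton_def using assms degree_smult_le order_trans by fastforce
qed

subsection \<open>Interpolation with small norm\<close>

text \<open>One step of \<open>interpolation\<close> adds a Newton polynomial:
  \<open>(1 + sqrt m) ^ m\<close> bounds its norm, \<open>4 ^ m\<close> is the Schwarz lemma, and
  \<open>1 + 2 * interp_const m\<close> bounds the remainder on the circle, from the polynomial
  itself and twice the norm of the interpolant found so far.\<close>

fun interp_const :: "nat \<Rightarrow> real" where
  "interp_const 0 = 1"
| "interp_const (Suc m) = interp_const m + (1 + sqrt (real m)) ^ m * (4 ^ m * (1 + 2 * interp_const m))"

lemma interp_const_ge_1: "interp_const m \<ge> 1"
proof (induction m)
  case (Suc m)
  then have "0 \<le> (1 + sqrt (real m)) ^ m * (4 ^ m * (1 + 2 * interp_const m))"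
    by (intro mult_nonneg_nonneg) auto
  with Suc show ?case unfolding interp_const.simps by linarith
qed simp

lemma poly_newton_center:
  assumes "length A \<le> n"
  shows "poly (newton n A a) a = poly (lrootp A) a *
    of_real (sw a ^ (n - length A) / prod_list (map (\<lambda>b. sw b * capped_dist (1 / sqrt (real n)) a b) A))"
proof -
  define P where "P = prod_list (map (\<lambda>b. sw b * capped_dist (1 / sqrt (real n)) a b) A)"
  have "1 + a * cnj a = of_real ((sw a)\<^sup>2)"
    unfolding sw_sq of_real_add complex_norm_square by simp
  then have "poly (newton n A a) a = of_real (1 / (P * sw a ^ (n - length A))) * (poly (lrootp A) a * of_real ((sw a)\<^sup>2) ^ (n - length A))"
    by (simp add: newton_def P_def)
  also have "\<dots> = poly (lrootp A) a * of_real (1 / (P * sw a ^ (n - length A)) * ((sw a)\<^sup>2) ^ (n - length A))"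
    by simp
  also have "1 / (P * sw a ^ (n - length A)) * ((sw a)\<^sup>2) ^ (n - length A) = sw a ^ (n - length A) / P"
    by (simp add: power2_eq_square power_mult_distrib)
  finally show ?thesis by (simp add: P_def)
qed

text \<open>The Newton coefficient at the next node \<open>a\<close> is determined by the value of
  the quotient \<open>g\<close> there, and the Schwarz lemma bounds this value by
  \<open>F - h\<close> on a circle about \<open>a\<close>, where both terms are under control. No
  divided difference is estimated through a distance of nodes, so nodes may collide or be
  repeated.\<close>

lemma interpolation:
  assumes n: "n > 0" and "length A \<le> n" and F: "degree F \<le> n" and B: "B \<ge> 0"
    and bnd: "\<And>a t. a \<in> set A \<Longrightarrow> cmod t = 1 / sqrt (real n) \<Longrightarrow> cmod (hev n F (a + t) (1 - cnj a * t)) \<le> B * sw a ^ n"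
  shows "\<exists>h g. F = h + lrootp A * g \<and> degree h \<le> n \<and> (g = 0 \<or> degree g + length A \<le> n) \<and>
    hn n h \<le> interp_const (length A) * B"
  using assms(2) bnd
proof (induction A)
  case Nil
  show ?case using F B by (intro exI[of _ 0] exI[of _ F]) (auto simp: hn_def)
next
  case (Cons a A)
  define r where "r = 1 / sqrt (real n)"
  have r: "0 < r" "r \<le> 1" using n by (auto simp: r_def)
  let ?m = "length A"
  define C where "C = interp_const ?m"
  have m: "Suc ?m \<le> n" using Cons.prems by simp
  obtain h g where hg: "F = h + lrootp A * g" "degree h \<le> n" "g = 0 \<or> degree g + ?m \<le> n" "hn n h \<le> C * B"
    using Cons.IH Cons.prems unfolding C_def by force
  define P where "P = prod_list (map (\<lambda>b. sw b * capped_dist r a b) A)"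
  have P: "P > 0" unfolding P_def using capped_dist_pos[OF r(1)] by (induction A) auto
  have Ps: "prod_list (map (\<lambda>b. sw a * sw b * capped_dist r a b) A) = sw a ^ ?m * P"
    unfolding P_def by (induction A) (auto simp: mult_ac)
  have "cmod (poly g a) * prod_list (map (\<lambda>b. sw a * sw b * capped_dist r a b) A) \<le> 4 ^ ?m * ((1 + 2 * C) * B * sw a ^ n)"
  proof (rule schwarz[OF r hg(3)])
    fix t assume t: "cmod t = r"
    have "lrootp A * g = F - h" using hg(1) by simp
    then have "cmod (hev n (lrootp A * g) (a + t) (1 - cnj a * t)) \<le>
      cmod (hev n F (a + t) (1 - cnj a * t)) + cmod (hev n h (a + t) (1 - cnj a * t))"
      by (simp add: hev_diff norm_triangle_ineq4)
    also have "\<dots> \<le> B * sw a ^ n + 2 * (C * B) * sw a ^ n"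
    proof (intro add_mono)
      show "cmod (hev n F (a + t) (1 - cnj a * t)) \<le> B * sw a ^ n" using Cons.prems(2)[of a t] t by (simp add: r_def)
      have "cmod (hev n h (a + t) (1 - cnj a * t)) \<le> 2 * hn n h * sw a ^ n"
        using hev_rotated_bound[OF n] t by (simp add: r_def)
      also have "\<dots> \<le> 2 * (C * B) * sw a ^ n"
        using hg(4) by (intro mult_right_mono mult_left_mono) (auto simp: less_imp_le)
      finally show "cmod (hev n h (a + t) (1 - cnj a * t)) \<le> 2 * (C * B) * sw a ^ n" .
    qed
    also have "\<dots> = (1 + 2 * C) * B * sw a ^ n" by (simp add: algebra_simps)
    finally show "cmod (hev n (lrootp A * g) (a + t) (1 - cnj a * t)) \<le> (1 + 2 * C) * B * sw a ^ n" .
  qed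
  then have gb: "cmod (poly g a) * (sw a ^ ?m * P) \<le> 4 ^ ?m * ((1 + 2 * C) * B) * sw a ^ n"
    unfolding Ps by (simp only: mult.assoc)
  define M where "M = smult (of_real (1 / (P * sw a ^ (n - ?m)))) ([:1, cnj a:] ^ (n - ?m))"
  have N: "newton n A a = lrootp A * M" by (simp add: newton_def M_def P_def r_def)
  have Ma: "poly M a = of_real (sw a ^ (n - ?m) / P)"
  proof -
    have "1 + a * cnj a = of_real ((sw a)\<^sup>2)" unfolding sw_sq of_real_add complex_norm_square by simp
    then have "poly M a = of_real (1 / (P * sw a ^ (n - ?m)) * ((sw a)\<^sup>2) ^ (n - ?m))"
      by (simp add: M_def)
    also have "1 / (P * sw a ^ (n - ?m)) * ((sw a)\<^sup>2) ^ (n - ?m) = sw a ^ (n - ?m) / P"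
      by (simp add: power2_eq_square power_mult_distrib)
    finally show ?thesis .
  qed
  \<comment> \<open>This choice makes \<open>g - smult c M\<close> vanish at \<open>a\<close>, so
    the next linear factor splits off.\<close>
  define c where "c = poly g a / poly M a"
  have swn: "sw a ^ n = sw a ^ (n - ?m) * sw a ^ ?m" using m by (simp add: power_add[symmetric])
  have cc: "cmod c = cmod (poly g a) * P / sw a ^ (n - ?m)"
    using P by (simp add: c_def Ma norm_divide norm_power norm_mult less_imp_le)
  have "cmod c * sw a ^ n = cmod (poly g a) * (sw a ^ ?m * P)" unfolding cc swn by simp
  also have "\<dots> \<le> 4 ^ ?m * ((1 + 2 * C) * B) * sw a ^ n" by (rule gb)
  finally have cb: "cmod c \<le> 4 ^ ?m * ((1 + 2 * C) * B)" by simp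
  have "poly (g - smult c M) a = 0" using P by (simp add: c_def Ma)
  then have "[:- a, 1:] dvd g - smult c M" by (simp only: poly_eq_0_iff_dvd)
  then obtain g' where g': "g - smult c M = [:- a, 1:] * g'" by (elim dvdE)
  have dM: "degree (smult c M) \<le> n - ?m"
    unfolding M_def using degree_linear_pow[of 1 "cnj a" "n - ?m"] by (meson degree_smult_le order_trans)
  have dg': "g' = 0 \<or> degree g' + length (a # A) \<le> n"
  proof (cases "g' = 0")
    case False
    have "degree g \<le> n - ?m" using hg(3) by auto
    then have "degree (g - smult c M) \<le> n - ?m" using dM by (rule degree_diff_le)
    moreover have "degree ([:- a, 1:] * g') = 1 + degree g'" using False by (subst degree_mult_eq) auto
    ultimately have "1 + degree g' \<le> n - ?m" unfolding g' by (simp only:)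
    then have "degree g' + length (a # A) \<le> n" using m by (simp only: list.size)
    then show ?thesis by simp
  qed simp
  define h' where "h' = h + smult c (newton n A a)"
  have "F = h' + lrootp A * (g - smult c M)"
    unfolding h'_def N hg(1) by (simp add: right_diff_distrib)
  then have "F = h' + lrootp (a # A) * g'" unfolding g' lrootp_simps by (simp only: mult_ac)
  moreover have "degree h' \<le> n"
    unfolding h'_def using hg(2) degree_newton[of A n a] m degree_smult_le order_trans
    by (intro degree_add_le) (auto intro: order_trans[OF degree_smult_le])
  moreover have "hn n h' \<le> interp_const (length (a # A)) * B"
  proof -
    have "hn n h' \<le> hn n h + cmod c * hn n (newton n A a)"
      unfolding h'_def by (rule order_trans[OF hn_triangle]) (simp add: hn_smult)
    also have "\<dots> \<le> C * B + (4 ^ ?m * ((1 + 2 * C) * B)) * (1 + sqrt (real ?m)) ^ ?m"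
      using m n B interp_const_ge_1[of ?m] by (intro add_mono hg(4) mult_mono cb hn_newton) (auto simp: C_def)
    also have "\<dots> = interp_const (length (a # A)) * B" by (simp add: C_def algebra_simps)
    finally show ?thesis .
  qed
  ultimately show ?case using dg' by blast
qed

subsection \<open>Almost orthogonality of distant jets\<close>

lemma lrootp_map: "lrootp (map z [0..<k]) = rootp k z"
  by (induction k) (auto simp: lrootp_append rootp_Suc mult.commute rootp_def lrootp_def)

text \<open>The element \<open>u\<close> sees only the jets at the points. With each point listed
  twice, the interpolant \<open>h\<close> has the jets of \<open>F\<close>, and the rest is
  divisible by the squared root polynomial, hence orthogonal to \<open>u\<close>.\<close>

lemma ip_kers_bound:
  assumes n: "n > 0" "2 * p \<le> n" and u: "u \<in> kers n p x" and F: "degree F \<le> n" and B: "B \<ge> 0"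
    and bnd: "\<And>i t. i < p \<Longrightarrow> cmod t = 1 / sqrt (real n) \<Longrightarrow>
      cmod (hev n F (x i + t) (1 - cnj (x i) * t)) \<le> B * sw (x i) ^ n"
  shows "cmod (ip n F u) \<le> interp_const (2 * p) * B * hn n u"
proof -
  define A where "A = map x [0..<p] @ map x [0..<p]"
  have lA: "length A = 2 * p" and rA: "lrootp A = rootp p x * rootp p x"
    by (simp_all add: A_def lrootp_append lrootp_map)
  have "\<exists>h g. F = h + lrootp A * g \<and> degree h \<le> n \<and> (g = 0 \<or> degree g + length A \<le> n) \<and> hn n h \<le> interp_const (length A) * B"
    by (rule interpolation[OF n(1) _ F B]) (use n bnd in \<open>auto simp: lA, auto simp: A_def\<close>)
  then obtain h g where hg: "F = h + rootp p x * rootp p x * g" "g = 0 \<or> degree g + 2 * p \<le> n" "hn n h \<le> interp_const (2 * p) * B"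
    unfolding lA rA by blast
  have "degree (rootp p x * rootp p x * g) \<le> n"
    using hg(2) degree_mult_le[of "rootp p x * rootp p x" g] by (cases "g = 0") (auto simp: degree_mult_eq rootp_nz degree_rootp)
  then have "ip n (rootp p x * rootp p x * g) u = 0"
    by (rule kers_orth[OF u]) (auto simp: poly_rootp_at pderiv_mult)
  then have "cmod (ip n F u) = cmod (ip n h u)" unfolding hg(1) ip_add_left by simp
  also have "\<dots> \<le> hn n h * hn n u" by (rule ip_le_hn)
  also have "\<dots> \<le> interp_const (2 * p) * B * hn n u" by (intro mult_right_mono hg(3)) simp
  finally show ?thesis .
qed

text \<open>The inner product of homogeneous points near \<open>a\<close> and \<open>b\<close>.
  Without \<open>t\<close> and \<open>t'\<close> its normalised modulus is
  \<open>sqrt (1 - \<sigma>\<^sup>2) \<le> 1 - \<sigma>\<^sup>2 / 2\<close>; half of this gain,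
  \<open>\<sigma>\<^sup>2 / 4\<close>, absorbs the cross terms of size
  \<open>2 * r * \<sigma>\<close>.\<close>

lemma rotated_inner_bound:
  assumes t: "cmod t = r" "cmod t' = r" and d: "0 \<le> \<delta>" "\<delta> \<le> hdist a b"
  shows "cmod (cnj (1 - cnj b * t') * (1 - cnj a * t) + cnj (b + t') * (a + t)) \<le>
    sw a * sw b * exp (5 * r\<^sup>2 - \<delta>\<^sup>2 / 4)"
proof -
  define \<sigma> where "\<sigma> = hdist a b"
  define s where "s = sw a * sw b"
  have s: "s > 0" by (simp add: s_def)
  have \<sigma>: "0 \<le> \<sigma>" "\<sigma> \<le> 1" using hdist_le_1[of a b] by (auto simp: \<sigma>_def)
  have r: "r \<ge> 0" using t(1) norm_ge_zero[of t] by linarith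
  have d1: "cmod (a - b) = s * \<sigma>" by (simp add: \<sigma>_def s_def hdist_def)
  have d2: "cmod (cnj b - cnj a) = s * \<sigma>" unfolding d1[symmetric] complex_cnj_diff[symmetric] complex_mod_cnj by (rule norm_minus_commute)
  have d3: "cmod (1 + cnj a * b) = s * sqrt (1 - \<sigma>\<^sup>2)" by (simp add: cmod_one_cnj s_def \<sigma>_def)
  have d4: "cmod (1 + a * cnj b) = s * sqrt (1 - \<sigma>\<^sup>2)"
    using complex_mod_cnj[of "1 + cnj a * b"] d3 by simp
  have "\<sigma>\<^sup>2 \<le> 1" using \<sigma> by (simp add: power_le_one)
  then have sq: "sqrt (1 - \<sigma>\<^sup>2) \<le> 1 - \<sigma>\<^sup>2 / 2"
    by (intro real_le_lsqrt) (auto simp: power2_diff)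
  have sq1: "sqrt (1 - \<sigma>\<^sup>2) \<le> 1" by simp
  have "cnj (1 - cnj b * t') * (1 - cnj a * t) + cnj (b + t') * (a + t) =
    (1 + a * cnj b) + t * (cnj b - cnj a) + cnj t' * (a - b) + t * cnj t' * (1 + cnj a * b)"
    by (simp add: algebra_simps)
  also have "cmod \<dots> \<le> cmod (1 + a * cnj b) + cmod (t * (cnj b - cnj a)) + cmod (cnj t' * (a - b)) + cmod (t * cnj t' * (1 + cnj a * b))"
    by (intro norm_triangle_le add_mono order_refl norm_triangle_ineq)
  also have "\<dots> = s * (sqrt (1 - \<sigma>\<^sup>2) + 2 * r * \<sigma> + r\<^sup>2 * sqrt (1 - \<sigma>\<^sup>2))"
    unfolding norm_mult d1 d2 d3 d4 complex_mod_cnj t by (simp add: algebra_simps power2_eq_square)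
  also have "\<dots> \<le> s * ((1 - \<sigma>\<^sup>2 / 2) + (\<sigma>\<^sup>2 / 4 + 4 * r\<^sup>2) + r\<^sup>2 * 1)"
  proof (intro mult_left_mono add_mono sq sq1)
    have "0 \<le> (\<sigma> / 2 - 2 * r)\<^sup>2" by simp
    then show "2 * r * \<sigma> \<le> \<sigma>\<^sup>2 / 4 + 4 * r\<^sup>2" by (simp add: power2_eq_square algebra_simps)
  qed (use s in auto)
  also have "\<dots> = s * (1 + (5 * r\<^sup>2 - \<sigma>\<^sup>2 / 4))" by (simp add: algebra_simps)
  also have "\<dots> \<le> s * exp (5 * r\<^sup>2 - \<sigma>\<^sup>2 / 4)" using s by (intro mult_left_mono exp_ge_add_one_self) auto
  also have "\<dots> \<le> s * exp (5 * r\<^sup>2 - \<delta>\<^sup>2 / 4)"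
    using s d power_mono[OF d(2) d(1), of 2] by (intro mult_left_mono) (auto simp: \<sigma>_def)
  finally show ?thesis by (simp add: s_def)
qed

text \<open>\<open>ip_kers_bound\<close> is applied twice: to a kernel at a point near
  \<open>y j\<close>, which shows that \<open>u\<close> is small near all \<open>y j\<close>, and
  then to \<open>u\<close> itself paired with \<open>v\<close>. The 5 in the exponent is
  \<open>5 * n * r^2\<close> on the circle of radius \<open>r = 1 / sqrt n\<close>.\<close>

lemma near_orthogonal:
  assumes n: "n > 0" "2 * p \<le> n" "2 * q \<le> n" and u: "u \<in> kers n p x" and v: "v \<in> kers n q y"
    and d: "0 \<le> \<delta>" "\<And>i j. i < p \<Longrightarrow> j < q \<Longrightarrow> \<delta> \<le> hdist (x i) (y j)"
  shows "cmod (ip n u v) \<le> interp_const (2 * p) * interp_const (2 * q) * exp (5 - real n * \<delta>\<^sup>2 / 4) * hn n u * hn n v"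
proof -
  define r where "r = 1 / sqrt (real n)"
  define E where "E = exp (5 - real n * \<delta>\<^sup>2 / 4)"
  have r2: "real n * (5 * r\<^sup>2 - \<delta>\<^sup>2 / 4) = 5 - real n * \<delta>\<^sup>2 / 4"
    using n by (simp add: r_def power_divide algebra_simps)
  have En: "exp (5 * r\<^sup>2 - \<delta>\<^sup>2 / 4) ^ n = E"
    unfolding E_def r2[symmetric] by (rule exp_of_nat_mult[symmetric])
  have u_dec: "cmod (hev n u (y j + t') (1 - cnj (y j) * t')) \<le> interp_const (2 * p) * (sw (y j) ^ n * E) * hn n u"
    if j: "j < q" and t': "cmod t' = r" for j t'
  proof -
    let ?X = "y j + t'" and ?Y = "1 - cnj (y j) * t'"
    have "cmod (ip n (kerP n ?X ?Y) u) \<le> interp_const (2 * p) * (sw (y j) ^ n * E) * hn n u"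
    proof (rule ip_kers_bound[OF n(1,2) u degree_kerP])
      fix i t assume i: "i < p" and t: "cmod t = 1 / sqrt (real n)"
      have "cmod (cnj ?Y * (1 - cnj (x i) * t) + cnj ?X * (x i + t)) \<le> sw (x i) * sw (y j) * exp (5 * r\<^sup>2 - \<delta>\<^sup>2 / 4)"
        by (rule rotated_inner_bound[OF _ t' d(1) d(2)[OF i j]]) (use t in \<open>simp add: r_def\<close>)
      then have "cmod (cnj ?Y * (1 - cnj (x i) * t) + cnj ?X * (x i + t)) ^ n \<le> (sw (x i) * sw (y j) * exp (5 * r\<^sup>2 - \<delta>\<^sup>2 / 4)) ^ n"
        by (intro power_mono) auto
      also have "\<dots> = sw (y j) ^ n * E * sw (x i) ^ n" unfolding En[symmetric] by (simp add: power_mult_distrib)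
      finally show "cmod (hev n (kerP n ?X ?Y) (x i + t) (1 - cnj (x i) * t)) \<le> sw (y j) ^ n * E * sw (x i) ^ n"
        unfolding hev_kerP norm_power .
    qed (auto simp: E_def less_imp_le)
    moreover have "cmod (ip n (kerP n ?X ?Y) u) = cmod (hev n u ?X ?Y)"
      unfolding ip_kerP[symmetric] ip_cnj[of n u, symmetric] complex_mod_cnj ..
    ultimately show ?thesis by simp
  qed
  have "cmod (ip n u v) \<le> interp_const (2 * q) * (interp_const (2 * p) * E * hn n u) * hn n v"
    by (rule ip_kers_bound[OF n(1,3) v kers_degree[OF u]])
      (use u_dec interp_const_ge_1[of "2 * p"] in \<open>auto simp: E_def r_def mult_ac intro!: mult_nonneg_nonneg\<close>)
  then show ?thesis by (simp add: E_def mult_ac)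
qed

subsection \<open>Comparison of the quadratic forms\<close>

lemma Re_ip_le:
  assumes "l > 0"
  shows "2 * Re (ip n F G) \<le> l * nrm2 n F + nrm2 n G / l"
proof -
  have "0 \<le> nrm2 n (smult (of_real (- l)) F + G)" by simp
  also have "\<dots> = l\<^sup>2 * nrm2 n F + nrm2 n G - 2 * l * Re (ip n F G)"
    unfolding nrm2_add nrm2_smult ip_smult_left by simp
  finally have "l * (2 * Re (ip n F G)) \<le> l * (l * nrm2 n F + nrm2 n G / l)"
    using assms by (simp add: power2_eq_square algebra_simps)
  then show ?thesis using assms by simp
qed

lemma kers_cong: "(\<And>j. j < k \<Longrightarrow> z j = w j) \<Longrightarrow> kers n k z = kers n k w"
  by (induction k) auto

lemma append_fun_simps:
  "i < p \<Longrightarrow> append_fun p q x y i = x i" "j < q \<Longrightarrow> append_fun p q x y (p + j) = y j"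
  by (auto simp: append_fun_def)

lemma kers_append:
  "F \<in> kers n (p + q) z \<Longrightarrow> \<exists>a\<in>kers n p z. \<exists>b\<in>kers n q (\<lambda>j. z (p + j)). F = a + b"
proof (induction q arbitrary: F)
  case 0
  then show ?case by auto
next
  case (Suc q)
  obtain F0 c d where F: "F = (F0 + smult c (ker n (z (p + q)))) + smult d (dker n (z (p + q)))" "F0 \<in> kers n (p + q) z"
    using Suc.prems by (auto simp: lspan1_def)
  obtain a b where ab: "a \<in> kers n p z" "b \<in> kers n q (\<lambda>j. z (p + j))" "F0 = a + b"
    using Suc.IH[OF F(2)] by blast
  have "(b + smult c (ker n (z (p + q)))) + smult d (dker n (z (p + q))) \<in> kers n (Suc q) (\<lambda>j. z (p + j))"
    using ab(2) by (auto simp: lspan1_def)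
  moreover have "F = a + ((b + smult c (ker n (z (p + q)))) + smult d (dker n (z (p + q))))"
    unfolding F(1) ab(3) by simp
  ultimately show ?case using ab(1) by blast
qed

text \<open>\<open>FI\<close> and \<open>FJ\<close> are the projections of \<open>F\<close> to the
  two spans, and \<open>F\<close> itself is a sum \<open>a + b\<close> from these spans. Almost
  orthogonality bounds the squared norm of \<open>FI + FJ\<close> from above and that of
  \<open>a + b\<close> from below by the sum of the two squared norms; each inequality follows by
  pairing \<open>F\<close> with one of the two sums.\<close>

lemma qform_compare:
  fixes u u' v v' :: "nat \<Rightarrow> complex"
  assumes inj: "inj_on (append_fun p q x y) {..<p + q}" and k: "2 * (p + q) \<le> Suc n"
    and \<epsilon>: "0 \<le> \<epsilon>" "\<epsilon> < 1"
    and orth: "\<And>a b. a \<in> kers n p x \<Longrightarrow> b \<in> kers n q y \<Longrightarrow> cmod (ip n a b) \<le> \<epsilon> * hn n a * hn n b"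
  defines "Q \<equiv> qform n (p + q) (append_fun p q x y) (append_fun p q v v') (append_fun p q u u')"
  shows "qform n p x v u + qform n q y v' u' \<le> (1 + \<epsilon>) * Q"
    and "(1 - \<epsilon>) * Q \<le> qform n p x v u + qform n q y v' u'"
proof -
  let ?z = "append_fun p q x y"
  have injx: "inj_on x {..<p}"
  proof (rule inj_onI)
    fix i j assume *: "i \<in> {..<p}" "j \<in> {..<p}" "x i = x j"
    then have "?z i = ?z j" by (simp add: append_fun_simps)
    then show "i = j" using inj_onD[OF inj, of i j] * by simp
  qed
  have injy: "inj_on y {..<q}"
  proof (rule inj_onI)
    fix i j assume *: "i \<in> {..<q}" "j \<in> {..<q}" "y i = y j"
    then have "?z (p + i) = ?z (p + j)" by (simp add: append_fun_simps)
    then show "i = j" using inj_onD[OF inj, of "p + i" "p + j"] * by simp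
  qed
  have kp: "2 * p \<le> Suc n" and kq: "2 * q \<le> Suc n" using k by auto
  define F where "F = minpoly n (p + q) ?z (append_fun p q v v') (append_fun p q u u')"
  define FI where "FI = minpoly n p x v u"
  define FJ where "FJ = minpoly n q y v' u'"
  have F: "F \<in> kers n (p + q) ?z" "has_jet (p + q) ?z (append_fun p q v v') (append_fun p q u u') F"
    unfolding F_def by (rule minpoly_kers[OF inj k], rule minpoly_jet[OF inj k])
  have FI: "FI \<in> kers n p x" "has_jet p x v u FI"
    unfolding FI_def by (rule minpoly_kers[OF injx kp], rule minpoly_jet[OF injx kp])
  have FJ: "FJ \<in> kers n q y" "has_jet q y v' u' FJ"
    unfolding FJ_def by (rule minpoly_kers[OF injy kq], rule minpoly_jet[OF injy kq])
  have F_jetI: "has_jet p x v u F" unfolding has_jet_def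
  proof (intro allI impI)
    fix j assume "j < p"
    then show "poly F (x j) = v j \<and> poly (pderiv F) (x j) = u j"
      using F(2)[unfolded has_jet_def, rule_format, of j] by (simp add: append_fun_simps)
  qed
  have F_jetJ: "has_jet q y v' u' F" unfolding has_jet_def
  proof (intro allI impI)
    fix j assume "j < q"
    then show "poly F (y j) = v' j \<and> poly (pderiv F) (y j) = u' j"
      using F(2)[unfolded has_jet_def, rule_format, of "p + j"] by (simp add: append_fun_simps)
  qed
  have PI: "ip n F a = ip n FI a" if "a \<in> kers n p x" for a
    using kers_orth[OF that degree_diff_le[OF kers_degree[OF F(1)] kers_degree[OF FI(1)]] has_jet_diff_zero[OF F_jetI FI(2)]]
    by (simp add: ip_diff_left)
  have PJ: "ip n F b = ip n FJ b" if "b \<in> kers n q y" for b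
    using kers_orth[OF that degree_diff_le[OF kers_degree[OF F(1)] kers_degree[OF FJ(1)]] has_jet_diff_zero[OF F_jetJ FJ(2)]]
    by (simp add: ip_diff_left)
  have "kers n p ?z = kers n p x" "kers n q (\<lambda>j. ?z (p + j)) = kers n q y"
    by (auto intro!: kers_cong simp: append_fun_simps)
  then obtain a b where ab: "a \<in> kers n p x" "b \<in> kers n q y" "F = a + b"
    using kers_append[OF F(1)] by auto
  have orth2: "\<bar>2 * Re (ip n a b)\<bar> \<le> \<epsilon> * (nrm2 n a + nrm2 n b)" if "a \<in> kers n p x" "b \<in> kers n q y" for a b
  proof -
    have "\<bar>2 * Re (ip n a b)\<bar> \<le> 2 * (\<epsilon> * hn n a * hn n b)"
      using orth[OF that] abs_Re_le_cmod[of "ip n a b"] by linarith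
    also have "\<dots> = \<epsilon> * (2 * hn n a * hn n b)" by simp
    also have "\<dots> \<le> \<epsilon> * ((hn n a)\<^sup>2 + (hn n b)\<^sup>2)"
      using sum_squares_bound[of "hn n a" "hn n b"] \<epsilon>(1) by (intro mult_left_mono) auto
    finally show ?thesis by (simp add: hn_sq)
  qed
  define N where "N = nrm2 n F"
  define S where "S = qform n p x v u + qform n q y v' u'"
  have NQ: "N = Q" by (simp add: N_def Q_def qform_def F_def)
  have S: "S = nrm2 n FI + nrm2 n FJ" by (simp add: S_def qform_def FI_def FJ_def)
  show "qform n p x v u + qform n q y v' u' \<le> (1 + \<epsilon>) * Q"
  proof -
    \<comment> \<open>Pairing with \<open>FI + FJ\<close> reproduces the sum of the two forms,
      because \<open>FI\<close> and \<open>FJ\<close> are projections of \<open>F\<close>.\<close>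
    have "of_real S = ip n F (FI + FJ)"
      unfolding S ip_add_right PI[OF FI(1)] PJ[OF FJ(1)] by (simp add: ip_self)
    then have "2 * S = 2 * Re (ip n F (FI + FJ))" by (metis Re_complex_of_real)
    also have "\<dots> \<le> (1 + \<epsilon>) * N + nrm2 n (FI + FJ) / (1 + \<epsilon>)"
      unfolding N_def using \<epsilon> by (intro Re_ip_le) auto
    also have "\<dots> \<le> (1 + \<epsilon>) * N + S"
    proof -
      have "nrm2 n (FI + FJ) \<le> (1 + \<epsilon>) * S"
        using orth2[OF FI(1) FJ(1)] unfolding S nrm2_add by (simp add: algebra_simps)
      then show ?thesis using \<epsilon> by (simp add: divide_le_eq mult.commute)
    qed
    finally show ?thesis by (simp add: S_def NQ)
  qed
  show "(1 - \<epsilon>) * Q \<le> qform n p x v u + qform n q y v' u'"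
  proof -
    define l where "l = 1 / (1 - \<epsilon>)"
    have l: "l > 0" using \<epsilon> by (simp add: l_def)
    \<comment> \<open>Here \<open>F\<close> is paired with itself in the form \<open>a + b\<close>,
      and in each summand the left \<open>F\<close> is replaced by its projection.\<close>
    have "complex_of_real N = ip n FI a + ip n FJ b"
      unfolding N_def ip_self[symmetric] PI[OF ab(1), symmetric] PJ[OF ab(2), symmetric] ip_add_right[symmetric] ab(3)[symmetric] ..
    then have "2 * N = 2 * Re (ip n FI a) + 2 * Re (ip n FJ b)"
      by (metis Re_complex_of_real distrib_left plus_complex.sel(1))
    also have "\<dots> \<le> (l * nrm2 n FI + nrm2 n a / l) + (l * nrm2 n FJ + nrm2 n b / l)"
      by (intro add_mono Re_ip_le l)
    also have "\<dots> = l * S + (1 - \<epsilon>) * (nrm2 n a + nrm2 n b)"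
      by (simp add: S l_def algebra_simps)
    also have "(1 - \<epsilon>) * (nrm2 n a + nrm2 n b) \<le> N"
      using orth2[OF ab(1,2)] unfolding N_def ab(3) nrm2_add by (simp add: algebra_simps)
    finally have "N \<le> l * S" by simp
    then have "(1 - \<epsilon>) * N \<le> S" using \<epsilon> by (simp add: l_def field_simps)
    then show ?thesis by (simp add: S_def NQ)
  qed
qed

subsection \<open>Scaling\<close>

lemma nn_integral_cL_scale:
  assumes c: "c > 0" and F: "F \<in> borel_measurable (cL k)"
  shows "(\<integral>\<^sup>+x. F x \<partial>cL k) = ennreal (c ^ (2 * k)) * (\<integral>\<^sup>+x. F (\<lambda>i\<in>{..<k}. of_real c * x i) \<partial>cL k)"
proof -
  have "(\<Prod>i<k. ennreal ((cmod (of_real c))\<^sup>2)) = ennreal (c ^ (2 * k))"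
    using c by (simp add: ennreal_power power_mult)
  then show ?thesis
    using nn_integral_cL_affine[of k "\<lambda>_. of_real c" F "\<lambda>_. 0"] c F by simp
qed

definition moment_at :: "nat \<Rightarrow> nat \<Rightarrow> (nat \<Rightarrow> complex) \<Rightarrow> real \<Rightarrow> ennreal" where
  "moment_at n k z s = (\<integral>\<^sup>+u. (\<Prod>j<k. ennreal ((cmod (u j))\<^sup>2)) * ennreal (exp (- (s * qform n k z (\<lambda>_. 0) u))) \<partial>cL k)"

definition total_at :: "nat \<Rightarrow> nat \<Rightarrow> (nat \<Rightarrow> complex) \<Rightarrow> real \<Rightarrow> ennreal" where
  "total_at n k z s = (\<integral>\<^sup>+v. \<integral>\<^sup>+u. ennreal (exp (- (s * qform n k z v u))) \<partial>cL k \<partial>cL k)"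

text \<open>The reference quantity of the upper bound: \<open>jet_moment\<close> is estimated above
  and \<open>jet_total\<close> below in terms of it.\<close>

definition section_at :: "nat \<Rightarrow> nat \<Rightarrow> (nat \<Rightarrow> complex) \<Rightarrow> real \<Rightarrow> ennreal" where
  "section_at n k z s = (\<integral>\<^sup>+u. ennreal (exp (- (s * qform n k z (\<lambda>_. 0) u))) \<partial>cL k)"

context
  fixes n k :: nat and z :: "nat \<Rightarrow> complex"
  assumes inj: "inj_on z {..<k}" and k: "2 * k \<le> Suc n"
begin

lemma measurable_qform_u: "(\<lambda>u. qform n k z v u) \<in> borel_measurable (cL k)"
  by (rule measurable_qform[OF inj k]) measurable

lemma measurable_qform_pair: "(\<lambda>w. qform n k z (fst w) (snd w)) \<in> borel_measurable (cL k \<Otimes>\<^sub>M cL k)"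
  by (rule measurable_qform[OF inj k]) measurable

lemma measurable_section: "(\<lambda>v. \<integral>\<^sup>+u. ennreal (exp (- (s * qform n k z v u))) \<partial>cL k) \<in> borel_measurable (cL k)"
proof -
  note [measurable] = measurable_qform_pair
  show ?thesis by measurable
qed

lemma qform_scale_restrict:
  "qform n k z (\<lambda>i\<in>{..<k}. of_real c * v i) (\<lambda>i\<in>{..<k}. of_real c * u i) = c\<^sup>2 * qform n k z v u"
proof -
  have "qform n k z (\<lambda>i\<in>{..<k}. of_real c * v i) (\<lambda>i\<in>{..<k}. of_real c * u i) =
    qform n k z (\<lambda>i. of_real c * v i) (\<lambda>i. of_real c * u i)" by (rule qform_cong) auto
  then show ?thesis by (simp add: qform_smult[OF inj k])
qed

lemma qform_scale_restrict_0:
  "qform n k z (\<lambda>_. 0) (\<lambda>i\<in>{..<k}. of_real c * u i) = c\<^sup>2 * qform n k z (\<lambda>_. 0) u"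
proof -
  have "qform n k z (\<lambda>_. 0) (\<lambda>i\<in>{..<k}. of_real c * u i) =
    qform n k z (\<lambda>i\<in>{..<k}. of_real c * (\<lambda>_. 0) i) (\<lambda>i\<in>{..<k}. of_real c * u i)" by (rule qform_cong) auto
  then show ?thesis unfolding qform_scale_restrict .
qed

lemma section_at_scale:
  assumes s: "s > 0"
  shows "section_at n k z 1 = ennreal (s ^ k) * section_at n k z s"
proof -
  note [measurable] = measurable_qform_u
  have "section_at n k z 1 = ennreal (sqrt s ^ (2 * k)) *
    (\<integral>\<^sup>+u. ennreal (exp (- (1 * qform n k z (\<lambda>_. 0) (\<lambda>i\<in>{..<k}. of_real (sqrt s) * u i)))) \<partial>cL k)"
    unfolding section_at_def by (rule nn_integral_cL_scale) (use s in \<open>simp, measurable\<close>)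
  then show ?thesis using s by (simp add: qform_scale_restrict_0 section_at_def power_mult)
qed

text \<open>Rescaling \<open>k\<close> complex variables gives \<open>s ^ k\<close>, and the moment
  factor gives another \<open>s ^ k\<close>. The total exponent equals that of
  \<open>jet_total\<close>, which has \<open>2 * k\<close> variables, so the ratio does not
  change.\<close>

lemma moment_at_scale:
  assumes s: "s > 0"
  shows "jet_moment n k z = ennreal (s ^ (2 * k)) * moment_at n k z s"
proof -
  note [measurable] = measurable_qform_u
  have pr: "(\<Prod>j<k. ennreal ((cmod ((\<lambda>i\<in>{..<k}. of_real (sqrt s) * u i) j))\<^sup>2)) = ennreal (s ^ k) * (\<Prod>j<k. ennreal ((cmod (u j))\<^sup>2))" for u
  proof -
    have "(\<Prod>j<k. ennreal ((cmod ((\<lambda>i\<in>{..<k}. of_real (sqrt s) * u i) j))\<^sup>2)) = (\<Prod>j<k. ennreal s * ennreal ((cmod (u j))\<^sup>2))"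
      using s by (intro prod.cong) (auto simp: norm_mult power_mult_distrib ennreal_mult)
    also have "\<dots> = ennreal (s ^ k) * (\<Prod>j<k. ennreal ((cmod (u j))\<^sup>2))"
      using s by (simp add: prod.distrib ennreal_power)
    finally show ?thesis .
  qed
  have "jet_moment n k z = ennreal (sqrt s ^ (2 * k)) *
    (\<integral>\<^sup>+u. (\<Prod>j<k. ennreal ((cmod ((\<lambda>i\<in>{..<k}. of_real (sqrt s) * u i) j))\<^sup>2)) *
      ennreal (exp (- qform n k z (\<lambda>_. 0) (\<lambda>i\<in>{..<k}. of_real (sqrt s) * u i))) \<partial>cL k)"
    unfolding jet_moment_def by (rule nn_integral_cL_scale) (use s in \<open>simp, measurable\<close>)
  also have "\<dots> = ennreal (s ^ k) * (\<integral>\<^sup>+u. ennreal (s ^ k) * ((\<Prod>j<k. ennreal ((cmod (u j))\<^sup>2)) *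
      ennreal (exp (- (s * qform n k z (\<lambda>_. 0) u)))) \<partial>cL k)"
    unfolding pr qform_scale_restrict_0 using s by (simp add: power_mult mult.assoc)
  also have "\<dots> = ennreal (s ^ k) * (ennreal (s ^ k) * moment_at n k z s)"
    unfolding moment_at_def by (subst nn_integral_cmult) measurable
  also have "\<dots> = ennreal (s ^ (2 * k)) * moment_at n k z s"
    using s by (simp add: mult.assoc[symmetric] ennreal_mult[symmetric] power_add[symmetric] mult_2)
  finally show ?thesis .
qed

lemma total_at_scale:
  assumes s: "s > 0"
  shows "jet_total n k z = ennreal (s ^ (2 * k)) * total_at n k z s"
proof -
  have sc: "(\<integral>\<^sup>+u. ennreal (exp (- (1 * qform n k z (\<lambda>i\<in>{..<k}. of_real (sqrt s) * v i) u))) \<partial>cL k) =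
    ennreal (s ^ k) * (\<integral>\<^sup>+u. ennreal (exp (- (s * qform n k z v u))) \<partial>cL k)" for v
  proof -
    note [measurable] = measurable_qform_u
    have "(\<integral>\<^sup>+u. ennreal (exp (- (1 * qform n k z (\<lambda>i\<in>{..<k}. of_real (sqrt s) * v i) u))) \<partial>cL k) = ennreal (sqrt s ^ (2 * k)) *
      (\<integral>\<^sup>+u. ennreal (exp (- (1 * qform n k z (\<lambda>i\<in>{..<k}. of_real (sqrt s) * v i) (\<lambda>i\<in>{..<k}. of_real (sqrt s) * u i)))) \<partial>cL k)"
      by (rule nn_integral_cL_scale) (use s in \<open>simp, measurable\<close>)
    then show ?thesis using s by (simp add: qform_scale_restrict power_mult)
  qed
  have "total_at n k z 1 = ennreal (sqrt s ^ (2 * k)) *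
    (\<integral>\<^sup>+v. \<integral>\<^sup>+u. ennreal (exp (- (1 * qform n k z (\<lambda>i\<in>{..<k}. of_real (sqrt s) * v i) u))) \<partial>cL k \<partial>cL k)"
    unfolding total_at_def by (rule nn_integral_cL_scale) (use s measurable_section[of 1] in auto)
  also have "\<dots> = ennreal (s ^ k) * (ennreal (s ^ k) * total_at n k z s)"
    unfolding sc total_at_def using s by (subst nn_integral_cmult[OF measurable_section]) (simp add: power_mult)
  also have "\<dots> = ennreal (s ^ (2 * k)) * total_at n k z s"
    using s by (simp add: mult.assoc[symmetric] ennreal_mult[symmetric] power_add[symmetric] mult_2)
  finally show ?thesis by (simp add: total_at_def jet_total_def)
qed

end

subsection \<open>Factorisation of the densities\<close>

lemma inj_on_append_funD:
  assumes inj: "inj_on (append_fun p q x y) {..<p + q}"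
  shows "inj_on x {..<p}" "inj_on y {..<q}"
proof -
  show "inj_on x {..<p}"
  proof (rule inj_onI)
    fix i j assume *: "i \<in> {..<p}" "j \<in> {..<p}" "x i = x j"
    then have "append_fun p q x y i = append_fun p q x y j" by (simp add: append_fun_simps)
    then show "i = j" using inj_onD[OF inj, of i j] * by simp
  qed
  show "inj_on y {..<q}"
  proof (rule inj_onI)
    fix i j assume *: "i \<in> {..<q}" "j \<in> {..<q}" "y i = y j"
    then have "append_fun p q x y (p + i) = append_fun p q x y (p + j)" by (simp add: append_fun_simps)
    then show "i = j" using inj_onD[OF inj, of "p + i" "p + j"] * by simp
  qed
qed

lemma prod_lessThan_add:
  fixes f :: "nat \<Rightarrow> 'a :: comm_monoid_mult"
  shows "(\<Prod>j<p + q. f j) = (\<Prod>j<p. f j) * (\<Prod>j<q. f (p + j))"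
  by (induction q) (simp_all add: mult.assoc)

lemma prod_append_fun:
  fixes f :: "complex \<Rightarrow> 'a :: comm_monoid_mult"
  shows "(\<Prod>j<p + q. f (append_fun p q u u' j)) = (\<Prod>j<p. f (u j)) * (\<Prod>j<q. f (u' j))"
  unfolding prod_lessThan_add by (intro arg_cong2[where f="(*)"] prod.cong) (auto simp: append_fun_simps)

lemma nn_integral_times:
  assumes [measurable]: "f \<in> borel_measurable M" "g \<in> borel_measurable N"
  shows "(\<integral>\<^sup>+x. \<integral>\<^sup>+y. f x * g y \<partial>N \<partial>M) = (\<integral>\<^sup>+x. f x \<partial>M) * (\<integral>\<^sup>+y. g y \<partial>N)"
  by (simp add: nn_integral_cmult nn_integral_multc)

context
  fixes n p q :: nat and x y :: "nat \<Rightarrow> complex"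
  assumes inj: "inj_on (append_fun p q x y) {..<p + q}" and k: "2 * (p + q) \<le> Suc n"
begin

lemma orders_le: "2 * p \<le> Suc n" "2 * q \<le> Suc n"
  using k by auto

lemmas injs = inj_on_append_funD[OF inj]

lemma moment_product:
  "moment_at n p x s * moment_at n q y s =
    (\<integral>\<^sup>+u. \<integral>\<^sup>+u'. (\<Prod>j<p + q. ennreal ((cmod (append_fun p q u u' j))\<^sup>2)) *
      ennreal (exp (- (s * (qform n p x (\<lambda>_. 0) u + qform n q y (\<lambda>_. 0) u')))) \<partial>cL q \<partial>cL p)"
proof -
  note [measurable] = measurable_qform_u[OF injs(1) orders_le(1)] measurable_qform_u[OF injs(2) orders_le(2)]
  have "(\<Prod>j<p + q. ennreal ((cmod (append_fun p q u u' j))\<^sup>2)) * ennreal (exp (- (s * (a + b)))) =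
    ((\<Prod>j<p. ennreal ((cmod (u j))\<^sup>2)) * ennreal (exp (- (s * a)))) * ((\<Prod>j<q. ennreal ((cmod (u' j))\<^sup>2)) * ennreal (exp (- (s * b))))" for u u' a b
    using prod_append_fun[where f="\<lambda>w. ennreal ((cmod w)\<^sup>2)"]
    by (simp add: distrib_left exp_add exp_diff exp_minus ennreal_mult[symmetric] mult_ac divide_inverse)
      (simp add: ennreal_mult mult_ac)
  then show ?thesis unfolding moment_at_def by (simp only:) (rule nn_integral_times[symmetric], measurable)
qed

lemma total_product:
  "total_at n p x s * total_at n q y s =
    (\<integral>\<^sup>+v. \<integral>\<^sup>+v'. \<integral>\<^sup>+u. \<integral>\<^sup>+u'. ennreal (exp (- (s * (qform n p x v u + qform n q y v' u')))) \<partial>cL q \<partial>cL p \<partial>cL q \<partial>cL p)"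
proof -
  note [measurable] = measurable_qform_u[OF injs(1) orders_le(1)] measurable_qform_u[OF injs(2) orders_le(2)]
    measurable_section[OF injs(1) orders_le(1)] measurable_section[OF injs(2) orders_le(2)]
  have "ennreal (exp (- (s * (a + b)))) = ennreal (exp (- (s * a))) * ennreal (exp (- (s * b)))" for a b
    by (simp add: distrib_left exp_add[symmetric] ennreal_mult[symmetric])
  then have "(\<integral>\<^sup>+u. \<integral>\<^sup>+u'. ennreal (exp (- (s * (qform n p x v u + qform n q y v' u')))) \<partial>cL q \<partial>cL p) =
    (\<integral>\<^sup>+u. ennreal (exp (- (s * qform n p x v u))) \<partial>cL p) * (\<integral>\<^sup>+u'. ennreal (exp (- (s * qform n q y v' u'))) \<partial>cL q)" for v v'
    by (simp only:) (rule nn_integral_times, measurable)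
  then show ?thesis unfolding total_at_def by (simp only:) (rule nn_integral_times[symmetric], measurable)
qed

lemma qform_append_0: "qform n (p + q) z (append_fun p q (\<lambda>_. 0) (\<lambda>_. 0)) u = qform n (p + q) z (\<lambda>_. 0) u"
  by (rule qform_cong) (auto simp: append_fun_def)

lemma jet_moment_append: "jet_moment n (p + q) (append_fun p q x y) =
    (\<integral>\<^sup>+u. \<integral>\<^sup>+u'. (\<Prod>j<p + q. ennreal ((cmod (append_fun p q u u' j))\<^sup>2)) *
      ennreal (exp (- qform n (p + q) (append_fun p q x y) (append_fun p q (\<lambda>_. 0) (\<lambda>_. 0)) (append_fun p q u u'))) \<partial>cL q \<partial>cL p)"
proof -
  note [measurable] = measurable_qform_u[OF inj k]
  show ?thesis unfolding jet_moment_def qform_append_0 by (rule nn_integral_cL_append) measurable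
qed

lemma jet_total_append: "jet_total n (p + q) (append_fun p q x y) =
    (\<integral>\<^sup>+v. \<integral>\<^sup>+v'. \<integral>\<^sup>+u. \<integral>\<^sup>+u'. ennreal (exp (- qform n (p + q) (append_fun p q x y) (append_fun p q v v') (append_fun p q u u'))) \<partial>cL q \<partial>cL p \<partial>cL q \<partial>cL p)"
proof -
  note [measurable] = measurable_qform_u[OF inj k]
  have inner: "(\<integral>\<^sup>+u. ennreal (exp (- qform n (p + q) (append_fun p q x y) (append_fun p q v v') u)) \<partial>cL (p + q)) =
    (\<integral>\<^sup>+u. \<integral>\<^sup>+u'. ennreal (exp (- qform n (p + q) (append_fun p q x y) (append_fun p q v v') (append_fun p q u u'))) \<partial>cL q \<partial>cL p)" for v v'
    by (rule nn_integral_cL_append) measurable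
  have "jet_total n (p + q) (append_fun p q x y) =
    (\<integral>\<^sup>+v. \<integral>\<^sup>+v'. \<integral>\<^sup>+u. ennreal (exp (- qform n (p + q) (append_fun p q x y) (append_fun p q v v') u)) \<partial>cL (p + q) \<partial>cL q \<partial>cL p)"
    unfolding jet_total_def using measurable_section[OF inj k, of 1] by (intro nn_integral_cL_append) simp
  then show ?thesis unfolding inner .
qed

text \<open>No determinants are needed: a perturbation of the quadratic form by a factor \<open>1 \<plusminus> \<epsilon>\<close>
  changes both integrals by explicit powers of that factor, by homogeneity.\<close>

lemma density_compare:
  assumes \<epsilon>: "0 \<le> \<epsilon>" "\<epsilon> \<le> 1 / 2"
    and orth: "\<And>a b. a \<in> kers n p x \<Longrightarrow> b \<in> kers n q y \<Longrightarrow> cmod (ip n a b) \<le> \<epsilon> * hn n a * hn n b"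
  defines "R \<equiv> zero_density n (p + q) (append_fun p q x y)"
    and "R' \<equiv> zero_density n p x * zero_density n q y"
  shows "R \<le> ennreal ((1 + 4 * \<epsilon>) ^ (2 * (p + q))) * R'" and "R' \<le> ennreal ((1 + 4 * \<epsilon>) ^ (2 * (p + q))) * R"
proof -
  let ?z = "append_fun p q x y" and ?k = "p + q"
  let ?Q = "\<lambda>v v' u u'. qform n ?k ?z (append_fun p q v v') (append_fun p q u u')"
  let ?S = "\<lambda>v v' u u'. qform n p x v u + qform n q y v' u'"
  define a where "a = 1 / (1 + \<epsilon>)"
  define b where "b = 1 / (1 - \<epsilon>)"
  have ab: "a > 0" "b > 0" using \<epsilon> by (auto simp: a_def b_def)
  have Q: "a * ?S v v' u u' \<le> ?Q v v' u u'" "?Q v v' u u' \<le> b * ?S v v' u u'" for v v' u u'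
    using qform_compare[OF inj k, of \<epsilon>, where u=u and u'=u' and v=v and v'=v'] \<epsilon> orth by (auto simp: a_def b_def field_simps)
  have M1: "jet_moment n ?k ?z \<le> moment_at n p x a * moment_at n q y a"
    unfolding jet_moment_append moment_product using Q(1) by (intro nn_integral_mono mult_left_mono ennreal_leI) auto
  have M2: "moment_at n p x b * moment_at n q y b \<le> jet_moment n ?k ?z"
    unfolding jet_moment_append moment_product using Q(2) by (intro nn_integral_mono mult_left_mono ennreal_leI) auto
  have N1: "jet_total n ?k ?z \<le> total_at n p x a * total_at n q y a"
    unfolding jet_total_append total_product using Q(1) by (intro nn_integral_mono ennreal_leI) auto
  have N2: "total_at n p x b * total_at n q y b \<le> jet_total n ?k ?z"
    unfolding jet_total_append total_product using Q(2) by (intro nn_integral_mono ennreal_leI) auto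
  define MM where "MM = jet_moment n p x * jet_moment n q y"
  define NN where "NN = jet_total n p x * jet_total n q y"
  define M where "M = jet_moment n ?k ?z"
  define N where "N = jet_total n ?k ?z"
  have MMs: "MM = ennreal (s ^ (2 * ?k)) * (moment_at n p x s * moment_at n q y s)" if "s > 0" for s
    unfolding MM_def moment_at_scale[OF injs(1) orders_le(1) that] moment_at_scale[OF injs(2) orders_le(2) that]
    using that by (simp add: distrib_left power_add ennreal_mult mult_ac)
  have NNs: "NN = ennreal (s ^ (2 * ?k)) * (total_at n p x s * total_at n q y s)" if "s > 0" for s
    unfolding NN_def total_at_scale[OF injs(1) orders_le(1) that] total_at_scale[OF injs(2) orders_le(2) that]
    using that by (simp add: distrib_left power_add ennreal_mult mult_ac)
  \<comment> \<open>Moments and totals scale with the same exponent, so one pair of factors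
    \<open>A\<close>, \<open>B\<close> serves all four estimates.\<close>
  define A where "A = ennreal (a ^ (2 * ?k))"
  define B where "B = ennreal (b ^ (2 * ?k))"
  have AM: "A * M \<le> MM" unfolding MMs[OF ab(1)] A_def M_def by (intro mult_left_mono M1) simp
  have BM: "MM \<le> B * M" unfolding MMs[OF ab(2)] B_def M_def by (intro mult_left_mono M2) simp
  have AN: "A * N \<le> NN" unfolding NNs[OF ab(1)] A_def N_def by (intro mult_left_mono N1) simp
  have BN: "NN \<le> B * N" unfolding NNs[OF ab(2)] B_def N_def by (intro mult_left_mono N2) simp
  have RN: "R * N = M" "N \<noteq> 0" "N \<noteq> \<infinity>"
    unfolding R_def N_def M_def using zero_density_eq[OF inj k] by auto
  have RN': "R' * NN = MM"
    unfolding R'_def NN_def MM_def using zero_density_eq(1)[OF injs(1) orders_le(1)] zero_density_eq(1)[OF injs(2) orders_le(2)]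
    by (metis mult.assoc mult.left_commute)
  have cancel: "X \<le> Y" if "X * N \<le> Y * N" for X Y
  proof -
    have "X * N / N \<le> Y * N / N" using that by (rule divide_right_mono_ennreal)
    then show ?thesis using RN(2,3) by (simp add: ennreal_mult_divide_eq)
  qed
  have 1: "A * R \<le> B * R'"
  proof (rule cancel)
    have "A * R * N = A * M" using RN(1) by (simp add: mult.assoc)
    also have "\<dots> \<le> R' * NN" using AM RN' by simp
    also have "\<dots> \<le> R' * (B * N)" by (intro mult_left_mono BN) simp
    finally show "A * R * N \<le> B * R' * N" by (simp add: mult_ac)
  qed
  have 2: "A * R' \<le> B * R"
  proof (rule cancel)
    have "A * R' * N = R' * (A * N)" by (simp add: mult_ac)
    also have "\<dots> \<le> R' * NN" by (intro mult_left_mono AN) simp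
    also have "\<dots> \<le> B * M" using RN' BM by simp
    finally show "A * R' * N \<le> B * R * N" using RN(1) by (simp add: mult_ac)
  qed
  define C where "C = ennreal ((1 + \<epsilon>) ^ (2 * ?k))"
  have CA: "C * A = 1"
    using \<epsilon> by (simp add: C_def A_def a_def ennreal_mult[symmetric] power_mult_distrib[symmetric])
  have CB: "C * B \<le> ennreal ((1 + 4 * \<epsilon>) ^ (2 * ?k))"
  proof -
    \<comment> \<open>This is
      \<open>(1 + \<epsilon>) / (1 - \<epsilon>) \<le> 1 + 4 * \<epsilon>\<close>, valid for
      \<open>\<epsilon> \<le> 1 / 2\<close>.\<close>
    have "(1 + \<epsilon>) * b \<le> 1 + 4 * \<epsilon>"
    proof -
      have "0 \<le> \<epsilon> * (1 - 2 * \<epsilon>)" using \<epsilon> by simp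
      then have "(1 + \<epsilon>) \<le> (1 + 4 * \<epsilon>) * (1 - \<epsilon>)" by (simp add: algebra_simps)
      then show ?thesis using \<epsilon> by (simp add: b_def divide_le_eq)
    qed
    then have "((1 + \<epsilon>) * b) ^ (2 * ?k) \<le> (1 + 4 * \<epsilon>) ^ (2 * ?k)"
      using \<epsilon> ab by (intro power_mono) auto
    then show ?thesis
      using \<epsilon> ab by (simp add: C_def B_def ennreal_mult[symmetric] power_mult_distrib)
  qed
  have fin: "X \<le> ennreal ((1 + 4 * \<epsilon>) ^ (2 * ?k)) * Y" if "A * X \<le> B * Y" for X Y
  proof -
    have "X = C * (A * X)" using CA by (simp add: mult.assoc[symmetric])
    also have "\<dots> \<le> C * (B * Y)" by (intro mult_left_mono that) simp
    also have "\<dots> = (C * B) * Y" by (simp add: mult.assoc)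
    also have "\<dots> \<le> ennreal ((1 + 4 * \<epsilon>) ^ (2 * ?k)) * Y" by (intro mult_right_mono CB) simp
    finally show ?thesis .
  qed
  show "R \<le> ennreal ((1 + 4 * \<epsilon>) ^ (2 * (p + q))) * R'" by (rule fin[OF 1])
  show "R' \<le> ennreal ((1 + 4 * \<epsilon>) ^ (2 * (p + q))) * R" by (rule fin[OF 2])
qed

end

subsection \<open>The upper bound\<close>

text \<open>All points are roots of \<open>F\<close>, so its derivative at \<open>z j\<close> is the
  product of the differences times the quotient \<open>g\<close> at \<open>z j\<close>, which the
  Schwarz lemma bounds with capped distances. The ratios of true to capped distance for the earlier
  points are those in the value of the Newton polynomial at its centre; for the later points they
  are bounded by 1.\<close>

lemma jet_derivative_bound:
  assumes n: "n > 0" "k \<le> n" and F: "degree F \<le> n" and F0: "\<And>j. j < k \<Longrightarrow> poly F (z j) = 0"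
    and inj: "inj_on z {..<k}" and j: "j < k"
  shows "cmod (poly (pderiv F) (z j)) \<le>
    2 * 4 ^ k * sqrt (real n) * cmod (poly (newton n (map z [0..<j]) (z j)) (z j)) * hn n F"
proof -
  define r where "r = 1 / sqrt (real n)"
  have r: "0 < r" "r \<le> 1" using n by (auto simp: r_def)
  define a where "a = z j"
  have "rootp k z dvd F"
  proof -
    have "rootp m z dvd F" if "m \<le> k" for m
      using that
    proof (induction m)
      case 0
      show ?case by (simp add: rootp_def)
    next
      case (Suc m)
      then obtain G where G: "F = rootp m z * G" by (auto elim: dvdE)
      have "poly (rootp m z) (z m) \<noteq> 0"
        using inj Suc.prems by (auto simp: poly_rootp dest: inj_onD)
      moreover have "poly F (z m) = 0" using F0 Suc.prems by simp
      ultimately have "[:- z m, 1:] dvd G" by (simp add: G poly_eq_0_iff_dvd[symmetric])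
      then show ?case unfolding rootp_Suc G by (simp only: mult.commute[of "[:- z m, 1:]"] mult_dvd_mono dvd_refl)
    qed
    then show ?thesis by simp
  qed
  then obtain g where g: "F = lrootp (map z [0..<k]) * g" unfolding lrootp_map by (elim dvdE)
  have dg: "g = 0 \<or> degree g + length (map z [0..<k]) \<le> n"
    using F unfolding g by (cases "g = 0") (auto simp: degree_mult_eq lrootp_nz degree_lrootp)
  have sch: "cmod (poly g a) * prod_list (map (\<lambda>b. sw a * sw b * capped_dist r a b) (map z [0..<k])) \<le> 4 ^ length (map z [0..<k]) * (2 * hn n F * sw a ^ n)"
  proof (rule schwarz[OF r dg])
    fix t assume "cmod t = r"
    then show "cmod (hev n (lrootp (map z [0..<k]) * g) (a + t) (1 - cnj a * t)) \<le> 2 * hn n F * sw a ^ n"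
      unfolding g[symmetric] by (intro hev_rotated_bound[OF n(1)]) (simp add: r_def)
  qed
  have pl: "prod_list (map f (map z [0..<k])) = (\<Prod>l<k. f (z l))" for f :: "complex \<Rightarrow> real" and k
    by (induction k) (auto simp: mult.commute)
  define m where "m l = capped_dist r a (z l)" for l
  have mp: "m l > 0" for l unfolding m_def by (rule capped_dist_pos[OF r(1)])
  define d where "d l = cmod (a - z l)" for l
  have d0: "d l \<ge> 0" for l by (simp add: d_def)
  have dl: "d l = sw a * sw (z l) * hdist a (z l)" for l by (simp add: d_def hdist_def)
  have hm: "hdist a (z l) \<le> m l" for l by (simp add: m_def capped_dist_def)
  have dm: "d l / (sw (z l) * m l) \<le> sw a" for l
    using hm[of l] mp[of l] by (simp add: dl divide_le_eq mult_ac mult_left_mono less_imp_le)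
  \<comment> \<open>The capped distance of the point to itself is \<open>r\<close>. Its reciprocal
    is the factor \<open>sqrt n\<close>, and in the end the source of \<open>n ^ k\<close> in the
    density bound.\<close>
  have mj: "m j = r" using r by (simp add: m_def a_def capped_dist_def hdist_def)
  define \<nu> where "\<nu> = cmod (poly (newton n (map z [0..<j]) (z j)) (z j))"
  have pr: "poly (lrootp (map z [0..<l])) a = (\<Prod>i<l. a - z i)" for l
    unfolding lrootp_map poly_rootp ..
  have \<nu>: "\<nu> = (\<Prod>l<j. d l / (sw (z l) * m l)) * sw a ^ (n - j)"
  proof -
    have "\<nu> = (\<Prod>i<j. d i) * (sw a ^ (n - j) / (\<Prod>l<j. sw (z l) * m l))"
      unfolding \<nu>_def a_def[symmetric] using j n mp
      by (subst poly_newton_center) (auto simp: pr pl norm_mult norm_divide norm_power prod_norm[symmetric] d_def r_def[symmetric] m_def less_imp_le abs_prod simp del: map_map)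
    then show ?thesis by (simp add: prod_dividef)
  qed
  have der: "cmod (poly (pderiv F) a) = (\<Prod>l\<in>{..<k} - {j}. d l) * cmod (poly g a)"
  proof -
    have "rootp k z = [:- z j, 1:] * (\<Prod>i\<in>{..<k}-{j}. [:- z i, 1:])"
      unfolding rootp_def using j by (subst prod.remove[of _ j]) auto
    then have "F = [:- a, 1:] * ((\<Prod>i\<in>{..<k}-{j}. [:- z i, 1:]) * g)"
      unfolding g lrootp_map a_def by (simp only: mult.assoc)
    then have "poly (pderiv F) a = poly ((\<Prod>i\<in>{..<k}-{j}. [:- z i, 1:]) * g) a"
      by (simp only: pderiv_mult) (simp add: pderiv_pCons)
    also have "\<dots> = (\<Prod>l\<in>{..<k} - {j}. a - z l) * poly g a" by (simp add: poly_prod)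
    finally show ?thesis by (simp add: norm_mult prod_norm[symmetric] d_def)
  qed
  have P: "(\<Prod>l\<in>{..<k} - {j}. sw (z l) * m l) > 0" using mp by (intro prod_pos) auto
  have split: "(\<Prod>l<k. sw a * sw (z l) * m l) = (sw a * sw a * r) * (sw a ^ (k - 1) * (\<Prod>l\<in>{..<k} - {j}. sw (z l) * m l))"
  proof -
    have "(\<Prod>l<k. sw a * sw (z l) * m l) = (sw a * sw (z j) * m j) * (\<Prod>l\<in>{..<k} - {j}. sw a * (sw (z l) * m l))"
      using j by (subst prod.remove[of _ j]) (auto simp: mult.assoc)
    then show ?thesis using j mj by (simp add: a_def[symmetric] prod.distrib)
  qed
  have prest: "(\<Prod>l\<in>{..<k} - {j}. d l) / (\<Prod>l\<in>{..<k} - {j}. sw (z l) * m l) \<le> (\<Prod>l<j. d l / (sw (z l) * m l)) * sw a ^ (k - 1 - j)"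
  proof -
    have un: "{..<k} - {j} = {..<j} \<union> {j<..<k}" using j by auto
    have "(\<Prod>l\<in>{..<k} - {j}. d l / (sw (z l) * m l)) = (\<Prod>l<j. d l / (sw (z l) * m l)) * (\<Prod>l\<in>{j<..<k}. d l / (sw (z l) * m l))"
      unfolding un by (rule prod.union_disjoint) auto
    also have "\<dots> \<le> (\<Prod>l<j. d l / (sw (z l) * m l)) * (\<Prod>l\<in>{j<..<k}. sw a)"
      using mp by (intro mult_left_mono prod_mono prod_nonneg) (auto simp: dm d0 less_imp_le)
    finally show ?thesis by (simp add: prod_dividef)
  qed
  have "cmod (poly g a) * ((sw a * sw a * r) * (sw a ^ (k - 1) * (\<Prod>l\<in>{..<k} - {j}. sw (z l) * m l))) \<le> 4 ^ k * (2 * hn n F * sw a ^ n)"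
    using sch unfolding pl m_def[symmetric] split by simp
  then have gb: "cmod (poly g a) \<le> 4 ^ k * (2 * hn n F * sw a ^ n) / ((sw a * sw a * r) * (sw a ^ (k - 1) * (\<Prod>l\<in>{..<k} - {j}. sw (z l) * m l)))"
    using P r by (subst pos_le_divide_eq) auto
  have "cmod (poly (pderiv F) a) \<le> (\<Prod>l\<in>{..<k} - {j}. d l) * (4 ^ k * (2 * hn n F * sw a ^ n) / ((sw a * sw a * r) * (sw a ^ (k - 1) * (\<Prod>l\<in>{..<k} - {j}. sw (z l) * m l))))"
    unfolding der by (intro mult_left_mono gb prod_nonneg) (auto simp: d_def)
  also have "\<dots> = (2 * 4 ^ k * hn n F / r) * (sw a ^ n / (sw a * sw a * sw a ^ (k - 1))) * ((\<Prod>l\<in>{..<k} - {j}. d l) / (\<Prod>l\<in>{..<k} - {j}. sw (z l) * m l))"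
    by (simp add: mult_ac)
  also have "\<dots> \<le> (2 * 4 ^ k * hn n F / r) * (sw a ^ n / (sw a * sw a * sw a ^ (k - 1))) * ((\<Prod>l<j. d l / (sw (z l) * m l)) * sw a ^ (k - 1 - j))"
    using r by (intro mult_left_mono prest) (auto simp: less_imp_le)
  also have "\<dots> \<le> (2 * 4 ^ k * hn n F / r) * (sw a ^ (n - j) / sw a ^ (k - 1 - j)) * ((\<Prod>l<j. d l / (sw (z l) * m l)) * sw a ^ (k - 1 - j))"
  proof (intro mult_right_mono mult_left_mono)
    have e: "sw a ^ n = sw a ^ (n - j) * sw a ^ j" "sw a ^ (k - 1) = sw a ^ (k - 1 - j) * sw a ^ j"
      using j n by (simp_all add: power_add[symmetric])
    \<comment> \<open>Two surplus factors \<open>sw a\<close> in the denominator are dropped, as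
      \<open>sw a \<ge> 1\<close>.\<close>
    have "1 \<le> sw a * sw a" using sw_ge_1[of a] mult_mono[of 1 "sw a" 1 "sw a"] by simp
    then have "sw a ^ (n - j) / sw a ^ (k - 1 - j) / (sw a * sw a) \<le> sw a ^ (n - j) / sw a ^ (k - 1 - j) / 1"
      by (intro divide_left_mono) (auto simp: less_imp_le)
    then show "sw a ^ n / (sw a * sw a * sw a ^ (k - 1)) \<le> sw a ^ (n - j) / sw a ^ (k - 1 - j)"
      unfolding e by (simp add: mult_ac)
  qed (use r mp in \<open>auto simp: d_def less_imp_le intro!: mult_nonneg_nonneg prod_nonneg\<close>)
  also have "\<dots> = 2 * 4 ^ k * sqrt (real n) * \<nu> * hn n F"
    unfolding \<nu> using n by (simp add: r_def)
  finally show ?thesis unfolding \<nu>_def a_def .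
qed

text \<open>From \<open>y \<le> exp y\<close> at \<open>y = x / (2 * k)\<close>, raised to the power
  \<open>k\<close>.\<close>

lemma power_le_exp:
  assumes "(x::real) \<ge> 0"
  shows "x ^ k \<le> (2 * real k) ^ k * exp (x / 2)"
proof (cases "k = 0")
  case True
  then show ?thesis using assms by simp
next
  case False
  have "(x / (2 * real k)) ^ k \<le> exp (x / (2 * real k)) ^ k"
    using assms exp_ge_add_one_self[of "x / (2 * real k)"] by (intro power_mono) (linarith, simp)
  also have "\<dots> = exp (x / 2)" using False by (simp add: exp_of_nat_mult[symmetric])
  finally show ?thesis using False by (simp add: power_divide divide_le_eq mult.commute)
qed

lemma nn_integral_gaussian_cL:
  assumes "\<alpha> > 0"
  shows "(\<integral>\<^sup>+c. (\<Prod>l<k. ennreal (exp (- (\<alpha> * (cmod (c l))\<^sup>2)))) \<partial>cL k) = ennreal ((pi / \<alpha>) ^ k)"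
proof -
  have "(\<integral>\<^sup>+x. ennreal (exp (- (cmod x)\<^sup>2)) \<partial>lborel) = ennreal ((cmod (of_real (sqrt \<alpha>)))\<^sup>2) * (\<integral>\<^sup>+x. ennreal (exp (- (cmod (of_real (sqrt \<alpha>) * x))\<^sup>2)) \<partial>lborel)"
    using assms by (intro nn_integral_complex_mult) auto
  then have "ennreal pi = ennreal \<alpha> * (\<integral>\<^sup>+x. ennreal (exp (- (\<alpha> * (cmod x)\<^sup>2))) \<partial>lborel)"
    using assms by (simp add: nn_integral_complex_gaussian norm_mult power_mult_distrib)
  then have "ennreal (1 / \<alpha>) * ennreal pi = (ennreal (1 / \<alpha>) * ennreal \<alpha>) * (\<integral>\<^sup>+x. ennreal (exp (- (\<alpha> * (cmod x)\<^sup>2))) \<partial>lborel)"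
    by (simp add: mult.assoc)
  then have "(\<integral>\<^sup>+x. ennreal (exp (- (\<alpha> * (cmod x)\<^sup>2))) \<partial>lborel) = ennreal (pi / \<alpha>)"
    using assms by (simp add: ennreal_mult[symmetric])
  moreover have "(\<integral>\<^sup>+c. (\<Prod>l<k. ennreal (exp (- (\<alpha> * (cmod (c l))\<^sup>2)))) \<partial>cL k) = (\<Prod>l<k. \<integral>\<^sup>+x. ennreal (exp (- (\<alpha> * (cmod x)\<^sup>2))) \<partial>lborel)"
    by (rule cL.product_nn_integral_prod) auto
  ultimately show ?thesis using assms by (simp add: ennreal_power)
qed

lemma hn_sum_le: "hn n (\<Sum>i\<in>A. f i) \<le> (\<Sum>i\<in>A. hn n (f i))"
proof (induction A rule: infinite_finite_induct)
  case (insert x F)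
  then show ?case using hn_triangle[of n "f x" "\<Sum>i\<in>F. f i"] by simp
qed (simp_all add: hn_def)

lemma prod_mono_ennreal:
  fixes f g :: "'a \<Rightarrow> ennreal"
  shows "(\<And>i. i \<in> A \<Longrightarrow> f i \<le> g i) \<Longrightarrow> prod f A \<le> prod g A"
  by (induction A rule: infinite_finite_induct) (auto intro: mult_mono)

text \<open>When points collide, numerator and denominator share the factor \<open>P\<close>, the
  product of the \<open>|\<nu> j|^2\<close>, which cancels. The moment is at most a constant times
  \<open>n ^ k * P * T\<close>, as each \<open>|u j|^2\<close> is at most a multiple of
  \<open>n * |\<nu> j|^2\<close> times the form; the total is at least a constant times
  \<open>P * T\<close>, with the coefficients of the Newton polynomials as coordinates for the
  values.\<close>

lemma zero_density_bound:
  "\<exists>K>0. \<forall>n z. n > 0 \<and> 2 * k \<le> n \<and> inj_on z {..<k} \<longrightarrow> zero_density n k z \<le> ennreal (K * real n ^ k)"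
proof -
  define K' where "K' = (1 + sqrt (real k)) ^ k"
  have K'1: "K' \<ge> 1" unfolding K'_def by (rule one_le_power) simp
  \<comment> \<open>\<open>real (Suc k) * K'\<^sup>2\<close> is a Cauchy-Schwarz constant for the
    squared norm of a combination of \<open>k\<close> Newton polynomials, \<open>Suc\<close> keeping
    it positive for \<open>k = 0\<close>; the 2 comes from \<open>nrm2_add_le\<close>.\<close>
  define \<alpha> where "\<alpha> = 2 * (real (Suc k) * K'\<^sup>2)"
  have \<alpha>: "\<alpha> > 0" using K'1 by (simp add: \<alpha>_def)
  define K where "K = (((2 * 4 ^ k)\<^sup>2) ^ k * ((2 * real k) ^ k * 2 ^ k)) * ((\<alpha> / pi) ^ k * 2 ^ k)"
  have K: "K > 0" using \<alpha> by (cases "k = 0") (auto simp: K_def)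
  have "zero_density n k z \<le> ennreal (K * real n ^ k)" if n: "n > 0" "2 * k \<le> n" and inj: "inj_on z {..<k}" for n z
  proof -
    have k: "2 * k \<le> Suc n" and kn: "k \<le> n" using n by auto
    note [measurable] = measurable_qform_u[OF inj k]
    define N where "N l = newton n (map z [0..<l]) (z l)" for l
    define \<nu> where "\<nu> l = poly (N l) (z l)" for l
    define T where "T = section_at n k z 1"
    define P where "P = (\<Prod>j<k. ennreal ((cmod (\<nu> j))\<^sup>2))"
    have \<nu>nz: "\<nu> l \<noteq> 0" if l: "l < k" for l
    proof -
      have "z l \<noteq> z i" if "i < l" for i using inj_onD[OF inj, of l i] l that by auto
      then have "(\<Prod>i<l. z l - z i) \<noteq> 0" by simp
      moreover have "prod_list (map (\<lambda>b. sw b * capped_dist (1 / sqrt (real n)) (z l) b) A) \<noteq> 0" for A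
        using n capped_dist_pos[of "1 / sqrt (real n)" "z l"] by (induction A) (auto simp: less_imp_neq[THEN not_sym])
      ultimately show ?thesis unfolding \<nu>_def N_def using l kn
        by (subst poly_newton_center) (auto simp: lrootp_map poly_rootp simp del: map_map)
    qed
    have Nvan: "poly (N l) (z i) = 0" if "i < l" for i l
      unfolding N_def newton_def using that by (auto simp: lrootp_map poly_rootp)
    have dN: "degree (N l) \<le> n" if "l < k" for l
      unfolding N_def using that kn by (intro degree_newton) simp
    have hN: "hn n (N l) \<le> K'" if "l < k" for l
    proof -
      have "hn n (N l) \<le> (1 + sqrt (real l)) ^ l"
        using hn_newton[of "map z [0..<l]" n "z l"] that kn n by (simp add: N_def)
      also have "\<dots> \<le> (1 + sqrt (real k)) ^ l" using that by (intro power_mono) auto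
      also have "\<dots> \<le> K'" unfolding K'_def using that by (intro power_increasing) auto
      finally show ?thesis .
    qed
    define S where "S = (2 * 4 ^ k)\<^sup>2 * real n"
    have S0: "S \<ge> 0" by (simp add: S_def)
    have M: "jet_moment n k z \<le> ennreal (S ^ k * ((2 * real k) ^ k * 2 ^ k)) * P * T"
    proof -
      have pt: "(\<Prod>j<k. ennreal ((cmod (u j))\<^sup>2)) * ennreal (exp (- qform n k z (\<lambda>_. 0) u)) \<le>
        ennreal (S ^ k * (2 * real k) ^ k) * P * ennreal (exp (- (1 / 2 * qform n k z (\<lambda>_. 0) u)))" for u
      proof -
        define F where "F = minpoly n k z (\<lambda>_. 0) u"
        define w where "w = qform n k z (\<lambda>_. 0) u"
        have w: "w = (hn n F)\<^sup>2" by (simp add: w_def qform_def F_def hn_sq)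
        have F: "degree F \<le> n" "has_jet k z (\<lambda>_. 0) u F"
          unfolding F_def by (rule kers_degree[OF minpoly_kers[OF inj k]], rule minpoly_jet[OF inj k])
        have "ennreal ((cmod (u j))\<^sup>2) \<le> ennreal S * ennreal ((cmod (\<nu> j))\<^sup>2) * ennreal w" if j: "j < k" for j
        proof -
          have "cmod (poly (pderiv F) (z j)) \<le> 2 * 4 ^ k * sqrt (real n) * cmod (\<nu> j) * hn n F"
            unfolding \<nu>_def N_def using F by (intro jet_derivative_bound[OF n(1) kn _ _ inj j]) (auto simp: has_jet_def)
          then have "(cmod (u j))\<^sup>2 \<le> (2 * 4 ^ k * sqrt (real n) * cmod (\<nu> j) * hn n F)\<^sup>2"
            using F(2) j by (intro power_mono) (auto simp: has_jet_def)
          also have "\<dots> = S * (cmod (\<nu> j))\<^sup>2 * w" by (simp add: S_def w power_mult_distrib)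
          finally show ?thesis using S0 by (simp add: ennreal_mult[symmetric] w ennreal_leI)
        qed
        then have "(\<Prod>j<k. ennreal ((cmod (u j))\<^sup>2)) \<le> (\<Prod>j<k. ennreal S * ennreal ((cmod (\<nu> j))\<^sup>2) * ennreal w)"
          by (intro prod_mono_ennreal) auto
        also have "\<dots> = ennreal (S ^ k) * P * ennreal (w ^ k)"
          unfolding P_def using S0 by (simp add: prod.distrib ennreal_power w)
        finally have "(\<Prod>j<k. ennreal ((cmod (u j))\<^sup>2)) * ennreal (exp (- w)) \<le> ennreal (S ^ k) * P * ennreal (w ^ k) * ennreal (exp (- w))"
          by (rule mult_right_mono) simp
        also have "\<dots> = ennreal (S ^ k) * P * ennreal (w ^ k * exp (- w))"
          by (simp add: ennreal_mult w mult.assoc)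
        \<comment> \<open>Half of the exponential pays for the power \<open>w ^ k\<close>; the half
          that remains is turned into \<open>T\<close> by rescaling
          \<open>section_at\<close>.\<close>
        also have "\<dots> \<le> ennreal (S ^ k) * P * ennreal ((2 * real k) ^ k * exp (- (1 / 2 * w)))"
        proof (intro mult_left_mono ennreal_leI)
          have "w ^ k * exp (- w) \<le> (2 * real k) ^ k * exp (w / 2) * exp (- w)"
            by (intro mult_right_mono power_le_exp) (auto simp: w)
          then show "w ^ k * exp (- w) \<le> (2 * real k) ^ k * exp (- (1 / 2 * w))"
            by (simp add: mult.assoc exp_add[symmetric])
        qed simp
        also have "\<dots> = ennreal (S ^ k * (2 * real k) ^ k) * P * ennreal (exp (- (1 / 2 * w)))"
          using S0 by (simp add: ennreal_mult mult_ac)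
        finally show ?thesis by (simp add: w_def)
      qed
      have T2: "section_at n k z (1 / 2) = ennreal (2 ^ k) * T"
      proof -
        have "ennreal (2 ^ k) * T = (ennreal (2 ^ k) * ennreal ((1 / 2) ^ k)) * section_at n k z (1 / 2)"
          unfolding T_def section_at_scale[OF inj k, of "1 / 2", simplified] by (simp add: mult.assoc)
        also have "ennreal (2 ^ k) * ennreal ((1 / 2) ^ k) = 1"
          by (simp add: ennreal_mult[symmetric] power_mult_distrib[symmetric])
        finally show ?thesis by simp
      qed
      have "jet_moment n k z \<le> (\<integral>\<^sup>+u. ennreal (S ^ k * (2 * real k) ^ k) * P * ennreal (exp (- (1 / 2 * qform n k z (\<lambda>_. 0) u))) \<partial>cL k)"
        unfolding jet_moment_def by (intro nn_integral_mono pt)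
      also have "\<dots> = ennreal (S ^ k * (2 * real k) ^ k) * P * section_at n k z (1 / 2)"
        unfolding section_at_def by (rule nn_integral_cmult) measurable
      also have "\<dots> = ennreal (S ^ k * ((2 * real k) ^ k * 2 ^ k)) * P * T"
        unfolding T2 using S0 by (simp add: ennreal_mult mult_ac)
      finally show ?thesis .
    qed
    have N: "P * (ennreal ((pi / \<alpha>) ^ k) * (ennreal ((1 / 2) ^ k) * T)) \<le> jet_total n k z"
    proof -
      define \<Psi> where "\<Psi> v = (\<integral>\<^sup>+u. ennreal (exp (- qform n k z v u)) \<partial>cL k)" for v
      have [measurable]: "\<Psi> \<in> borel_measurable (cL k)"
        using measurable_section[OF inj k, of 1] by (simp add: \<Psi>_def[abs_def])
      define A where "A i x = (\<Sum>l<i. x l * poly (N l) (z i))" for i and x :: "nat \<Rightarrow> complex"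
      \<comment> \<open>The values at the points of the combination of the \<open>N l\<close> with
        coefficients \<open>c l\<close>. As \<open>N l\<close> vanishes at the points before
        \<open>z l\<close>, the map is triangular with diagonal \<nu>.\<close>
      define V where "V c = (\<lambda>i\<in>{..<k}. A i (restrict c {..<i}) + \<nu> i * c i)" for c
      have tri: "jet_total n k z = P * (\<integral>\<^sup>+c. \<Psi> (V c) \<partial>cL k)"
        unfolding jet_total_def \<Psi>_def[symmetric] P_def V_def
      proof (rule nn_integral_cL_triangular[OF \<nu>nz])
        show "A i \<in> borel_measurable (cL i)" for i unfolding A_def by measurable
      qed auto
      have T2: "section_at n k z 2 = ennreal ((1 / 2) ^ k) * T"
      proof -
        have "ennreal ((1 / 2) ^ k) * T = (ennreal ((1 / 2) ^ k) * ennreal (2 ^ k)) * section_at n k z 2"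
          unfolding T_def section_at_scale[OF inj k, of 2, simplified] by (simp add: mult.assoc)
        also have "ennreal ((1 / 2) ^ k) * ennreal (2 ^ k) = 1"
          by (simp add: ennreal_mult[symmetric] power_mult_distrib[symmetric])
        finally show ?thesis by simp
      qed
      \<comment> \<open>Given \<open>c\<close>, the polynomial \<open>h\<close> has the values
        \<open>V c\<close>. Shifting \<open>u\<close> by its derivatives \<open>u0\<close> and
        bounding the norm of a sum by \<open>nrm2_add_le\<close> separates the dependence on
        \<open>c\<close> from that on \<open>u\<close>.\<close>
      have low: "(\<Prod>l<k. ennreal (exp (- (\<alpha> * (cmod (c l))\<^sup>2)))) * section_at n k z 2 \<le> \<Psi> (V c)" for c
      proof -
        define h where "h = (\<Sum>l<k. smult (c l) (N l))"
        define u0 where "u0 i = poly (pderiv h) (z i)" for i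
        have dh: "degree h \<le> n" unfolding h_def
          by (intro degree_sum_le) (auto intro!: order_trans[OF degree_smult_le] dN)
        have hv: "poly h (z i) = V c i" if i: "i < k" for i
        proof -
          have "poly h (z i) = (\<Sum>l<k. c l * poly (N l) (z i))" by (simp add: h_def poly_sum)
          also have "\<dots> = (\<Sum>l<Suc i. c l * poly (N l) (z i))"
            using i by (intro sum.mono_neutral_right) (auto simp: Nvan)
          finally show ?thesis using i by (simp add: V_def A_def \<nu>_def mult.commute)
        qed
        have jh: "has_jet k z (V c) u0 h" by (simp add: has_jet_def hv u0_def)
        have nh: "2 * nrm2 n h \<le> \<alpha> * (\<Sum>l<k. (cmod (c l))\<^sup>2)"
        proof -
          have "hn n h \<le> (\<Sum>l<k. hn n (smult (c l) (N l)))" unfolding h_def by (rule hn_sum_le)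
          also have "\<dots> \<le> (\<Sum>l<k. cmod (c l) * K')"
            unfolding hn_smult by (intro sum_mono mult_left_mono hN) auto
          finally have "(hn n h)\<^sup>2 \<le> (\<Sum>l<k. cmod (c l) * K')\<^sup>2" by (rule power_mono) simp
          also have "\<dots> \<le> (\<Sum>l<k. (cmod (c l) * K')\<^sup>2) * real (card {..<k})"
            by (rule sum_squared_le_sum_of_squares)
          also have "\<dots> = K'\<^sup>2 * real k * (\<Sum>l<k. (cmod (c l))\<^sup>2)"
            by (simp add: power_mult_distrib sum_distrib_left mult_ac)
          also have "\<dots> \<le> K'\<^sup>2 * real (Suc k) * (\<Sum>l<k. (cmod (c l))\<^sup>2)"
            by (intro mult_right_mono mult_left_mono sum_nonneg) auto
          finally show ?thesis by (simp add: hn_sq \<alpha>_def mult_ac)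
        qed
        have qb: "qform n k z (V c) (\<lambda>i\<in>{..<k}. u0 i + 1 * u i) \<le> 2 * nrm2 n h + 2 * qform n k z (\<lambda>_. 0) u" for u
        proof -
          have "qform n k z (V c) (\<lambda>i\<in>{..<k}. u0 i + 1 * u i) = qform n k z (\<lambda>i. V c i + 0) (\<lambda>i. u0 i + u i)"
            by (rule qform_cong) auto
          also have "\<dots> = nrm2 n (minpoly n k z (V c) u0 + minpoly n k z (\<lambda>_. 0) u)"
            unfolding qform_def minpoly_add[OF inj k] ..
          also have "\<dots> \<le> 2 * qform n k z (V c) u0 + 2 * qform n k z (\<lambda>_. 0) u"
            unfolding qform_def by (rule nrm2_add_le)
          also have "\<dots> \<le> 2 * nrm2 n h + 2 * qform n k z (\<lambda>_. 0) u"
            using qform_le[OF inj k dh jh] by simp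
          finally show ?thesis .
        qed
        have "(\<Prod>l<k. ennreal (exp (- (\<alpha> * (cmod (c l))\<^sup>2)))) = ennreal (exp (- (\<alpha> * (\<Sum>l<k. (cmod (c l))\<^sup>2))))"
          by (simp add: prod_ennreal exp_sum[symmetric] sum_negf sum_distrib_left)
        also have "\<dots> \<le> ennreal (exp (- (2 * nrm2 n h)))" using nh by (intro ennreal_leI) simp
        finally have "(\<Prod>l<k. ennreal (exp (- (\<alpha> * (cmod (c l))\<^sup>2)))) * section_at n k z 2 \<le> ennreal (exp (- (2 * nrm2 n h))) * section_at n k z 2"
          by (rule mult_right_mono) simp
        also have "\<dots> = (\<integral>\<^sup>+u. ennreal (exp (- (2 * nrm2 n h))) * ennreal (exp (- (2 * qform n k z (\<lambda>_. 0) u))) \<partial>cL k)"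
          unfolding section_at_def by (rule nn_integral_cmult[symmetric]) measurable
        also have "\<dots> \<le> (\<integral>\<^sup>+u. ennreal (exp (- qform n k z (V c) (\<lambda>i\<in>{..<k}. u0 i + 1 * u i))) \<partial>cL k)"
        proof (rule nn_integral_mono)
          fix u
          have "ennreal (exp (- (2 * nrm2 n h))) * ennreal (exp (- (2 * qform n k z (\<lambda>_. 0) u))) =
            ennreal (exp (- (2 * nrm2 n h + 2 * qform n k z (\<lambda>_. 0) u)))"
            by (simp add: ennreal_mult[symmetric] exp_add[symmetric])
          also have "\<dots> \<le> ennreal (exp (- qform n k z (V c) (\<lambda>i\<in>{..<k}. u0 i + 1 * u i)))"
            by (intro ennreal_leI exp_le_cancel_iff[THEN iffD2] le_imp_neg_le qb)
          finally show "ennreal (exp (- (2 * nrm2 n h))) * ennreal (exp (- (2 * qform n k z (\<lambda>_. 0) u))) \<le>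
            ennreal (exp (- qform n k z (V c) (\<lambda>i\<in>{..<k}. u0 i + 1 * u i)))" .
        qed
        also have "\<dots> = \<Psi> (V c)"
          unfolding \<Psi>_def by (subst nn_integral_cL_affine[where s="\<lambda>_. 1" and a=u0]) auto
        finally show ?thesis .
      qed
      have "ennreal ((pi / \<alpha>) ^ k) * section_at n k z 2 = (\<integral>\<^sup>+c. (\<Prod>l<k. ennreal (exp (- (\<alpha> * (cmod (c l))\<^sup>2)))) * section_at n k z 2 \<partial>cL k)"
        unfolding nn_integral_gaussian_cL[OF \<alpha>, symmetric] by (rule nn_integral_multc[symmetric]) measurable
      also have "\<dots> \<le> (\<integral>\<^sup>+c. \<Psi> (V c) \<partial>cL k)" by (intro nn_integral_mono low)
      finally show ?thesis unfolding tri T2 by (rule mult_left_mono) simp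
    qed
    have RN: "zero_density n k z * jet_total n k z = jet_moment n k z" "jet_total n k z \<noteq> 0" "jet_total n k z \<noteq> \<infinity>"
      using zero_density_eq[OF inj k] by auto
    have "zero_density n k z * jet_total n k z \<le> ennreal (S ^ k * ((2 * real k) ^ k * 2 ^ k)) * P * T"
      unfolding RN(1) by (rule M)
    also have "\<dots> = ennreal (K * real n ^ k) * (P * (ennreal ((pi / \<alpha>) ^ k) * (ennreal ((1 / 2) ^ k) * T)))"
    proof -
      have "S ^ k * ((2 * real k) ^ k * 2 ^ k) = K * real n ^ k * ((pi / \<alpha>) ^ k * (1 / 2) ^ k)"
        using \<alpha> by (simp add: K_def S_def power_mult_distrib power_divide)
      then show ?thesis using \<alpha> K by (simp add: ennreal_mult mult_ac)
    qed
    also have "\<dots> \<le> ennreal (K * real n ^ k) * jet_total n k z" by (intro mult_left_mono N) simp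
    finally have "zero_density n k z * jet_total n k z / jet_total n k z \<le> ennreal (K * real n ^ k) * jet_total n k z / jet_total n k z"
      by (rule divide_right_mono_ennreal)
    then show ?thesis using RN(2,3) by (simp add: ennreal_mult_divide_eq)
  qed
  then show ?thesis using K by blast
qed

subsection \<open>From box averages to point functions\<close>

text \<open>For disjoint discs and \<open>k \<le> n\<close> this is the expected product of the zero
  counts in the discs; divided by \<open>disc_area r ^ k\<close> it is an average of the
  density.\<close>

definition box_mass :: "nat \<Rightarrow> nat \<Rightarrow> (nat \<Rightarrow> complex) \<Rightarrow> real \<Rightarrow> ennreal" where
  "box_mass n k z r = (\<integral>\<^sup>+w. (\<Prod>j<k. indicator (ball (z j) r) (w j)) * zero_density n k w \<partial>cL k)"

definition disc_area :: "real \<Rightarrow> ennreal" where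
  "disc_area r = emeasure lborel (ball (0 :: complex) r)"

lemma emeasure_disc: "r > 0 \<Longrightarrow> emeasure lborel (ball (c :: complex) r) = disc_area r"
  by (simp add: disc_area_def emeasure_ball)

lemma disc_area_pos: "r > 0 \<Longrightarrow> disc_area r \<noteq> 0" "disc_area r \<noteq> \<infinity>"
proof -
  show "disc_area r \<noteq> \<infinity>" unfolding disc_area_def using emeasure_lborel_ball_finite[of "0::complex" r] by auto
  show "disc_area r \<noteq> 0" if "r > 0"
  proof -
    have "unit_ball_vol 2 \<noteq> 0" using unit_ball_vol_pos[of 2] by linarith
    then show ?thesis using that by (simp add: disc_area_def emeasure_ball)
  qed
qed

lemma measurable_box_indicator:
  "(\<lambda>w. \<Prod>j<k. indicator (ball (z j) r) (w j) :: ennreal) \<in> borel_measurable (cL k)"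
proof (rule borel_measurable_prod_ennreal)
  fix j
  have "(\<lambda>w. w j) \<in> borel_measurable (cL k)" by measurable
  then show "(\<lambda>w. indicator (ball (z j) r) (w j) :: ennreal) \<in> borel_measurable (cL k)"
    by (rule measurable_compose) (intro borel_measurable_indicator, simp)
qed

lemma nn_integral_box:
  assumes "r > 0"
  shows "(\<integral>\<^sup>+w. (\<Prod>j<k. indicator (ball (z j) r) (w j)) \<partial>cL k) = disc_area r ^ k"
proof -
  have "(\<integral>\<^sup>+w. (\<Prod>j<k. indicator (ball (z j) r) (w j)) \<partial>cL k) = (\<Prod>j<k. \<integral>\<^sup>+x. indicator (ball (z j) r) x \<partial>lborel)"
    by (rule cL.product_nn_integral_prod) (auto intro!: borel_measurable_indicator)
  then show ?thesis using assms by (simp add: emeasure_disc)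
qed

lemma point_function_near:
  assumes cont: "continuous_on {z. inj_on z {..<k}} (\<lambda>z. \<rho> (map z [0..<k]))"
    and inj: "inj_on z {..<k}" and \<eta>: "\<eta> > 0"
  shows "\<forall>\<^sub>F r in at_right 0. \<forall>w. (\<forall>j<k. w j \<in> ball (z j) r) \<longrightarrow> inj_on w {..<k} \<and>
    \<bar>\<rho> (map w [0..<k]) - (\<rho> (map z [0..<k]) :: real)\<bar> < \<eta>"
proof -
  have sep: "\<forall>\<^sub>F r in at_right 0. \<forall>i\<in>{..<k}. \<forall>j\<in>{..<k}. i \<noteq> j \<longrightarrow> 2 * r < dist (z i) (z j)"
  proof (intro eventually_ball_finite ballI finite_lessThan)
    fix i j assume ij: "i \<in> {..<k}" "j \<in> {..<k}"
    show "\<forall>\<^sub>F r in at_right 0. i \<noteq> j \<longrightarrow> 2 * r < dist (z i) (z j)"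
    proof (cases "i = j")
      case False
      then have "dist (z i) (z j) > 0" using inj_onD[OF inj] ij by auto
      then show ?thesis unfolding eventually_at_right_field
        by (intro exI[of _ "dist (z i) (z j) / 2"]) auto
    qed simp
  qed
  obtain U where U: "open U" "z \<in> U"
    "\<And>w. w \<in> {z. inj_on z {..<k}} \<Longrightarrow> w \<in> U \<Longrightarrow> \<rho> (map w [0..<k]) \<in> ball (\<rho> (map z [0..<k])) \<eta>"
    using cont[unfolded continuous_on_topological, rule_format, of z "ball (\<rho> (map z [0..<k])) \<eta>"] inj \<eta> by auto
  have "openin (product_topology (\<lambda>_. euclidean) UNIV) U" using U(1) by (simp only: open_fun_def)
  from product_topology_open_contains_basis[OF this U(2)]
  obtain X where X: "z \<in> (\<Pi>\<^sub>E i\<in>UNIV. X i)" "\<forall>i. openin euclidean (X i)" "(\<Pi>\<^sub>E i\<in>UNIV. X i) \<subseteq> U"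
    by (elim exE conjE)
  have zX: "z i \<in> X i" for i using PiE_mem[of z UNIV X i] X(1) by simp
  have balls: "\<forall>\<^sub>F r in at_right 0. ball (z j) r \<subseteq> X j" for j
  proof -
    have "open (X j)" using X(2) by (simp add: open_openin[symmetric])
    then obtain e where e: "e > 0" "ball (z j) e \<subseteq> X j" using zX[of j] by (rule openE)
    have "ball (z j) r \<subseteq> X j" if "r < e" for r
      using subset_ball[of r e "z j"] that e(2) by simp
    then show ?thesis unfolding eventually_at_right_field using e(1) by blast
  qed
  have "\<forall>\<^sub>F r in at_right 0. \<forall>j\<in>{..<k}. ball (z j) r \<subseteq> X j"
    by (rule eventually_ball_finite) (simp_all add: balls)
  with sep show ?thesis
  proof eventually_elim
    case (elim r)
    show ?case
    proof (intro allI impI)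
      fix w assume w: "\<forall>j<k. w j \<in> ball (z j) r"
      have injw: "inj_on w {..<k}"
      proof (rule inj_onI, rule ccontr)
        fix i j assume *: "i \<in> {..<k}" "j \<in> {..<k}" "w i = w j" "i \<noteq> j"
        have "dist (z i) (w i) < r" "dist (z j) (w i) < r" using w * by auto
        then have "dist (z i) (z j) < 2 * r"
          using dist_triangle2[of "z i" "z j" "w i"] by linarith
        then show False using elim(1) * by force
      qed
      \<comment> \<open>A basic neighbourhood of \<open>z\<close> mentions every coordinate, so
        those from \<open>k\<close> on are reset to \<open>z\<close>; \<rho> reads only the first
        \<open>k\<close>.\<close>
      define w' where "w' j = (if j < k then w j else z j)" for j
      have m: "map w' [0..<k] = map w [0..<k]" by (auto simp: w'_def)
      have "w' j \<in> X j" for j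
      proof (cases "j < k")
        case True
        then have "w j \<in> ball (z j) r" using w by blast
        then show ?thesis using elim(2) True by (auto simp only: w'_def lessThan_iff if_True)
      qed (simp add: w'_def zX)
      then have "w' \<in> (\<Pi>\<^sub>E i\<in>UNIV. X i)" by (intro PiE_I) simp_all
      then have "w' \<in> U" using X(3) by (rule subsetD[rotated])
      moreover have "inj_on w' {..<k}" using injw by (auto simp: w'_def inj_on_def)
      ultimately have "\<rho> (map w' [0..<k]) \<in> ball (\<rho> (map z [0..<k])) \<eta>" using U(3) by blast
      then show "inj_on w {..<k} \<and> \<bar>\<rho> (map w [0..<k]) - \<rho> (map z [0..<k])\<bar> < \<eta>"
        using injw unfolding m by (simp add: dist_real_def abs_minus_commute)
    qed
  qed
qed

text \<open>On disjoint discs the defining identity of \<rho> and the formula for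
  \<open>zero_density\<close> express the same expectation, so the box mass is also the integral of
  \<rho>, which is nearly constant there.\<close>

lemma box_mass_approx:
  assumes pf: "is_point_function n k \<rho>" and kn: "k \<le> n" and inj: "inj_on z {..<k}" and \<eta>: "\<eta> > 0"
  shows "\<forall>\<^sub>F r in at_right 0. box_mass n k z r \<le> ennreal (\<rho> (map z [0..<k]) + \<eta>) * disc_area r ^ k \<and>
    ennreal (\<rho> (map z [0..<k]) - \<eta>) * disc_area r ^ k \<le> box_mass n k z r"
proof -
  have cont: "continuous_on {z. inj_on z {..<k}} (\<lambda>z. \<rho> (map z [0..<k]))"
    and int: "\<And>B. (\<forall>j<k. B j \<in> sets borel) \<and> disjoint_family_on B {..<k} \<Longrightarrow>
        (\<integral>\<^sup>+ a. (\<Prod>j<k. of_nat (card (zero_set n a \<inter> B j))) \<partial>coeff_law n) =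
        (\<integral>\<^sup>+ z \<in> PiE {..<k} B. ennreal (\<rho> (map z [0..<k])) \<partial>cL k)"
    using pf unfolding is_point_function_def by blast+
  have pos: "\<forall>\<^sub>F r in at_right (0::real). r > 0" by (simp add: eventually_at_right_less)
  from point_function_near[OF cont inj \<eta>] pos show ?thesis
  proof eventually_elim
    case (elim r)
    define B where "B j = ball (z j) r" for j
    have disj: "disjoint_family_on B {..<k}"
      unfolding disjoint_family_on_def
    proof (intro ballI impI equals0I)
      fix i j x assume *: "i \<in> {..<k}" "j \<in> {..<k}" "i \<noteq> j" "x \<in> B i \<inter> B j"
      \<comment> \<open>A common point \<open>x\<close> of two discs would give a tuple in the box
        with a repeated entry, against the injectivity just obtained.\<close>
      define w where "w l = (if l = i \<or> l = j then x else z l)" for l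
      have "\<forall>l<k. w l \<in> ball (z l) r" using * elim(2) by (auto simp: w_def B_def)
      then have "inj_on w {..<k}" using elim(1) by blast
      then show False using * inj_onD[of w "{..<k}" i j] by (auto simp: w_def)
    qed
    have "box_mass n k z r = (\<integral>\<^sup>+ a. (\<Prod>j<k. of_nat (card (zero_set n a \<inter> B j))) \<partial>coeff_law n)"
      unfolding box_mass_def B_def[symmetric] by (rule nn_integral_zero_density[symmetric, OF kn _ disj]) (simp add: B_def)
    also have "\<dots> = (\<integral>\<^sup>+ w \<in> PiE {..<k} B. ennreal (\<rho> (map w [0..<k])) \<partial>cL k)"
      by (rule int) (intro conjI allI impI disj, simp add: B_def)
    finally have bm: "box_mass n k z r = (\<integral>\<^sup>+ w \<in> PiE {..<k} B. ennreal (\<rho> (map w [0..<k])) \<partial>cL k)" .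
    have ind: "indicator (PiE {..<k} B) w = (\<Prod>j<k. indicator (ball (z j) r) (w j) :: ennreal)" if w: "w \<in> space (cL k)" for w
    proof (cases "w \<in> PiE {..<k} B")
      case True
      then have "\<forall>j\<in>{..<k}. indicator (ball (z j) r) (w j) = (1 :: ennreal)"
        by (auto simp: B_def PiE_def Pi_def)
      then have "(\<Prod>j<k. indicator (ball (z j) r) (w j) :: ennreal) = 1" by (rule prod.neutral)
      then show ?thesis using True by simp
    next
      case False
      then obtain j where "j < k" "w j \<notin> ball (z j) r" using w unfolding B_def by (auto simp: space_PiM PiE_def Pi_def)
      then have "(\<Prod>j<k. indicator (ball (z j) r) (w j) :: ennreal) = 0"
        by (intro prod_zero bexI[of _ j]) auto
      then show ?thesis using False by simp
    qed
    note meas = measurable_box_indicator[where k=k and z=z and r=r]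
    have near: "\<bar>\<rho> (map w [0..<k]) - \<rho> (map z [0..<k])\<bar> < \<eta>" if "w \<in> PiE {..<k} B" for w
      using elim(1) that by (auto simp: B_def PiE_def Pi_def)
    have const: "(\<integral>\<^sup>+w. c * indicator (PiE {..<k} B) w \<partial>cL k) = c * disc_area r ^ k" for c
    proof -
      have "(\<integral>\<^sup>+w. c * indicator (PiE {..<k} B) w \<partial>cL k) = (\<integral>\<^sup>+w. c * (\<Prod>j<k. indicator (ball (z j) r) (w j)) \<partial>cL k)"
        by (intro nn_integral_cong) (simp add: ind)
      also have "\<dots> = c * disc_area r ^ k"
        using meas elim(2) by (subst nn_integral_cmult) (simp_all add: nn_integral_box)
      finally show ?thesis .
    qed
    have "box_mass n k z r \<le> (\<integral>\<^sup>+w. ennreal (\<rho> (map z [0..<k]) + \<eta>) * indicator (PiE {..<k} B) w \<partial>cL k)"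
      unfolding bm
    proof (rule nn_integral_mono)
      fix w
      show "ennreal (\<rho> (map w [0..<k])) * indicator (PiE {..<k} B) w \<le> ennreal (\<rho> (map z [0..<k]) + \<eta>) * indicator (PiE {..<k} B) w"
      proof (cases "w \<in> PiE {..<k} B")
        case True
        then have "\<rho> (map w [0..<k]) \<le> \<rho> (map z [0..<k]) + \<eta>" using near[OF True] by linarith
        then show ?thesis unfolding indicator_simps(1)[OF True] mult_1_right by (rule ennreal_leI)
      next
        case False
        show ?thesis unfolding indicator_simps(2)[OF False] mult_zero_right by (rule order_refl)
      qed
    qed
    moreover have "(\<integral>\<^sup>+w. ennreal (\<rho> (map z [0..<k]) - \<eta>) * indicator (PiE {..<k} B) w \<partial>cL k) \<le> box_mass n k z r"
      unfolding bm
    proof (rule nn_integral_mono)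
      fix w
      show "ennreal (\<rho> (map z [0..<k]) - \<eta>) * indicator (PiE {..<k} B) w \<le> ennreal (\<rho> (map w [0..<k])) * indicator (PiE {..<k} B) w"
      proof (cases "w \<in> PiE {..<k} B")
        case True
        then have "\<rho> (map z [0..<k]) - \<eta> \<le> \<rho> (map w [0..<k])" using near[OF True] by linarith
        then show ?thesis unfolding indicator_simps(1)[OF True] mult_1_right by (rule ennreal_leI)
      next
        case False
        show ?thesis unfolding indicator_simps(2)[OF False] mult_zero_right by (rule order_refl)
      qed
    qed
    ultimately show ?case unfolding const by (rule conjI)
  qed
qed

lemma ennreal_mult_disc_cancel:
  assumes "r > 0" "a * disc_area r ^ k \<le> b * disc_area r ^ k"
  shows "a \<le> b"
proof -
  have nz: "disc_area r ^ k \<noteq> 0" "disc_area r ^ k \<noteq> \<top>"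
    using disc_area_pos[of r] assms(1) by (auto simp: power_eq_top_ennreal)
  have "a * disc_area r ^ k / disc_area r ^ k \<le> b * disc_area r ^ k / disc_area r ^ k"
    using assms(2) by (rule divide_right_mono_ennreal)
  then show ?thesis using nz by (simp add: ennreal_mult_divide_eq)
qed

lemma point_function_bound:
  assumes pf: "is_point_function n k \<rho>" and n: "n > 0" "2 * k \<le> n" and inj: "inj_on z {..<k}" and K: "K > 0"
    and bnd: "\<And>w. inj_on w {..<k} \<Longrightarrow> zero_density n k w \<le> ennreal K"
  shows "\<rho> (map z [0..<k]) \<le> K"
proof (rule field_le_epsilon)
  fix \<eta> :: real assume \<eta>: "\<eta> > 0"
  have cont: "continuous_on {z. inj_on z {..<k}} (\<lambda>z. \<rho> (map z [0..<k]))"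
    using pf unfolding is_point_function_def by blast
  have pos: "\<forall>\<^sub>F r in at_right (0::real). r > 0" by (simp add: eventually_at_right_less)
  have "k \<le> n" using n by simp
  from box_mass_approx[OF pf this inj \<eta>] point_function_near[OF cont inj \<eta>] pos
  have "\<forall>\<^sub>F r in at_right 0. r > 0 \<and> ennreal (\<rho> (map z [0..<k]) - \<eta>) * disc_area r ^ k \<le> box_mass n k z r \<and>
    (\<forall>w. (\<forall>j<k. w j \<in> ball (z j) r) \<longrightarrow> inj_on w {..<k})"
    by eventually_elim blast
  then obtain r where r: "r > 0" "ennreal (\<rho> (map z [0..<k]) - \<eta>) * disc_area r ^ k \<le> box_mass n k z r"
    "\<And>w. (\<forall>j<k. w j \<in> ball (z j) r) \<Longrightarrow> inj_on w {..<k}"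
    using eventually_happens'[OF trivial_limit_at_right_real] by blast
  note meas = measurable_box_indicator[where k=k and z=z and r=r]
  have "box_mass n k z r \<le> (\<integral>\<^sup>+w. ennreal K * (\<Prod>j<k. indicator (ball (z j) r) (w j)) \<partial>cL k)"
    unfolding box_mass_def
  proof (rule nn_integral_mono)
    fix w
    show "(\<Prod>j<k. indicator (ball (z j) r) (w j)) * zero_density n k w \<le> ennreal K * (\<Prod>j<k. indicator (ball (z j) r) (w j))"
    proof (cases "\<forall>j<k. w j \<in> ball (z j) r")
      case True
      then show ?thesis using bnd[OF r(3)[OF True]] by (simp add: mult.commute mult_left_mono)
    next
      case False
      then obtain j where "j < k" "w j \<notin> ball (z j) r" by blast
      then have "(\<Prod>j<k. indicator (ball (z j) r) (w j) :: ennreal) = 0"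
        by (intro prod_zero bexI[of _ j]) auto
      then show ?thesis by (simp only: mult_zero_left mult_zero_right order_refl)
    qed
  qed
  also have "\<dots> = ennreal K * disc_area r ^ k"
    using meas r(1) by (subst nn_integral_cmult) (simp_all add: nn_integral_box)
  finally have "ennreal (\<rho> (map z [0..<k]) - \<eta>) \<le> ennreal K"
    using ennreal_mult_disc_cancel[OF r(1)] r(2) order_trans by blast
  then show "\<rho> (map z [0..<k]) \<le> K + \<eta>" using K by (simp add: ennreal_le_iff2)
qed

lemma hdist_near:
  assumes "hdist a b > \<delta>"
  shows "\<forall>\<^sub>F r in at_right 0. \<forall>a'\<in>ball a r. \<forall>b'\<in>ball b r. hdist a' b' > \<delta>"
proof -
  have "continuous_on UNIV (\<lambda>w. hdist (fst w) (snd w))"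
    unfolding hdist_def sw_def by (intro continuous_intros) (auto simp: add_nonneg_eq_0_iff)
  then have "open ((\<lambda>w. hdist (fst w) (snd w)) -` {\<delta><..})"
    by (intro open_vimage) auto
  moreover have "(a, b) \<in> (\<lambda>w. hdist (fst w) (snd w)) -` {\<delta><..}" using assms by simp
  ultimately obtain A B where AB: "open A" "open B" "(a, b) \<in> A \<times> B" "A \<times> B \<subseteq> (\<lambda>w. hdist (fst w) (snd w)) -` {\<delta><..}"
    by (rule open_prod_elim)
  obtain e1 e2 where e: "e1 > 0" "ball a e1 \<subseteq> A" "e2 > 0" "ball b e2 \<subseteq> B"
    using AB openE by (metis mem_Sigma_iff)
  show ?thesis unfolding eventually_at_right_field
  proof (intro exI[of _ "min e1 e2"] conjI allI impI ballI)
    fix r a' b' assume "0 < r" "r < min e1 e2" "a' \<in> ball a r" "b' \<in> ball b r"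
    then have "a' \<in> A" "b' \<in> B" using e by auto
    then show "hdist a' b' > \<delta>" using AB(4) by auto
  qed (use e in auto)
qed

lemma interp_const_mono: "m \<le> m' \<Longrightarrow> interp_const m \<le> interp_const m'"
proof (rule lift_Suc_mono_le[of interp_const])
  fix m
  have "0 \<le> (1 + sqrt (real m)) ^ m * (4 ^ m * (1 + 2 * interp_const m))"
    using interp_const_ge_1[of m] by (intro mult_nonneg_nonneg) auto
  then show "interp_const m \<le> interp_const (Suc m)" unfolding interp_const.simps by linarith
qed

text \<open>The box averages satisfy both multiplicative estimates; the point functions inherit them by
  continuity.\<close>

lemma point_function_compare:
  assumes pf: "is_point_function n (p + q) \<rho>" "is_point_function n p \<rho>" "is_point_function n q \<rho>"
    and n: "n > 0" "2 * (p + q) \<le> n" and inj: "inj_on (append_fun p q x y) {..<p + q}"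
    and d: "0 < \<delta>" "\<And>i j. i < p \<Longrightarrow> j < q \<Longrightarrow> \<delta> < hdist (x i) (y j)"
    and \<epsilon>: "\<epsilon> = interp_const (2 * p) * interp_const (2 * q) * exp (5 - real n * \<delta>\<^sup>2 / 4)" "\<epsilon> \<le> 1 / 2"
  defines "a \<equiv> \<rho> (map (append_fun p q x y) [0..<p + q])" and "b \<equiv> \<rho> (map x [0..<p])" and "c \<equiv> \<rho> (map y [0..<q])"
    and "\<theta> \<equiv> (1 + 4 * \<epsilon>) ^ (2 * (p + q))"
  shows "a \<le> \<theta> * (b * c)" and "b * c \<le> \<theta> * a"
proof -
  let ?z = "append_fun p q x y"
  have k: "2 * (p + q) \<le> Suc n" and kn: "p + q \<le> n" "p \<le> n" "q \<le> n" using n by auto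
  note injs = inj_on_append_funD[OF inj]
  have \<epsilon>0: "0 \<le> \<epsilon>" unfolding \<epsilon>(1) using interp_const_ge_1[of "2 * p"] interp_const_ge_1[of "2 * q"]
    by (intro mult_nonneg_nonneg) auto
  have \<theta>: "\<theta> \<ge> 1" unfolding \<theta>_def using \<epsilon>0 by (intro one_le_power) simp
  have cont: "continuous_on {z. inj_on z {..<p + q}} (\<lambda>z. \<rho> (map z [0..<p + q]))"
    using pf(1) unfolding is_point_function_def by blast
  have "distinct (map z [0..<l]) \<longleftrightarrow> inj_on z {..<l}" for z :: "nat \<Rightarrow> complex" and l
    by (simp add: distinct_map atLeast0LessThan)
  then have nn: "a \<ge> 0" "b \<ge> 0" "c \<ge> 0"
    using pf inj injs unfolding is_point_function_def a_def b_def c_def by (metis length_map length_upt minus_nat.diff_0)+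
  have pos: "\<forall>\<^sub>F r in at_right (0::real). r > 0" by (simp add: eventually_at_right_less)
  have hd: "\<forall>\<^sub>F r in at_right 0. \<forall>i\<in>{..<p}. \<forall>j\<in>{..<q}. \<forall>a'\<in>ball (x i) r. \<forall>b'\<in>ball (y j) r. hdist a' b' > \<delta>"
    using d(2) by (intro eventually_ball_finite ballI finite_lessThan hdist_near) auto
  \<comment> \<open>The lower bounds are cut off at 0 by \<open>max\<close>, since a product of two
    negative numbers would spoil the second estimate.\<close>
  have main: "a - \<eta> \<le> \<theta> * ((b + \<eta>) * (c + \<eta>))" "max 0 (b - \<eta>) * max 0 (c - \<eta>) \<le> \<theta> * (a + \<eta>)" if \<eta>: "\<eta> > 0" for \<eta>
  proof -
    from box_mass_approx[OF pf(1) kn(1) inj \<eta>] box_mass_approx[OF pf(2) kn(2) injs(1) \<eta>]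
      box_mass_approx[OF pf(3) kn(3) injs(2) \<eta>] point_function_near[OF cont inj \<eta>] pos hd
    have "\<forall>\<^sub>F r in at_right 0. r > 0 \<and>
      (box_mass n (p + q) ?z r \<le> ennreal (a + \<eta>) * disc_area r ^ (p + q) \<and> ennreal (a - \<eta>) * disc_area r ^ (p + q) \<le> box_mass n (p + q) ?z r) \<and>
      (box_mass n p x r \<le> ennreal (b + \<eta>) * disc_area r ^ p \<and> ennreal (b - \<eta>) * disc_area r ^ p \<le> box_mass n p x r) \<and>
      (box_mass n q y r \<le> ennreal (c + \<eta>) * disc_area r ^ q \<and> ennreal (c - \<eta>) * disc_area r ^ q \<le> box_mass n q y r) \<and>
      (\<forall>w. (\<forall>j<p + q. w j \<in> ball (?z j) r) \<longrightarrow> inj_on w {..<p + q}) \<and>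
      (\<forall>i\<in>{..<p}. \<forall>j\<in>{..<q}. \<forall>a'\<in>ball (x i) r. \<forall>b'\<in>ball (y j) r. hdist a' b' > \<delta>)"
      unfolding a_def b_def c_def by eventually_elim blast
    then obtain r where r: "r > 0"
      and Ja: "box_mass n (p + q) ?z r \<le> ennreal (a + \<eta>) * disc_area r ^ (p + q)" "ennreal (a - \<eta>) * disc_area r ^ (p + q) \<le> box_mass n (p + q) ?z r"
      and Jb: "box_mass n p x r \<le> ennreal (b + \<eta>) * disc_area r ^ p" "ennreal (b - \<eta>) * disc_area r ^ p \<le> box_mass n p x r"
      and Jc: "box_mass n q y r \<le> ennreal (c + \<eta>) * disc_area r ^ q" "ennreal (c - \<eta>) * disc_area r ^ q \<le> box_mass n q y r"
      and near: "\<And>w. (\<forall>j<p + q. w j \<in> ball (?z j) r) \<Longrightarrow> inj_on w {..<p + q}"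
      and hdr: "\<And>i j a' b'. i < p \<Longrightarrow> j < q \<Longrightarrow> a' \<in> ball (x i) r \<Longrightarrow> b' \<in> ball (y j) r \<Longrightarrow> hdist a' b' > \<delta>"
       using eventually_happens'[OF trivial_limit_at_right_real] by blast
    define f where "f w = (\<Prod>j<p. indicator (ball (x j) r) (w j) :: ennreal)" for w
    define g where "g w = (\<Prod>j<q. indicator (ball (y j) r) (w j) :: ennreal)" for w
    have [measurable]: "f \<in> borel_measurable (cL p)" "g \<in> borel_measurable (cL q)"
      unfolding f_def[abs_def] g_def[abs_def] by (rule measurable_box_indicator)+
    have split: "(\<Prod>j<p + q. indicator (ball (?z j) r) (append_fun p q w w' j)) = f w * g w'" for w w'
      unfolding f_def g_def prod_lessThan_add
      by (intro arg_cong2[where f="(*)"] prod.cong) (auto simp: append_fun_simps)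
    have zero: "f w * g w' = 0 \<or> ((\<forall>j<p. w j \<in> ball (x j) r) \<and> (\<forall>j<q. w' j \<in> ball (y j) r))" for w w'
    proof (rule disjCI)
      assume nb: "\<not> ((\<forall>j<p. w j \<in> ball (x j) r) \<and> (\<forall>j<q. w' j \<in> ball (y j) r))"
      then consider j where "j < p" "w j \<notin> ball (x j) r" | j where "j < q" "w' j \<notin> ball (y j) r" by blast
      then show "f w * g w' = 0"
      proof cases
        case 1
        then have "f w = 0" unfolding f_def by (intro prod_zero bexI[of _ j]) auto
        then show ?thesis by simp
      next
        case 2
        then have "g w' = 0" unfolding g_def by (intro prod_zero bexI[of _ j]) auto
        then show ?thesis by simp
      qed
    qed
    \<comment> \<open>The pointwise comparison is available for tuples in the boxes, where
      injectivity and the distance \<delta> persist; elsewhere the indicators \<open>f\<close> and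
      \<open>g\<close> make both sides 0.\<close>
    have cmp: "f w * g w' * zero_density n (p + q) (append_fun p q w w') \<le> ennreal \<theta> * ((f w * zero_density n p w) * (g w' * zero_density n q w'))"
      "(f w * zero_density n p w) * (g w' * zero_density n q w') \<le> ennreal \<theta> * (f w * g w' * zero_density n (p + q) (append_fun p q w w'))" for w w'
    proof -
      have "zero_density n (p + q) (append_fun p q w w') \<le> ennreal \<theta> * (zero_density n p w * zero_density n q w') \<and>
        zero_density n p w * zero_density n q w' \<le> ennreal \<theta> * zero_density n (p + q) (append_fun p q w w')"
        if b: "\<forall>j<p. w j \<in> ball (x j) r" "\<forall>j<q. w' j \<in> ball (y j) r"
      proof -
        have injw: "inj_on (append_fun p q w w') {..<p + q}"
          by (rule near) (use b in \<open>auto simp: append_fun_def\<close>)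
        have "cmod (ip n u v) \<le> \<epsilon> * hn n u * hn n v" if "u \<in> kers n p w" "v \<in> kers n q w'" for u v
          unfolding \<epsilon>(1) by (rule near_orthogonal[OF n(1) _ _ that]) (use n d(1) hdr b in \<open>auto intro: less_imp_le\<close>)
        from density_compare[OF injw k \<epsilon>0 \<epsilon>(2) this] show ?thesis unfolding \<theta>_def by blast
      qed
      then have Z: "f w * g w' = 0 \<or> (zero_density n (p + q) (append_fun p q w w') \<le> ennreal \<theta> * (zero_density n p w * zero_density n q w') \<and>
        zero_density n p w * zero_density n q w' \<le> ennreal \<theta> * zero_density n (p + q) (append_fun p q w w'))"
        using zero by blast
      have m1: "ennreal \<theta> * ((f w * zero_density n p w) * (g w' * zero_density n q w')) = (f w * g w') * (ennreal \<theta> * (zero_density n p w * zero_density n q w'))"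
        by (simp add: mult_ac)
      have m2: "(f w * zero_density n p w) * (g w' * zero_density n q w') = (f w * g w') * (zero_density n p w * zero_density n q w')"
        "ennreal \<theta> * (f w * g w' * zero_density n (p + q) (append_fun p q w w')) = (f w * g w') * (ennreal \<theta> * zero_density n (p + q) (append_fun p q w w'))"
        by (simp_all add: mult_ac)
      show "f w * g w' * zero_density n (p + q) (append_fun p q w w') \<le> ennreal \<theta> * ((f w * zero_density n p w) * (g w' * zero_density n q w'))"
        unfolding m1 using Z by (auto intro: mult_left_mono)
      show "(f w * zero_density n p w) * (g w' * zero_density n q w') \<le> ennreal \<theta> * (f w * g w' * zero_density n (p + q) (append_fun p q w w'))"
        unfolding m2 using Z by (auto intro: mult_left_mono)
    qed
    have J: "box_mass n (p + q) ?z r = (\<integral>\<^sup>+w. \<integral>\<^sup>+w'. f w * g w' * zero_density n (p + q) (append_fun p q w w') \<partial>cL q \<partial>cL p)"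
      unfolding box_mass_def split[symmetric]
      by (intro nn_integral_cL_append borel_measurable_times_ennreal measurable_box_indicator measurable_zero_density)
    have JJ: "box_mass n p x r * box_mass n q y r = (\<integral>\<^sup>+w. \<integral>\<^sup>+w'. (f w * zero_density n p w) * (g w' * zero_density n q w') \<partial>cL q \<partial>cL p)"
      unfolding box_mass_def f_def[symmetric] g_def[symmetric] by (rule nn_integral_times[symmetric]) measurable
    have le1: "box_mass n (p + q) ?z r \<le> ennreal \<theta> * (box_mass n p x r * box_mass n q y r)"
    proof -
      have "box_mass n (p + q) ?z r \<le> (\<integral>\<^sup>+w. \<integral>\<^sup>+w'. ennreal \<theta> * ((f w * zero_density n p w) * (g w' * zero_density n q w')) \<partial>cL q \<partial>cL p)"
        unfolding J by (intro nn_integral_mono cmp(1))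
      also have "\<dots> = ennreal \<theta> * (box_mass n p x r * box_mass n q y r)"
        unfolding JJ by (subst nn_integral_cmult[symmetric], measurable) (intro nn_integral_cong nn_integral_cmult, measurable)
      finally show ?thesis .
    qed
    have le2: "box_mass n p x r * box_mass n q y r \<le> ennreal \<theta> * box_mass n (p + q) ?z r"
    proof -
      have "box_mass n p x r * box_mass n q y r \<le> (\<integral>\<^sup>+w. \<integral>\<^sup>+w'. ennreal \<theta> * (f w * g w' * zero_density n (p + q) (append_fun p q w w')) \<partial>cL q \<partial>cL p)"
        unfolding JJ by (intro nn_integral_mono cmp(2))
      also have "\<dots> = ennreal \<theta> * box_mass n (p + q) ?z r"
        unfolding J by (subst nn_integral_cmult[symmetric], measurable) (intro nn_integral_cong nn_integral_cmult, measurable)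
      finally show ?thesis .
    qed
    have "ennreal (a - \<eta>) * disc_area r ^ (p + q) \<le> ennreal \<theta> * ((ennreal (b + \<eta>) * disc_area r ^ p) * (ennreal (c + \<eta>) * disc_area r ^ q))"
      using Ja(2) le1 by (rule order_trans[OF order_trans]) (intro mult_left_mono mult_mono Jb(1) Jc(1), auto)
    also have "\<dots> = ennreal (\<theta> * ((b + \<eta>) * (c + \<eta>))) * disc_area r ^ (p + q)"
      using \<theta> nn \<eta> by (simp add: ennreal_mult power_add mult_ac)
    finally have "ennreal (a - \<eta>) \<le> ennreal (\<theta> * ((b + \<eta>) * (c + \<eta>)))"
      by (rule ennreal_mult_disc_cancel[OF r])
    then show "a - \<eta> \<le> \<theta> * ((b + \<eta>) * (c + \<eta>))"
      using \<theta> nn \<eta> by (subst (asm) ennreal_le_iff) (auto intro!: mult_nonneg_nonneg)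
    \<comment> \<open>\<open>ennreal\<close> sends negative numbers to 0, in agreement with the
      cut-off.\<close>
    have eb: "ennreal (max 0 s) = ennreal s" for s by (simp add: max_def ennreal_neg)
    have "ennreal (max 0 (b - \<eta>) * max 0 (c - \<eta>)) * disc_area r ^ (p + q) = (ennreal (b - \<eta>) * disc_area r ^ p) * (ennreal (c - \<eta>) * disc_area r ^ q)"
      by (simp add: ennreal_mult eb power_add mult_ac)
    also have "\<dots> \<le> box_mass n p x r * box_mass n q y r" by (intro mult_mono Jb(2) Jc(2)) auto
    also have "\<dots> \<le> ennreal \<theta> * box_mass n (p + q) ?z r" by (rule le2)
    also have "\<dots> \<le> ennreal \<theta> * (ennreal (a + \<eta>) * disc_area r ^ (p + q))" by (intro mult_left_mono Ja(1)) simp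
    also have "\<dots> = ennreal (\<theta> * (a + \<eta>)) * disc_area r ^ (p + q)"
      using \<theta> nn \<eta> by (simp add: ennreal_mult mult_ac)
    finally have "ennreal (max 0 (b - \<eta>) * max 0 (c - \<eta>)) \<le> ennreal (\<theta> * (a + \<eta>))"
      by (rule ennreal_mult_disc_cancel[OF r])
    then show "max 0 (b - \<eta>) * max 0 (c - \<eta>) \<le> \<theta> * (a + \<eta>)"
      using \<theta> nn \<eta> by (subst (asm) ennreal_le_iff) (auto intro!: mult_nonneg_nonneg)
  qed
  have lim: "((\<lambda>\<eta>. h \<eta>) \<longlongrightarrow> h 0) (at_right 0)" if "isCont h 0" for h :: "real \<Rightarrow> real"
    using that by (simp add: isCont_def filterlim_at_split)
  have "((\<lambda>\<eta>. \<theta> * ((b + \<eta>) * (c + \<eta>)) - (a - \<eta>)) \<longlongrightarrow> \<theta> * ((b + 0) * (c + 0)) - (a - 0)) (at_right 0)"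
    by (rule lim) (intro continuous_intros)
  then have "0 \<le> \<theta> * ((b + 0) * (c + 0)) - (a - 0)"
    by (rule tendsto_lowerbound) (use main(1) in \<open>auto intro!: eventually_mono[OF pos]\<close>)
  then show "a \<le> \<theta> * (b * c)" by simp
  have "((\<lambda>\<eta>. \<theta> * (a + \<eta>) - max 0 (b - \<eta>) * max 0 (c - \<eta>)) \<longlongrightarrow> \<theta> * (a + 0) - max 0 (b - 0) * max 0 (c - 0)) (at_right 0)"
    by (rule lim) (intro continuous_intros)
  then have "0 \<le> \<theta> * (a + 0) - max 0 (b - 0) * max 0 (c - 0)"
    by (rule tendsto_lowerbound) (use main(2) in \<open>auto intro!: eventually_mono[OF pos]\<close>)
  then show "b * c \<le> \<theta> * a" using nn by simp
qed

text \<open>On \<open>[0, 2]\<close> the factor \<open>1 + x\<close> is at most 3, whence the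
  \<open>3 ^ m\<close>. The lemma turns a power of \<open>1 + 4 * \<epsilon>\<close> into an error
  linear in \<epsilon>.\<close>

lemma power_minus_one_le:
  assumes "0 \<le> (x::real)" "x \<le> 2"
  shows "(1 + x) ^ m \<le> 1 + real m * 3 ^ m * x"
proof (induction m)
  case (Suc m)
  have "(1 + x) ^ Suc m \<le> (1 + real m * 3 ^ m * x) * (1 + x)"
    using Suc assms by (simp add: mult_right_mono mult.commute)
  also have "\<dots> = 1 + x + real m * 3 ^ m * x * (1 + x)" by (simp add: algebra_simps)
  also have "\<dots> \<le> 1 + 3 ^ Suc m * x + real m * 3 ^ m * x * 3"
    using assms one_le_power[of "3::real" "Suc m"] by (intro add_mono mult_left_mono mult_right_mono order_refl mult_le_cancel_right1[THEN iffD2]) auto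
  also have "\<dots> = 1 + real (Suc m) * 3 ^ Suc m * x" by (simp add: algebra_simps)
  finally show ?case .
qed simp

section \<open>Splitting a tuple by index sets, and the clustering estimate\<close>

lemma nths_cong_set: "(\<And>i. i < length xs \<Longrightarrow> i \<in> A \<longleftrightarrow> i \<in> B) \<Longrightarrow> nths xs A = nths xs B"
  unfolding nths_def by (intro arg_cong[where f="map fst"] filter_cong) (auto dest: set_zip_rightD)

lemma mset_nths_Compl: "mset (nths xs A) + mset (nths xs (- A)) = mset xs"
proof (induction xs arbitrary: A)
  case (Cons x xs)
  have "{j. Suc j \<in> - A} = - {j. Suc j \<in> A}" by auto
  then show ?case using Cons[of "{j. Suc j \<in> A}"] by (simp add: nths_Cons)
qed simp

theorem theorem1p3:
  fixes k :: nat
  assumes "k \<ge> 2"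
  shows "\<exists>c C D :: real. c > 0 \<and> C > 0 \<and> D > 0 \<and>
    (\<forall>\<^sub>F n in sequentially.
      \<forall>\<rho> :: complex list \<Rightarrow> real. (\<forall>l\<in>{1..k}. is_point_function n l \<rho>) \<longrightarrow>
        (\<forall>(Z :: complex list) (I :: nat set) (J :: nat set).
          length Z = k \<and> distinct Z \<and>
          I \<union> J = {..<k} \<and> I \<inter> J = {} \<and> I \<noteq> {} \<and> J \<noteq> {} \<and>
          tuple_dist (nths Z I) (nths Z J) \<ge> D / sqrt (real n) \<longrightarrow>
          \<bar>\<rho> Z - \<rho> (nths Z I) * \<rho> (nths Z J)\<bar>
            \<le> C * real n ^ k * exp (- c * real n * (tuple_dist (nths Z I) (nths Z J))\<^sup>2)))"
proof -
  have "\<exists>K. \<forall>l. K l > 0 \<and> (\<forall>n z. n > 0 \<and> 2 * l \<le> n \<and> inj_on z {..<l} \<longrightarrow> zero_density n l z \<le> ennreal (K l * real n ^ l))"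
    using zero_density_bound by (intro choice) blast
  then obtain K where K: "\<And>l. K l > 0" "\<And>l n z. n > 0 \<Longrightarrow> 2 * l \<le> n \<Longrightarrow> inj_on z {..<l} \<Longrightarrow> zero_density n l z \<le> ennreal (K l * real n ^ l)"
    by blast
  \<comment> \<open>A common constant for groups of every size up to \<open>k\<close>.\<close>
  define Km where "Km = (\<Sum>l\<le>k. K l)"
  have Km: "K l \<le> Km" if "l \<le> k" for l
    unfolding Km_def using that K(1) by (intro member_le_sum) (auto simp: less_imp_le)
  have Km0: "Km > 0" using Km[of 0] K(1)[of 0] by linarith
  \<comment> \<open>Bounds the prefactor of \<epsilon> for all group sizes, the interpolation
    constants being monotone in the number of nodes.\<close>
  define E0 where "E0 = interp_const (2 * k) * interp_const (2 * k) * exp 5"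
  have E0: "E0 \<ge> 1"
  proof -
    have "1 * 1 \<le> interp_const (2 * k) * interp_const (2 * k)"
      using interp_const_ge_1[of "2 * k"] by (intro mult_mono) auto
    then have "1 * 1 \<le> (interp_const (2 * k) * interp_const (2 * k)) * exp 5" by (intro mult_mono) auto
    then show ?thesis by (simp add: E0_def)
  qed
  define D where "D = 8 * sqrt (ln (2 * E0))"
  have ln0: "ln (2 * E0) > 0" using E0 by simp
  have D: "D > 0" using ln0 by (simp add: D_def)
  \<comment> \<open>The bound for \<open>(\<theta> - 1) / e\<close> times the bound for
    \<open>\<theta> * (b * c) / n ^ k\<close>.\<close>
  define C where "C = 4 * E0 * (real (2 * k) * 3 ^ (2 * k)) * (3 ^ (2 * k) * (Km * Km))"
  have C: "C > 0" using E0 Km0 assms by (simp add: C_def)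
  have "\<forall>\<rho> :: complex list \<Rightarrow> real. (\<forall>l\<in>{1..k}. is_point_function n l \<rho>) \<longrightarrow>
        (\<forall>(Z :: complex list) (I :: nat set) (J :: nat set).
          length Z = k \<and> distinct Z \<and>
          I \<union> J = {..<k} \<and> I \<inter> J = {} \<and> I \<noteq> {} \<and> J \<noteq> {} \<and>
          tuple_dist (nths Z I) (nths Z J) \<ge> D / sqrt (real n) \<longrightarrow>
          \<bar>\<rho> Z - \<rho> (nths Z I) * \<rho> (nths Z J)\<bar>
            \<le> C * real n ^ k * exp (- (1 / 64) * real n * (tuple_dist (nths Z I) (nths Z J))\<^sup>2))"
    if n2: "n \<ge> 2 * k" for n
  proof (intro allI impI, elim conjE)
    fix \<rho> :: "complex list \<Rightarrow> real" and Z :: "complex list" and I J :: "nat set"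
    assume pf: "\<forall>l\<in>{1..k}. is_point_function n l \<rho>"
      and Z: "length Z = k" "distinct Z" and IJ: "I \<union> J = {..<k}" "I \<inter> J = {}" "I \<noteq> {}" "J \<noteq> {}"
      and dist: "D / sqrt (real n) \<le> tuple_dist (nths Z I) (nths Z J)"
    have n: "n > 0" using n2 assms by simp
    define X where "X = nths Z I"
    define Y where "Y = nths Z J"
    define p where "p = length X"
    define q where "q = length Y"
    define d where "d = tuple_dist X Y"
    have dist: "D / sqrt (real n) \<le> d" using dist by (simp add: d_def X_def Y_def)
    have "D / sqrt (real n) > 0" using D n by simp
    then have d0: "d > 0" using dist by linarith
    \<comment> \<open>\<open>nths\<close> ignores indices beyond the length, so \<open>J\<close> may
      be replaced by the complement of \<open>I\<close>.\<close>
    have YC: "Y = nths Z (- I)" unfolding Y_def by (rule nths_cong_set) (use IJ Z in auto)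
    have ms: "mset (X @ Y) = mset Z" unfolding X_def YC using mset_nths_Compl[of Z I] by simp
    have pqk: "p + q = k" using arg_cong[OF ms, of size] Z(1) by (simp add: p_def q_def)
    have "{i. i < length Z \<and> i \<in> I} = I" "{i. i < length Z \<and> i \<in> J} = J" using IJ Z by auto
    then have "p = card I" "q = card J" by (simp_all add: p_def q_def X_def Y_def length_nths)
    moreover have "finite I" "finite J" using IJ(1) by (metis finite_Un finite_lessThan)+
    ultimately have pq0: "p > 0" "q > 0" using IJ by (simp_all add: card_gt_0_iff)
    have pfs: "is_point_function n (p + q) \<rho>" "is_point_function n p \<rho>" "is_point_function n q \<rho>"
      using pf pq0 pqk by auto
    define x where "x j = X ! j" for j
    define y where "y j = Y ! j" for j
    let ?z = "append_fun p q x y"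
    have mx: "map x [0..<p] = X" "map y [0..<q] = Y"
      unfolding x_def y_def p_def q_def by (rule map_nth)+
    have mz: "map ?z [0..<p + q] = X @ Y"
      by (rule nth_equalityI) (auto simp: p_def q_def append_fun_def x_def y_def nth_append)
    have dXY: "distinct (X @ Y)" using ms Z(2) by (metis mset_eq_imp_distinct_iff)
    have inj: "inj_on ?z {..<p + q}"
      using dXY unfolding mz[symmetric] distinct_map by (simp add: atLeast0LessThan)
    \<comment> \<open>The entries of \<open>X @ Y\<close> are those of \<open>Z\<close> in another
      order, and \<rho> is symmetric.\<close>
    have \<rho>Z: "\<rho> (X @ Y) = \<rho> Z"
    proof -
      have sym: "\<forall>V W. length V = p + q \<and> distinct V \<and> mset W = mset V \<longrightarrow> \<rho> W = \<rho> V"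
        using pfs(1) unfolding is_point_function_def by (elim conjE)
      show ?thesis by (rule sym[rule_format]) (use Z pqk ms in simp)
    qed
    \<comment> \<open>Half of \<open>d / 2\<close>, the least \<open>hdist\<close> between the
      groups. The strict inequality survives small displacements of the points, and
      \<open>n * \<delta>\<^sup>2 / 4\<close> becomes \<open>n * d\<^sup>2 / 64\<close>.\<close>
    define \<delta> where "\<delta> = d / 4"
    define \<epsilon> where "\<epsilon> = interp_const (2 * p) * interp_const (2 * q) * exp (5 - real n * \<delta>\<^sup>2 / 4)"
    have hd: "\<delta> < hdist (x i) (y j)" if "i < p" "j < q" for i j
    proof -
      have "d \<le> sphere_dist (x i) (y j)"
        unfolding d_def tuple_dist_def using that
        by (intro Min_le) (auto simp: x_def y_def p_def q_def intro!: image_eqI[of _ _ "(X ! i, Y ! j)"])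
      then show ?thesis using d0 by (simp add: sphere_dist_hdist \<delta>_def)
    qed
    define e where "e = exp (- (1 / 64) * real n * d\<^sup>2)"
    have e5: "exp (5 - real n * \<delta>\<^sup>2 / 4) = exp 5 * e"
      by (simp add: e_def exp_add[symmetric] \<delta>_def power_divide)
    have \<epsilon>E: "\<epsilon> \<le> E0 * e"
    proof -
      have "interp_const (2 * p) * interp_const (2 * q) \<le> interp_const (2 * k) * interp_const (2 * k)"
        using interp_const_ge_1 pqk by (intro mult_mono interp_const_mono) (auto intro: order_trans[of 0 1])
      then show ?thesis unfolding \<epsilon>_def e5 E0_def by (simp add: mult.assoc[symmetric] mult_right_mono e_def)
    qed
    have eb: "E0 * e \<le> 1 / 2"
    proof -
      have "D\<^sup>2 \<le> real n * d\<^sup>2"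
      proof -
        have "(D / sqrt (real n))\<^sup>2 \<le> d\<^sup>2" using dist D by (intro power_mono) auto
        then show ?thesis using n by (simp add: power_divide divide_le_eq mult.commute)
      qed
      then have "64 * ln (2 * E0) \<le> real n * d\<^sup>2" using ln0 by (simp add: D_def power_mult_distrib)
      then have "e \<le> exp (- ln (2 * E0))" unfolding e_def by simp
      also have "\<dots> = 1 / (2 * E0)" using E0 by (simp add: exp_minus inverse_eq_divide)
      finally show ?thesis using E0 by (simp add: field_simps)
    qed
    have \<epsilon>0: "\<epsilon> \<ge> 0" unfolding \<epsilon>_def using interp_const_ge_1[of "2 * p"] interp_const_ge_1[of "2 * q"]
      by (intro mult_nonneg_nonneg) auto
    have \<epsilon>2: "\<epsilon> \<le> 1 / 2" using \<epsilon>E eb by linarith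
    define a where "a = \<rho> Z"
    define b where "b = \<rho> X"
    define c where "c = \<rho> Y"
    define \<theta> where "\<theta> = (1 + 4 * \<epsilon>) ^ (2 * k)"
    have "2 * (p + q) \<le> n" using n2 pqk by simp
    from point_function_compare[OF pfs n this inj _ hd \<epsilon>_def \<epsilon>2]
    have cmp: "a \<le> \<theta> * (b * c)" "b * c \<le> \<theta> * a"
      using d0 unfolding pqk mz[unfolded pqk] mx \<rho>Z a_def b_def c_def \<theta>_def by (simp_all add: \<delta>_def)
    note injs = inj_on_append_funD[OF inj]
    have "distinct X" "distinct Y" using dXY by auto
    moreover have "\<forall>V. length V = l \<and> distinct V \<longrightarrow> 0 \<le> \<rho> V" if "is_point_function n l \<rho>" for l
      using that unfolding is_point_function_def by (elim conjE)
    ultimately have nn: "b \<ge> 0" "c \<ge> 0"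
      using pfs(2,3) unfolding b_def c_def p_def q_def by simp_all
    have bb: "b \<le> Km * real n ^ p"
    proof -
      have "\<rho> (map x [0..<p]) \<le> K p * real n ^ p"
        by (rule point_function_bound[OF pfs(2) n _ injs(1)]) (use n n2 pqk K in auto)
      also have "\<dots> \<le> Km * real n ^ p" using Km[of p] pqk by (intro mult_right_mono) auto
      finally show ?thesis by (simp add: mx b_def)
    qed
    have cb: "c \<le> Km * real n ^ q"
    proof -
      have "\<rho> (map y [0..<q]) \<le> K q * real n ^ q"
        by (rule point_function_bound[OF pfs(3) n _ injs(2)]) (use n n2 pqk K in auto)
      also have "\<dots> \<le> Km * real n ^ q" using Km[of q] pqk by (intro mult_right_mono) auto
      finally show ?thesis by (simp add: mx c_def)
    qed
    have bc: "b * c \<le> Km * Km * real n ^ k"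
    proof -
      have "b * c \<le> (Km * real n ^ p) * (Km * real n ^ q)"
        using bb cb nn Km0 by (intro mult_mono) auto
      also have "\<dots> = Km * Km * real n ^ k" by (simp add: pqk[symmetric] power_add mult_ac)
      finally show ?thesis .
    qed
    have \<theta>1: "\<theta> \<ge> 1" unfolding \<theta>_def using \<epsilon>0 by (intro one_le_power) simp
    have \<theta>3: "\<theta> \<le> 3 ^ (2 * k)" unfolding \<theta>_def using \<epsilon>0 \<epsilon>2 by (intro power_mono) auto
    have \<theta>m: "\<theta> - 1 \<le> 4 * E0 * (real (2 * k) * 3 ^ (2 * k)) * e"
    proof -
      have "\<theta> \<le> 1 + real (2 * k) * 3 ^ (2 * k) * (4 * \<epsilon>)"
        unfolding \<theta>_def using \<epsilon>0 \<epsilon>2 by (intro power_minus_one_le) auto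
      also have "\<dots> \<le> 1 + real (2 * k) * 3 ^ (2 * k) * (4 * (E0 * e))"
        using \<epsilon>E by (intro add_left_mono mult_left_mono) auto
      finally show ?thesis by (simp add: mult_ac)
    qed
    have bc0: "b * c \<ge> 0" using nn by simp
    \<comment> \<open>Either difference is at most \<open>\<theta> - 1\<close> times its subtrahend,
      and both subtrahends are at most \<open>\<theta> * (b * c)\<close>.\<close>
    have "\<bar>a - b * c\<bar> \<le> (\<theta> - 1) * (\<theta> * (b * c))"
    proof -
      have "a - b * c \<le> (\<theta> - 1) * (b * c)" using cmp(1) by (simp add: algebra_simps)
      also have "\<dots> \<le> (\<theta> - 1) * (\<theta> * (b * c))"
        using \<theta>1 bc0 mult_right_mono[of 1 \<theta> "b * c"] by (intro mult_left_mono) auto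
      finally have 1: "a - b * c \<le> (\<theta> - 1) * (\<theta> * (b * c))" .
      have "b * c - a \<le> (\<theta> - 1) * a" using cmp(2) by (simp add: algebra_simps)
      also have "\<dots> \<le> (\<theta> - 1) * (\<theta> * (b * c))" using \<theta>1 cmp(1) by (intro mult_left_mono) auto
      finally show ?thesis using 1 by linarith
    qed
    also have "\<dots> \<le> (4 * E0 * (real (2 * k) * 3 ^ (2 * k)) * e) * (3 ^ (2 * k) * (Km * Km * real n ^ k))"
    proof (rule mult_mono[OF \<theta>m])
      show "\<theta> * (b * c) \<le> 3 ^ (2 * k) * (Km * Km * real n ^ k)"
        by (rule mult_mono[OF \<theta>3 bc _ bc0]) simp
      show "0 \<le> 4 * E0 * (real (2 * k) * 3 ^ (2 * k)) * e" using \<theta>m \<theta>1 by linarith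
      show "0 \<le> \<theta> * (b * c)" using \<theta>1 bc0 by simp
    qed
    also have "\<dots> = C * real n ^ k * e" by (simp add: C_def mult_ac)
    finally show "\<bar>\<rho> Z - \<rho> (nths Z I) * \<rho> (nths Z J)\<bar> \<le> C * real n ^ k * exp (- (1 / 64) * real n * (tuple_dist (nths Z I) (nths Z J))\<^sup>2)"
      by (simp only: a_def b_def c_def X_def Y_def e_def d_def)
  qed
  then have ev: "\<forall>\<^sub>F n in sequentially. \<forall>\<rho> :: complex list \<Rightarrow> real. (\<forall>l\<in>{1..k}. is_point_function n l \<rho>) \<longrightarrow>
        (\<forall>(Z :: complex list) (I :: nat set) (J :: nat set).
          length Z = k \<and> distinct Z \<and>
          I \<union> J = {..<k} \<and> I \<inter> J = {} \<and> I \<noteq> {} \<and> J \<noteq> {} \<and>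
          tuple_dist (nths Z I) (nths Z J) \<ge> D / sqrt (real n) \<longrightarrow>
          \<bar>\<rho> Z - \<rho> (nths Z I) * \<rho> (nths Z J)\<bar>
            \<le> C * real n ^ k * exp (- (1 / 64) * real n * (tuple_dist (nths Z I) (nths Z J))\<^sup>2))"
    by (rule eventually_sequentiallyI)
  show ?thesis
    by (rule exI[of _ "1 / 64"], rule exI[of _ C], rule exI[of _ D]) (intro conjI C D ev, simp)
qed

end
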